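(* On a quaternionic manifold $M$ of real dimension $4n$, we have $d=\mathcal{D}+\overline{\mathcal{D}}$, and so $$\mathcal{D}^2=\mathcal{D}\overline{\mathcal{D}}+\overline{\mathcal{D}}\mathcal{D}=\overline{\mathcal{D}}^2=0 .$$
   Context: A quaternionic manifold is, for $n\ge 2$, a real $4n$-manifold $M$ with an $\mathrm{Sp}(1)\mathrm{GL}(n,\mathbb{H})$-structure $Q$ admitting a torsion-free connection; here $\mathrm{Sp}(1)\mathrm{GL}(n,\mathbb{H})=\mathrm{Sp}(1)\times_{\mathbb{Z}_2}\mathrm{GL}(n,\mathbb{H})\subset \mathrm{GL}(4n,\mathbb{R})$ acts on $\mathbb{H}^n$, with $\mathrm{Sp}(1)$ the unit quaternions acting by left multiplication and $\mathrm{GL}(n,\mathbb{H})$ acting by right multiplication by quaternionic matrices. For $n=1$ a quaternionic manifold means a self-dual conformal 4-manifold (with the induced $\mathrm{Sp}(1)\mathrm{GL}(1,\mathbb{H})$-structure). The structure gives locally defined almost complex structures $I,J,K$ with $IJ=K$, well defined up to rotation. They act on $T^*M$ (with $IJ=K$ there too) and, extended by derivations, on $\Lambda^kT^*M$, giving an action of $\mathfrak{sp}(1)=\langle I,J,K\rangle$. The Casimir operator $I^2+J^2+K^2$ on $\Lambda^kT^*M$ is globally well defined. $E_{k,r}\subset\Lambda^kT^*M$ is the subbundle consisting of the $\mathrm{Sp}(1)$-representations with highest weight $r$ (copies of $V_r=S^r(\mathbb{C}^2)$); equivalently, the eigenbundle of $I^2+J^2+K^2$ on $\Lambda^kT^*M$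 with eigenvalue $-r(r+2)$. It is zero unless $0\le r\le k$ and $r\equiv k\bmod 2$; also $E_{k,-1}=0$. One has $\Lambda^kT^*M=\bigoplus_{r=0}^kE_{k,r}$. Let $\pi_{k,r}:\Lambda^kT^*M\to E_{k,r}$ be the natural projection. Define $$\mathcal{D}=\pi_{k+1,r+1}\circ d:C^\infty(E_{k,r})\to C^\infty(E_{k+1,r+1}),\qquad \overline{\mathcal{D}}=\pi_{k+1,r-1}\circ d:C^\infty(E_{k,r})\to C^\infty(E_{k+1,r-1}),$$ extended additively to all forms. *)

theory Defs
  imports "HOL-Analysis.Analysis"
begin

section \<open>Quaternions and the group Sp(1)GL(n,H)\<close>

text \<open>The components of index 1, 2, 3, 4 are the coefficients of 1, i, j, k.\<close>

type_synonym quat = "real^4"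

definition qmul :: "quat \<Rightarrow> quat \<Rightarrow> quat" where
  "qmul p q = (\<chi> m.
     if m = 1 then p$1 * q$1 - p$2 * q$2 - p$3 * q$3 - p$4 * q$4
     else if m = 2 then p$1 * q$2 + p$2 * q$1 + p$3 * q$4 - p$4 * q$3
     else if m = 3 then p$1 * q$3 - p$2 * q$4 + p$3 * q$1 + p$4 * q$2
     else p$1 * q$4 + p$2 * q$3 - p$3 * q$2 + p$4 * q$1)"

definition q1 :: quat where "q1 = axis 1 1"
definition qi :: quat where "qi = axis 2 1"
definition qj :: quat where "qj = axis 3 1"
definition qk :: quat where "qk = axis 4 1"

definition left_mult :: "quat \<Rightarrow> quat^'n \<Rightarrow> quat^'n" where
  "left_mult q v = (\<chi> m. qmul q (v$m))"

definition right_mult :: "quat^'n^'n \<Rightarrow> quat^'n \<Rightarrow> quat^'n" where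
  "right_mult B v = (\<chi> m. \<Sum>l\<in>UNIV. qmul (v$l) (B$l$m))"

definition qmat_mul :: "quat^'n^'n \<Rightarrow> quat^'n^'n \<Rightarrow> quat^'n^'n" where
  "qmat_mul B C = (\<chi> l m. \<Sum>h\<in>UNIV. qmul (B$l$h) (C$h$m))"

definition qmat_one :: "quat^'n^'n" where
  "qmat_one = (\<chi> l m. if l = m then q1 else 0)"

definition qmat_invertible :: "quat^'n^'n \<Rightarrow> bool" where
  "qmat_invertible B \<longleftrightarrow> (\<exists>C. qmat_mul B C = qmat_one \<and> qmat_mul C B = qmat_one)"

definition Sp1GL :: "(quat^'n \<Rightarrow> quat^'n) set" where
  "Sp1GL = {left_mult q \<circ> right_mult B | q B. norm q = 1 \<and> qmat_invertible B}"

text \<open>The Lie algebra of \<^const>\<open>Sp1GL\<close>: left multiplications by imaginary quaternions plus right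
  multiplications by arbitrary quaternionic matrices.\<close>

definition sp1gl :: "(quat^'n \<Rightarrow> quat^'n) set" where
  "sp1gl = {\<lambda>v. left_mult p v + right_mult B v | p B. p$1 = 0}"


section \<open>Smooth manifolds\<close>

text \<open>\<open>Ck_on\<close> and \<open>smooth_on\<close> are only meant for open sets \<open>S\<close>.\<close>

primrec Ck_on :: "nat \<Rightarrow> ('e::euclidean_space \<Rightarrow> 'b::real_normed_vector) \<Rightarrow> 'e set \<Rightarrow> bool" where
  "Ck_on 0 f S \<longleftrightarrow> continuous_on S f"
| "Ck_on (Suc k) f S \<longleftrightarrow> (\<forall>x\<in>S. f differentiable (at x)) \<and>
     (\<forall>v. Ck_on k (\<lambda>x. frechet_derivative f (at x) v) S)"

definition smooth_on :: "('e::euclidean_space \<Rightarrow> 'b::real_normed_vector) \<Rightarrow> 'e set \<Rightarrow> bool" where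
  "smooth_on f S \<longleftrightarrow> (\<forall>k. Ck_on k f S)"

text \<open>A chart is a pair of its domain and its coordinate map. The model space of a 4n-dimensional
  manifold is H^n, with n the cardinality of the index type.\<close>

type_synonym ('a, 'n) chart = "'a set \<times> ('a \<Rightarrow> quat^'n)"

definition chart_image :: "('a, 'n) chart \<Rightarrow> (quat^'n) set" where
  "chart_image c = snd c ` fst c"

definition overlap :: "('a, 'n) chart \<Rightarrow> ('a, 'n) chart \<Rightarrow> (quat^'n) set" where
  "overlap c c' = snd c ` (fst c \<inter> fst c')"

definition transition :: "('a, 'n) chart \<Rightarrow> ('a, 'n) chart \<Rightarrow> quat^'n \<Rightarrow> quat^'n" where
  "transition c c' = snd c' \<circ> inv_into (fst c) (snd c)"

definition dtransition ::
    "('a, 'n::finite) chart \<Rightarrow> ('a, 'n) chart \<Rightarrow> quat^'n \<Rightarrow> quat^'n \<Rightarrow> quat^'n" where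
  "dtransition c c' x = frechet_derivative (transition c c') (at x)"

definition smooth_manifold :: "'a topology \<Rightarrow> ('a, 'n::finite) chart set \<Rightarrow> bool" where
  "smooth_manifold X A \<longleftrightarrow>
     Hausdorff_space X \<and> second_countable X \<and> (\<Union>c\<in>A. fst c) = topspace X \<and>
     (\<forall>c\<in>A. openin X (fst c) \<and> open (chart_image c) \<and>
        homeomorphic_map (subtopology X (fst c)) (top_of_set (chart_image c)) (snd c)) \<and>
     (\<forall>c\<in>A. \<forall>c'\<in>A. smooth_on (transition c c') (overlap c c'))"

text \<open>Every geometric object on a manifold (form, metric, connection, frame bundle) is given by
  its coordinate representations in the charts of the atlas, subject to the transformation law on
  overlaps: a tangent vector at the point with coordinates \<open>x\<close> in the chart \<open>c\<close> is represented by
  \<open>v\<close> in \<open>c\<close> and by \<open>dtransition c c' x v\<close> in \<open>c'\<close>. The values of a representation outside of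
  the image of the chart, or for a chart not in the atlas, are irrelevant.\<close>


section \<open>Differential forms\<close>

text \<open>An element of the full exterior algebra of the dual of \<open>'e\<close> is a function on lists
  of vectors; its restriction to the lists of length \<open>k\<close> is its component of degree \<open>k\<close>.\<close>

type_synonym 'e multiform = "'e list \<Rightarrow> real"

definition exterior :: "'e::euclidean_space multiform \<Rightarrow> bool" where
  "exterior \<alpha> \<longleftrightarrow> (\<forall>us vs. linear (\<lambda>v. \<alpha> (us @ v # vs))) \<and>
     (\<forall>us v vs ws. \<alpha> (us @ v # vs @ v # ws) = 0)"

definition exterior_power :: "nat \<Rightarrow> 'e::euclidean_space multiform set" where
  "exterior_power k = {\<alpha>. exterior \<alpha> \<and> (\<forall>vs. length vs \<noteq> k \<longrightarrow> \<alpha> vs = 0)}"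

definition degree_part :: "nat \<Rightarrow> 'e multiform \<Rightarrow> 'e multiform" where
  "degree_part k \<alpha> vs = (if length vs = k then \<alpha> vs else 0)"

type_synonym ('a, 'n) form_field = "('a, 'n) chart \<Rightarrow> quat^'n \<Rightarrow> (quat^'n) multiform"

text \<open>Smooth forms, not necessarily homogeneous.\<close>

definition smooth_form :: "('a, 'n::finite) chart set \<Rightarrow> ('a, 'n) form_field \<Rightarrow> bool" where
  "smooth_form A \<omega> \<longleftrightarrow>
     (\<forall>c\<in>A. \<forall>x\<in>chart_image c. exterior (\<omega> c x)) \<and>
     (\<forall>c\<in>A. \<forall>vs. smooth_on (\<lambda>x. \<omega> c x vs) (chart_image c)) \<and>
     (\<forall>c\<in>A. \<forall>c'\<in>A. \<forall>x\<in>overlap c c'. \<forall>vs.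
        \<omega> c x vs = \<omega> c' (transition c c' x) (map (dtransition c c' x) vs))"

definition ext_deriv :: "('a, 'n::finite) form_field \<Rightarrow> ('a, 'n) form_field" where
  "ext_deriv \<omega> c x vs = (\<Sum>m<length vs. (- 1) ^ m *
     frechet_derivative (\<lambda>y. \<omega> c y (take m vs @ drop (Suc m) vs)) (at x) (vs ! m))"


section \<open>Sp(1)GL(n,H)-structures and connections\<close>

text \<open>\<open>Q c x\<close> is the set of the frames of the structure, seen as linear isomorphisms from H^n onto
  the tangent space at the point with coordinates \<open>x\<close> in \<open>c\<close>.\<close>

type_synonym ('a, 'n) frame_bundle =
  "('a, 'n) chart \<Rightarrow> quat^'n \<Rightarrow> (quat^'n \<Rightarrow> quat^'n) set"

definition smooth_section ::
    "('a, 'n::finite) frame_bundle \<Rightarrow> ('a, 'n) chart \<Rightarrow> (quat^'n) set \<Rightarrow>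
      (quat^'n \<Rightarrow> quat^'n \<Rightarrow> quat^'n) \<Rightarrow> bool" where
  "smooth_section Q c W s \<longleftrightarrow> (\<forall>y\<in>W. s y \<in> Q c y) \<and> (\<forall>v. smooth_on (\<lambda>y. s y v) W)"

definition Sp1GL_structure ::
    "('a, 'n::finite) chart set \<Rightarrow> ('a, 'n) frame_bundle \<Rightarrow> bool" where
  "Sp1GL_structure A Q \<longleftrightarrow>
     (\<forall>c\<in>A. \<forall>x\<in>chart_image c. \<forall>f\<in>Q c x.
        linear f \<and> bij f \<and> Q c x = {f \<circ> h | h. h \<in> Sp1GL}) \<and>
     (\<forall>c\<in>A. \<forall>x\<in>chart_image c. \<exists>W s. open W \<and> x \<in> W \<and> W \<subseteq> chart_image c \<and>
        smooth_section Q c W s) \<and>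
     (\<forall>c\<in>A. \<forall>c'\<in>A. \<forall>x\<in>overlap c c'.
        Q c' (transition c c' x) = {dtransition c c' x \<circ> f | f. f \<in> Q c x})"

text \<open>Affine connections are given by their Christoffel symbols: in the chart \<open>c\<close>, the covariant
  derivative of the vector field \<open>Y\<close> in the direction \<open>u\<close> is \<open>DY(u) + \<Gamma> c x u (Y x)\<close>.\<close>

type_synonym ('a, 'n) christoffel =
  "('a, 'n) chart \<Rightarrow> quat^'n \<Rightarrow> quat^'n \<Rightarrow> quat^'n \<Rightarrow> quat^'n"

definition affine_connection ::
    "('a, 'n::finite) chart set \<Rightarrow> ('a, 'n) christoffel \<Rightarrow> bool" where
  "affine_connection A \<Gamma> \<longleftrightarrow>
     (\<forall>c\<in>A. \<forall>x\<in>chart_image c. bilinear (\<Gamma> c x)) \<and>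
     (\<forall>c\<in>A. \<forall>u v. smooth_on (\<lambda>x. \<Gamma> c x u v) (chart_image c)) \<and>
     (\<forall>c\<in>A. \<forall>c'\<in>A. \<forall>x\<in>overlap c c'. \<forall>u v.
        \<Gamma> c' (transition c c' x) (dtransition c c' x u) (dtransition c c' x v) =
          dtransition c c' x (\<Gamma> c x u v) -
          frechet_derivative (\<lambda>y. dtransition c c' y v) (at x) u)"

definition torsion_free ::
    "('a, 'n::finite) chart set \<Rightarrow> ('a, 'n) christoffel \<Rightarrow> bool" where
  "torsion_free A \<Gamma> \<longleftrightarrow> (\<forall>c\<in>A. \<forall>x\<in>chart_image c. \<forall>u v. \<Gamma> c x u v - \<Gamma> c x v u = 0)"

text \<open>A connection on the structure \<open>Q\<close>: its connection form, with respect to any local section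
  \<open>s\<close> of \<open>Q\<close>, takes its values \<open>\<theta>\<close> in the Lie algebra.\<close>

definition structure_connection ::
    "('a, 'n::finite) chart set \<Rightarrow> ('a, 'n) frame_bundle \<Rightarrow> ('a, 'n) christoffel \<Rightarrow> bool" where
  "structure_connection A Q \<Gamma> \<longleftrightarrow> affine_connection A \<Gamma> \<and>
     (\<forall>c\<in>A. \<forall>W s. open W \<and> W \<subseteq> chart_image c \<and> smooth_section Q c W s \<longrightarrow>
        (\<forall>x\<in>W. \<forall>u. \<exists>\<theta>\<in>sp1gl. \<forall>v.
           frechet_derivative (\<lambda>y. s y v) (at x) u + \<Gamma> c x u (s x v) = s x (\<theta> v)))"


section \<open>Self-dual conformal 4-manifolds\<close>

type_synonym ('a, 'n) metric_field =
  "('a, 'n) chart \<Rightarrow> quat^'n \<Rightarrow> quat^'n \<Rightarrow> quat^'n \<Rightarrow> real"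

definition riemannian_metric ::
    "('a, 'n::finite) chart set \<Rightarrow> ('a, 'n) metric_field \<Rightarrow> bool" where
  "riemannian_metric A g \<longleftrightarrow>
     (\<forall>c\<in>A. \<forall>x\<in>chart_image c. bilinear (g c x) \<and>
        (\<forall>u v. g c x u v = g c x v u) \<and> (\<forall>u. u \<noteq> 0 \<longrightarrow> g c x u u > 0)) \<and>
     (\<forall>c\<in>A. \<forall>u v. smooth_on (\<lambda>x. g c x u v) (chart_image c)) \<and>
     (\<forall>c\<in>A. \<forall>c'\<in>A. \<forall>x\<in>overlap c c'. \<forall>u v.
        g c x u v = g c' (transition c c' x) (dtransition c c' x u) (dtransition c c' x v))"

definition levi_civita ::
    "('a, 'n::finite) chart set \<Rightarrow> ('a, 'n) metric_field \<Rightarrow> ('a, 'n) christoffel \<Rightarrow> bool" where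
  "levi_civita A g \<Gamma> \<longleftrightarrow> affine_connection A \<Gamma> \<and> torsion_free A \<Gamma> \<and>
     (\<forall>c\<in>A. \<forall>x\<in>chart_image c. \<forall>u v w.
        frechet_derivative (\<lambda>y. g c y v w) (at x) u =
          g c x (\<Gamma> c x u v) w + g c x v (\<Gamma> c x u w))"

definition curvature ::
    "('a, 'n::finite) christoffel \<Rightarrow> ('a, 'n) chart \<Rightarrow> quat^'n \<Rightarrow>
      quat^'n \<Rightarrow> quat^'n \<Rightarrow> quat^'n \<Rightarrow> quat^'n" where
  "curvature \<Gamma> c x u v w =
     frechet_derivative (\<lambda>y. \<Gamma> c y v w) (at x) u - frechet_derivative (\<lambda>y. \<Gamma> c y u w) (at x) v
     + \<Gamma> c x u (\<Gamma> c x v w) - \<Gamma> c x v (\<Gamma> c x u w)"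

text \<open>The trace of \<open>u \<mapsto> R(u,v)w\<close>, which may be computed in any basis.\<close>

definition ricci ::
    "('a, 'n::finite) christoffel \<Rightarrow> ('a, 'n) chart \<Rightarrow> quat^'n \<Rightarrow> quat^'n \<Rightarrow> quat^'n \<Rightarrow> real" where
  "ricci \<Gamma> c x v w = (\<Sum>b\<in>Basis. curvature \<Gamma> c x b v w \<bullet> b)"

definition orthonormal_frames ::
    "('a, 'n::finite) metric_field \<Rightarrow> ('a, 'n) chart \<Rightarrow> quat^'n \<Rightarrow> (quat^'n \<Rightarrow> quat^'n) set" where
  "orthonormal_frames g c x = {f. linear f \<and> (\<forall>u v. g c x (f u) (f v) = u \<bullet> v)}"

definition scalar_curvature ::
    "('a, 'n::finite) metric_field \<Rightarrow> ('a, 'n) christoffel \<Rightarrow> ('a, 'n) chart \<Rightarrow> quat^'n \<Rightarrow> real" where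
  "scalar_curvature g \<Gamma> c x = (THE r. \<forall>f\<in>orthonormal_frames g c x.
     r = (\<Sum>b\<in>Basis. ricci \<Gamma> c x (f b) (f b)))"

text \<open>The Schouten and Weyl tensors in dimension 4. The sign convention for the curvature tensor
  \<open>g(R(u,v)w,z)\<close> is the one for which it is \<open>g(v,w)g(u,z) - g(u,w)g(v,z)\<close> on the unit sphere.\<close>

definition schouten4 ::
    "('a, 'n::finite) metric_field \<Rightarrow> ('a, 'n) christoffel \<Rightarrow> ('a, 'n) chart \<Rightarrow> quat^'n \<Rightarrow>
      quat^'n \<Rightarrow> quat^'n \<Rightarrow> real" where
  "schouten4 g \<Gamma> c x u v = (ricci \<Gamma> c x u v - scalar_curvature g \<Gamma> c x / 6 * g c x u v) / 2"

definition weyl4 ::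
    "('a, 'n::finite) metric_field \<Rightarrow> ('a, 'n) christoffel \<Rightarrow> ('a, 'n) chart \<Rightarrow> quat^'n \<Rightarrow>
      quat^'n \<Rightarrow> quat^'n \<Rightarrow> quat^'n \<Rightarrow> quat^'n \<Rightarrow> real" where
  "weyl4 g \<Gamma> c x u v w z = g c x (curvature \<Gamma> c x u v w) z
     - (schouten4 g \<Gamma> c x u z * g c x v w + schouten4 g \<Gamma> c x v w * g c x u z
        - schouten4 g \<Gamma> c x u w * g c x v z - schouten4 g \<Gamma> c x v z * g c x u w)"

text \<open>Orientations are given by volume forms. For n = 1, a frame \<open>f\<close> is an isomorphism
  from H = R^4, and \<open>frame_list f\<close> is the list of the images of 1, i, j, k.\<close>

definition volume_form4 ::
    "('a, 'n::finite) chart set \<Rightarrow> ('a, 'n) form_field \<Rightarrow> bool" where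
  "volume_form4 A \<nu> \<longleftrightarrow> smooth_form A \<nu> \<and>
     (\<forall>c\<in>A. \<forall>x\<in>chart_image c. \<nu> c x \<in> exterior_power 4 \<and> \<nu> c x \<noteq> (\<lambda>_. 0))"

definition frame_list :: "(quat^'n \<Rightarrow> quat^'n) \<Rightarrow> (quat^'n) list" where
  "frame_list f = [f (vec q1), f (vec qi), f (vec qj), f (vec qk)]"

text \<open>The 2-forms with \<open>* \<alpha> = - \<alpha>\<close>: the Hodge star satisfies \<open>(* \<alpha>)(e1,e2) = \<alpha>(e3,e4)\<close> for
  every oriented orthonormal basis \<open>e1, e2, e3, e4\<close>.\<close>

definition anti_self_dual_forms ::
    "('a, 'n::finite) metric_field \<Rightarrow> ('a, 'n) form_field \<Rightarrow> ('a, 'n) chart \<Rightarrow> quat^'n \<Rightarrow>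
      (quat^'n) multiform set" where
  "anti_self_dual_forms g \<nu> c x = {\<alpha> \<in> exterior_power 2.
     \<forall>f\<in>orthonormal_frames g c x. \<nu> c x (frame_list f) > 0 \<longrightarrow>
       \<alpha> [f (vec qj), f (vec qk)] = - \<alpha> [f (vec q1), f (vec qi)]}"

text \<open>The anti-self-dual part of the Weyl tensor, which is the restriction to the
  anti-self-dual forms of its action on 2-forms, vanishes.\<close>

definition self_dual_metric ::
    "('a, 'n::finite) chart set \<Rightarrow> ('a, 'n) metric_field \<Rightarrow> ('a, 'n) form_field \<Rightarrow> bool" where
  "self_dual_metric A g \<nu> \<longleftrightarrow> (\<exists>\<Gamma>. levi_civita A g \<Gamma> \<and>
     (\<forall>c\<in>A. \<forall>x\<in>chart_image c. \<forall>\<alpha>\<in>anti_self_dual_forms g \<nu> c x.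
        \<forall>f\<in>orthonormal_frames g c x. \<forall>u v.
          (\<Sum>a\<in>Basis. \<Sum>b\<in>Basis. weyl4 g \<Gamma> c x u v (f a) (f b) * \<alpha> [f a, f b]) = 0))"

text \<open>The frames are conformal isomorphisms, so they only depend on the conformal class of \<open>g\<close>.
  Left multiplications by i, j, k on H are orthogonal and their fundamental 2-forms are self-dual
  for the orientation (1, i, j, k). On a self-dual manifold, the almost complex structures of the
  induced quaternionic structure (those with integrable twistor space) are the ones with
  anti-self-dual fundamental forms, hence the frames reverse the orientation.\<close>

definition induced_structure ::
    "('a, 'n::finite) metric_field \<Rightarrow> ('a, 'n) form_field \<Rightarrow> ('a, 'n) frame_bundle" where
  "induced_structure g \<nu> c x = {f. linear f \<and> (\<exists>l>0. \<forall>u v. g c x (f u) (f v) = l * (u \<bullet> v)) \<and>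
     \<nu> c x (frame_list f) < 0}"

definition self_dual_conformal4 ::
    "('a, 'n::finite) chart set \<Rightarrow> ('a, 'n) frame_bundle \<Rightarrow> bool" where
  "self_dual_conformal4 A Q \<longleftrightarrow> (\<exists>g \<nu>. riemannian_metric A g \<and> volume_form4 A \<nu> \<and>
     self_dual_metric A g \<nu> \<and>
     (\<forall>c\<in>A. \<forall>x\<in>chart_image c. Q c x = induced_structure g \<nu> c x))"


section \<open>Quaternionic manifolds and the operators on forms\<close>

definition quaternionic_manifold ::
    "'a topology \<Rightarrow> ('a, 'n::finite) chart set \<Rightarrow> ('a, 'n) frame_bundle \<Rightarrow> bool" where
  "quaternionic_manifold X A Q \<longleftrightarrow> smooth_manifold X A \<and> Sp1GL_structure A Q \<and>
     (if CARD('n) = 1 then self_dual_conformal4 A Q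
      else \<exists>\<Gamma>. structure_connection A Q \<Gamma> \<and> torsion_free A \<Gamma>)"

text \<open>The derivation of the exterior algebra which extends the dual action \<open>\<alpha> \<mapsto> - \<alpha> \<circ> J\<close> of
  an endomorphism \<open>J\<close> of the tangent space; the sign makes \<open>IJ = K\<close> hold on covectors as well.\<close>

definition deriv_action :: "('e \<Rightarrow> 'e) \<Rightarrow> 'e multiform \<Rightarrow> 'e multiform" where
  "deriv_action J \<alpha> vs = - (\<Sum>m<length vs. \<alpha> (vs[m := J (vs ! m)]))"

definition complex_structure :: "(quat^'n \<Rightarrow> quat^'n) \<Rightarrow> quat \<Rightarrow> quat^'n \<Rightarrow> quat^'n" where
  "complex_structure f q = f \<circ> left_mult q \<circ> inv f"

text \<open>A change of the frame \<open>f\<close> rotates the triple \<open>I, J, K\<close>, so the operator does not depend on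
  the choice of \<open>f\<close>.\<close>

definition casimir ::
    "('a, 'n) frame_bundle \<Rightarrow> ('a, 'n) chart \<Rightarrow> quat^'n \<Rightarrow>
      (quat^'n) multiform \<Rightarrow> (quat^'n) multiform" where
  "casimir Q c x \<alpha> vs =
     (let f = (SOME f. f \<in> Q c x);
          I = deriv_action (complex_structure f qi);
          J = deriv_action (complex_structure f qj);
          K = deriv_action (complex_structure f qk)
      in I (I \<alpha>) vs + J (J \<alpha>) vs + K (K \<alpha>) vs)"

text \<open>The fibres of the bundles E(k,r). The weight is an integer so that E(k,-1) = 0 makes
  sense; the last condition is needed as \<open>r (r + 2)\<close> takes the same value at \<open>r\<close> and \<open>- 2 - r\<close>.\<close>

definition E_fibre ::
    "('a, 'n::finite) frame_bundle \<Rightarrow> ('a, 'n) chart \<Rightarrow> quat^'n \<Rightarrow> nat \<Rightarrow> int \<Rightarrow>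
      (quat^'n) multiform set" where
  "E_fibre Q c x k r = {\<alpha> \<in> exterior_power k.
     (\<forall>vs. casimir Q c x \<alpha> vs = - of_int (r * (r + 2)) * \<alpha> vs) \<and> (r < 0 \<longrightarrow> \<alpha> = (\<lambda>_. 0))}"

text \<open>The component of weight \<open>r\<close> of the degree \<open>k\<close> part of \<open>\<alpha>\<close> in the direct sum of the
  E(k,s), \<open>0 \<le> s \<le> k\<close>.\<close>

definition proj_fibre ::
    "('a, 'n::finite) frame_bundle \<Rightarrow> ('a, 'n) chart \<Rightarrow> quat^'n \<Rightarrow> nat \<Rightarrow> int \<Rightarrow>
      (quat^'n) multiform \<Rightarrow> (quat^'n) multiform" where
  "proj_fibre Q c x k r \<alpha> = (THE \<beta>. \<exists>h. (\<forall>s. h s \<in> E_fibre Q c x k s) \<and>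
     (\<forall>vs. degree_part k \<alpha> vs = (\<Sum>s = 0..int k. h s vs)) \<and> \<beta> = h r)"

definition proj ::
    "('a, 'n::finite) frame_bundle \<Rightarrow> nat \<Rightarrow> int \<Rightarrow> ('a, 'n) form_field \<Rightarrow> ('a, 'n) form_field" where
  "proj Q k r \<omega> c x = proj_fibre Q c x k r (\<omega> c x)"

definition D_op ::
    "('a, 'n::finite) frame_bundle \<Rightarrow> ('a, 'n) form_field \<Rightarrow> ('a, 'n) form_field" where
  "D_op Q \<omega> c x vs = (\<Sum>k = 0..4 * CARD('n). \<Sum>r = 0..int k.
     proj Q (k + 1) (r + 1) (ext_deriv (proj Q k r \<omega>)) c x vs)"

definition Dbar_op ::
    "('a, 'n::finite) frame_bundle \<Rightarrow> ('a, 'n) form_field \<Rightarrow> ('a, 'n) form_field" where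
  "Dbar_op Q \<omega> c x vs = (\<Sum>k = 0..4 * CARD('n). \<Sum>r = 0..int k.
     proj Q (k + 1) (r - 1) (ext_deriv (proj Q k r \<omega>)) c x vs)"

end

theory Submission
  imports Defs
begin

text \<open>On a quaternionic manifold there is a torsion-free connection which preserves the structure: it is
  given for n > 1, and it is the Levi-Civita connection for n = 1. Its covariant derivative preserves
  the bundles E(k,r), and \<open>d\<close> is the alternation of the covariant derivative. Alternation is an
  sp(1)-equivariant map from T* \<open>\<otimes>\<close> E(k,r), which only contains the weights \<open>r + 1\<close> and \<open>r - 1\<close> as T* is a
  sum of copies of the representation of weight 1; this is expressed by a quadratic
  equation for the operator \<open>I \<otimes> I + J \<otimes> J + K \<otimes> K\<close> on T* \<open>\<otimes>\<close> E(k,r). Hence \<open>d\<close> is the sum of its two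
  components, and the components of \<open>d\<^sup>2 = 0\<close> of weight \<open>r + 2\<close>, \<open>r\<close>, \<open>r - 2\<close> are the three
  identities.\<close>

section \<open>Algebra of multiforms\<close>

text \<open>Two choices are hidden in the definitions. \<open>proj\<close> is a definite
  description, so existence and uniqueness of the isotypic decomposition have to be proved:
  uniqueness since the Casimir eigenvalues of distinct weights r \<ge> 0 differ, existence by
  induction on the degree, with the same argument on covectors tensor forms, because k times a
  k-form is the alternation of its contractions. \<open>casimir\<close> picks a frame at each point
  without any regularity; independence of the frame lets a smooth local section take its place, and
  writing the projections as polynomials in the Casimir operator makes them smooth, as the second
  application of \<open>ext_deriv\<close> requires. The quadratic equation is T^2 = 2 T - C, with T
  the mixed operator and C the Casimir operator on forms. At C = - r (r + 2) its roots are r + 2 and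
  - r. For r = 0 the first root would lead to the weight -1, whose Casimir eigenvalue is 1; such an
  eigenvalue is excluded because it is positive. The covariant derivative is only formed at one
  point, by differentiating the Casimir eigenvalue equation along a smooth section of
  frames.\<close>

definition interior_product :: "'e \<Rightarrow> 'e multiform \<Rightarrow> 'e multiform" where
  "interior_product v \<alpha> = (\<lambda>vs. \<alpha> (v # vs))"

text \<open>The wedge map from covectors tensor k-forms to (k+1)-forms, an element of the tensor
  product being seen as a linear map \<open>t\<close> from vectors to forms. It is not normalised
  and only moves the new slot, so that with the signs of \<open>ext_deriv\<close> the exterior
  derivative is exactly the alternation of the total derivative.\<close>

definition alternation :: "('e \<Rightarrow> 'e multiform) \<Rightarrow> 'e multiform" where
  "alternation t vs = (\<Sum>m<length vs. (- 1) ^ m * t (vs ! m) (take m vs @ drop (Suc m) vs))"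

abbreviation lin2 :: "real \<Rightarrow> 'e multiform \<Rightarrow> real \<Rightarrow> 'e multiform \<Rightarrow> 'e multiform" where
  "lin2 a \<alpha> b \<beta> \<equiv> (\<lambda>vs. a * \<alpha> vs + b * \<beta> vs)"

lemma interior_product_apply: "interior_product v \<alpha> vs = \<alpha> (v # vs)"
  by (simp add: interior_product_def)

lemma alternation_Nil [simp]: "alternation t [] = 0"
  by (simp add: alternation_def)

lemma alternation_Cons: "alternation t (v # vs) = t v vs - alternation (\<lambda>u. interior_product v (t u)) vs"
  unfolding alternation_def interior_product_apply
  by (simp add: sum.lessThan_Suc_shift sum_negf del: sum.lessThan_Suc)

lemma deriv_action_Nil [simp]: "deriv_action J \<alpha> [] = 0"
  by (simp add: deriv_action_def)

lemma deriv_action_Cons: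
  "deriv_action J \<alpha> (v # vs) = deriv_action J (interior_product v \<alpha>) vs - interior_product (J v) \<alpha> vs"
  unfolding deriv_action_def interior_product_apply
  by (simp add: sum.lessThan_Suc_shift del: sum.lessThan_Suc)

lemma interior_deriv_action:
  "interior_product v (deriv_action J \<alpha>) =
     (\<lambda>vs. deriv_action J (interior_product v \<alpha>) vs - interior_product (J v) \<alpha> vs)"
  by (simp add: fun_eq_iff deriv_action_Cons interior_product_apply)

lemma deriv_action_lin2:
  "deriv_action J (lin2 a \<alpha> b \<beta>) = lin2 a (deriv_action J \<alpha>) b (deriv_action J \<beta>)"
  by (simp add: fun_eq_iff deriv_action_def sum.distrib sum_distrib_left algebra_simps)

lemma deriv_action_cmult: "deriv_action J (\<lambda>vs. a * \<alpha> vs) = (\<lambda>vs. a * deriv_action J \<alpha> vs)"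
  by (simp add: fun_eq_iff deriv_action_def sum_distrib_left)

lemma deriv_action_add: "deriv_action J (\<lambda>vs. \<alpha> vs + \<beta> vs) = (\<lambda>vs. deriv_action J \<alpha> vs + deriv_action J \<beta> vs)"
  by (simp add: fun_eq_iff deriv_action_def sum.distrib)

lemma deriv_action_diff: "deriv_action J (\<lambda>vs. \<alpha> vs - \<beta> vs) = (\<lambda>vs. deriv_action J \<alpha> vs - deriv_action J \<beta> vs)"
  by (simp add: fun_eq_iff deriv_action_def sum_subtractf)

lemma deriv_action_minus: "deriv_action J (\<lambda>vs. - \<alpha> vs) = (\<lambda>vs. - deriv_action J \<alpha> vs)"
  by (simp add: fun_eq_iff deriv_action_def sum_negf)

lemma deriv_action_zero: "deriv_action J (\<lambda>vs. 0) = (\<lambda>vs. 0)"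
  by (simp add: fun_eq_iff deriv_action_def)

lemma alternation_cmult: "alternation (\<lambda>u vs. a * t u vs) = (\<lambda>vs. a * alternation t vs)"
  by (simp add: fun_eq_iff alternation_def sum_distrib_left algebra_simps)

lemma alternation_add: "alternation (\<lambda>u vs. t u vs + s u vs) = (\<lambda>vs. alternation t vs + alternation s vs)"
  by (simp add: fun_eq_iff alternation_def sum.distrib algebra_simps)

lemma alternation_diff: "alternation (\<lambda>u vs. t u vs - s u vs) = (\<lambda>vs. alternation t vs - alternation s vs)"
  by (simp add: fun_eq_iff alternation_def sum_subtractf algebra_simps)

lemma alternation_minus: "alternation (\<lambda>u vs. - t u vs) = (\<lambda>vs. - alternation t vs)"
  by (simp add: fun_eq_iff alternation_def sum_negf)

lemma alternation_sum: "alternation (\<lambda>u vs. \<Sum>i\<in>S. t i u vs) = (\<lambda>vs. \<Sum>i\<in>S. alternation (t i) vs)"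
  by (rule ext, induction S rule: infinite_finite_induct)
     (simp_all add: alternation_def sum.distrib algebra_simps)

text \<open>Equivariance of the wedge map: on the right \<open>J\<close> acts on the tensor product
  by the Leibniz rule, where \<open>- t (J u)\<close> is the dual action on the covector slot. The
  induction peels off one argument at a time.\<close>

lemma deriv_action_alternation:
  "deriv_action J (alternation t) = alternation (\<lambda>u vs. deriv_action J (t u) vs - t (J u) vs)"
proof
  show "deriv_action J (alternation t) vs = alternation (\<lambda>u vs. deriv_action J (t u) vs - t (J u) vs) vs" for vs
  proof (induction vs arbitrary: t)
    case (Cons v vs)
    have i: "interior_product v (alternation t) = (\<lambda>vs. t v vs - alternation (\<lambda>u. interior_product v (t u)) vs)" for v
      by (simp add: fun_eq_iff alternation_Cons interior_product_apply)
    have j: "(\<lambda>u. interior_product v (\<lambda>vs. deriv_action J (t u) vs - t (J u) vs)) =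
      (\<lambda>u vs. (deriv_action J (interior_product v (t u)) vs - interior_product v (t (J u)) vs)
        - interior_product (J v) (t u) vs)"
      by (simp add: fun_eq_iff deriv_action_Cons interior_product_apply)
    have "alternation (\<lambda>u. interior_product v (\<lambda>vs. deriv_action J (t u) vs - t (J u) vs)) vs =
      deriv_action J (alternation (\<lambda>u. interior_product v (t u))) vs - alternation (\<lambda>u. interior_product (J v) (t u)) vs"
      unfolding j alternation_diff[of "\<lambda>u vs. deriv_action J (interior_product v (t u)) vs - interior_product v (t (J u)) vs"]
        Cons.IH ..
    then show ?case
      by (simp add: deriv_action_Cons[of _ "alternation t"] alternation_Cons i deriv_action_diff)
  qed simp
qed

text \<open>The source of d d = 0: \<open>S u v\<close> will be the second derivative of the
  coefficients. In the induction, the two terms in which \<open>v\<close> fills one of the two new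
  slots cancel by symmetry.\<close>

lemma alternation_alternation_symmetric:
  assumes "\<And>u v. S u v = S v u"
  shows "alternation (\<lambda>u. alternation (S u)) = (\<lambda>vs. 0)"
proof
  show "alternation (\<lambda>u. alternation (S u)) vs = 0" for vs
    using assms
  proof (induction vs arbitrary: S)
    case (Cons v vs)
    have "alternation (\<lambda>u. alternation (\<lambda>w. interior_product v (S u w))) vs = 0"
      by (rule Cons.IH) (simp add: Cons.prems[of u w for u w])
    moreover have "(\<lambda>u. interior_product v (alternation (S u))) =
        (\<lambda>u vs. S u v vs - alternation (\<lambda>w. interior_product v (S u w)) vs)"
      by (simp add: fun_eq_iff alternation_Cons interior_product_apply)
    moreover have "alternation (\<lambda>u. S u v) vs = alternation (S v) vs"
    proof -
      have "(\<lambda>u. S u v) = S v"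
        using Cons.prems by auto
      then show ?thesis by simp
    qed
    ultimately show ?case
      by (simp add: alternation_Cons alternation_diff)
  qed simp
qed

subsection \<open>Exterior forms\<close>

lemma exterior_linear: "exterior \<alpha> \<Longrightarrow> linear (\<lambda>v. \<alpha> (us @ v # vs))"
  by (simp add: exterior_def)

lemma exterior_linear_Cons: "exterior \<alpha> \<Longrightarrow> linear (\<lambda>v. \<alpha> (v # vs))"
  using exterior_linear[of \<alpha> "[]"] by simp

lemma exterior_alt: "exterior \<alpha> \<Longrightarrow> \<alpha> (us @ v # vs @ v # ws) = 0"
  by (simp add: exterior_def)

lemma exterior_alt_Cons: "exterior \<alpha> \<Longrightarrow> \<alpha> (v # vs @ v # ws) = 0"
  using exterior_alt[of \<alpha> "[]"] by simp

lemma exterior_alt_Cons2: "exterior \<alpha> \<Longrightarrow> \<alpha> (v # v # ws) = 0"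
  using exterior_alt_Cons[of \<alpha> v "[]"] by simp

lemma exterior_interior: "exterior \<alpha> \<Longrightarrow> exterior (interior_product v \<alpha>)"
  unfolding exterior_def interior_product_apply by (simp flip: append_Cons)

lemma exterior_add_Cons: "exterior \<alpha> \<Longrightarrow> \<alpha> ((u + v) # vs) = \<alpha> (u # vs) + \<alpha> (v # vs)"
  using linear_add[OF exterior_linear_Cons] by blast

lemma exterior_diff_Cons: "exterior \<alpha> \<Longrightarrow> \<alpha> ((u - v) # vs) = \<alpha> (u # vs) - \<alpha> (v # vs)"
  using linear_diff[OF exterior_linear_Cons] by blast

lemma exterior_scale_Cons: "exterior \<alpha> \<Longrightarrow> \<alpha> ((c *\<^sub>R v) # vs) = c * \<alpha> (v # vs)"
  by (simp add: linear_scale[OF exterior_linear_Cons])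

lemma exterior_swap:
  assumes "exterior \<alpha>" shows "\<alpha> (u # v # vs) = - \<alpha> (v # u # vs)"
proof -
  have s: "\<alpha> (x # (u + v) # vs) = \<alpha> (x # u # vs) + \<alpha> (x # v # vs)" for x
    using exterior_add_Cons[OF exterior_interior[OF assms]] by (simp add: interior_product_apply)
  have "0 = \<alpha> ((u + v) # (u + v) # vs)"
    using exterior_alt_Cons2[OF assms] by simp
  also have "\<dots> = \<alpha> (u # (u + v) # vs) + \<alpha> (v # (u + v) # vs)"
    by (rule exterior_add_Cons[OF assms])
  also have "\<dots> = \<alpha> (u # v # vs) + \<alpha> (v # u # vs)"
    unfolding s by (simp add: exterior_alt_Cons2[OF assms])
  finally show ?thesis by simp
qed

lemma interior_swap:
  "exterior \<alpha> \<Longrightarrow> interior_product u (interior_product v \<alpha>) =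
     (\<lambda>vs. - interior_product v (interior_product u \<alpha>) vs)"
  unfolding interior_product_def by (rule ext) (rule exterior_swap)

lemma interior_diff: "exterior \<alpha> \<Longrightarrow>
    interior_product (u - v) \<alpha> = (\<lambda>vs. interior_product u \<alpha> vs - interior_product v \<alpha> vs)"
  by (simp add: fun_eq_iff interior_product_apply exterior_diff_Cons)

lemma interior_lin: "exterior \<alpha> \<Longrightarrow> interior_product (a *\<^sub>R u + b *\<^sub>R v) \<alpha> =
    lin2 a (interior_product u \<alpha>) b (interior_product v \<alpha>)"
  by (simp add: fun_eq_iff interior_product_apply exterior_add_Cons exterior_scale_Cons)

lemma interior_interior_same:
  "exterior \<alpha> \<Longrightarrow> interior_product u (interior_product u \<alpha>) = (\<lambda>vs. 0)"
  by (simp add: fun_eq_iff exterior_alt_Cons2 interior_product_apply)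

lemma exterior_zero: "exterior (\<lambda>vs. 0)"
  by (simp add: exterior_def linear_zero)

lemma exterior_lin2: "exterior \<alpha> \<Longrightarrow> exterior \<beta> \<Longrightarrow> exterior (lin2 a \<alpha> b \<beta>)"
  unfolding exterior_def linear_iff by (simp add: algebra_simps)

lemma exterior_add: "exterior \<alpha> \<Longrightarrow> exterior \<beta> \<Longrightarrow> exterior (\<lambda>vs. \<alpha> vs + \<beta> vs)"
  using exterior_lin2[of \<alpha> \<beta> 1 1] by simp

lemma exterior_diff: "exterior \<alpha> \<Longrightarrow> exterior \<beta> \<Longrightarrow> exterior (\<lambda>vs. \<alpha> vs - \<beta> vs)"
  using exterior_lin2[of \<alpha> \<beta> 1 "-1"] by simp

lemma exterior_cmult: "exterior \<alpha> \<Longrightarrow> exterior (\<lambda>vs. c * \<alpha> vs)"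
  using exterior_lin2[of \<alpha> \<alpha> c 0] by simp

lemma exterior_sum: "(\<And>i. i \<in> S \<Longrightarrow> exterior (t i)) \<Longrightarrow> exterior (\<lambda>vs. \<Sum>i\<in>S. t i vs)"
  by (induction S rule: infinite_finite_induct) (auto intro: exterior_zero exterior_add)

lemma exterior_degree_part: "exterior \<alpha> \<Longrightarrow> exterior (degree_part k \<alpha>)"
  unfolding exterior_def degree_part_def
  by (auto simp: linear_iff)

section \<open>Stability of exterior forms under derivations and alternation\<close>

lemma linear_deriv_action_family:
  assumes "\<And>vs. linear (\<lambda>v. t v vs)"
  shows "linear (\<lambda>v. deriv_action J (t v) vs)"
proof -
  have "linear (\<lambda>v. \<Sum>m<length vs. t v (vs[m := J (vs ! m)]))"
    using assms by (intro linear_compose_sum) auto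
  then show ?thesis
    unfolding deriv_action_def by (rule linear_compose_neg)
qed

text \<open>Among the terms of the derivation, all still contain \<open>v\<close> twice except the
  one in which \<open>J\<close> hits the \<open>v\<close> inside the list; exchanging its two
  entries absorbs the sign of \<open>deriv_action\<close>.\<close>

lemma deriv_action_alt_aux:
  assumes "exterior \<alpha>"
  shows "deriv_action J (interior_product v \<alpha>) (vs @ v # ws) = \<alpha> (J v # vs @ v # ws)"
  using assms
proof (induction vs arbitrary: \<alpha>)
  case Nil
  then show ?case
    using exterior_swap[OF Nil, of v "J v" ws]
    by (simp add: deriv_action_Cons interior_interior_same deriv_action_zero)
      (simp add: interior_product_apply)
next
  case (Cons x vs)
  have "deriv_action J (interior_product v (interior_product x \<alpha>)) (vs @ v # ws) =
      \<alpha> (x # J v # vs @ v # ws)"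
    unfolding Cons.IH[OF exterior_interior[OF Cons.prems]] by (simp add: interior_product_apply)
  moreover have "\<alpha> (v # J x # vs @ v # ws) = 0"
    using exterior_alt_Cons[OF Cons.prems, of v "J x # vs"] by simp
  ultimately show ?case
    using exterior_swap[OF Cons.prems, of x "J v"]
    by (simp add: deriv_action_Cons interior_swap[OF Cons.prems, of x v] deriv_action_minus)
      (simp add: interior_product_apply)
qed

lemma exterior_deriv_action:
  assumes "linear J" "exterior \<alpha>"
  shows "exterior (deriv_action J \<alpha>)"
proof -
  have "linear (\<lambda>v. deriv_action J \<alpha> (us @ v # vs))" for us vs
    using assms(2)
  proof (induction us arbitrary: \<alpha>)
    case Nil
    have "linear (\<lambda>v. deriv_action J (interior_product v \<alpha>) vs)"
      by (rule linear_deriv_action_family) (simp add: exterior_linear_Cons Nil interior_product_apply)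
    moreover have "linear (\<lambda>v. \<alpha> (J v # vs))"
      using linear_compose[OF assms(1) exterior_linear_Cons[OF Nil]] by (simp add: o_def)
    ultimately show ?case
      by (simp add: deriv_action_Cons linear_compose_sub interior_product_apply)
  next
    case (Cons a us)
    show ?case
      using linear_compose_sub[OF Cons.IH[OF exterior_interior[OF Cons.prems, of a]]
          exterior_linear[OF Cons.prems, of "J a # us"]]
      by (simp add: deriv_action_Cons interior_product_apply[of "J a"])
  qed
  moreover have "deriv_action J \<alpha> (us @ v # vs @ v # ws) = 0" for us v vs ws
    using assms(2)
  proof (induction us arbitrary: \<alpha>)
    case Nil
    then show ?case
      by (simp add: deriv_action_Cons deriv_action_alt_aux interior_product_apply)
  next
    case (Cons a us)
    show ?case
      using Cons.IH[OF exterior_interior[OF Cons.prems, of a]] exterior_alt[OF Cons.prems, of "J a # us"]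
      by (simp add: deriv_action_Cons interior_product_apply[of "J a"])
  qed
  ultimately show ?thesis
    by (simp add: exterior_def)
qed

text \<open>Only the term that removes the \<open>v\<close> inside the list is free of a repeated
  argument; its sign is the one of moving the front \<open>v\<close> back to that place.\<close>

lemma alternation_alt_aux:
  assumes "\<And>u. exterior (t u)"
  shows "alternation (\<lambda>u. interior_product v (t u)) (vs @ v # ws) = t v (vs @ v # ws)"
  using assms
proof (induction vs arbitrary: t)
  case Nil
  then show ?case
    by (simp add: alternation_Cons interior_interior_same interior_product_apply[of v "t v"]) (simp add: alternation_def)
next
  case (Cons x vs)
  have "alternation (\<lambda>u. interior_product x (interior_product v (t u))) (vs @ v # ws) = - t v (x # vs @ v # ws)"
    using Cons.IH[of "\<lambda>u. interior_product x (t u)"] exterior_interior[OF Cons.prems]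
    by (simp add: interior_swap[OF Cons.prems, of x v] alternation_minus) (simp add: interior_product_apply)
  then show ?case
    by (simp add: alternation_Cons) (simp add: interior_product_apply exterior_alt_Cons[OF Cons.prems])
qed

lemma exterior_alternation:
  assumes "\<And>u. exterior (t u)" "\<And>vs. linear (\<lambda>u. t u vs)"
  shows "exterior (alternation t)"
proof -
  have "linear (\<lambda>v. alternation t (us @ v # vs))" for us vs
    using assms
  proof (induction us arbitrary: t)
    case Nil
    have "linear (\<lambda>v. (- 1) ^ m * t (vs ! m) (v # take m vs @ drop (Suc m) vs))" for m
      using linear_compose_scale_right[OF exterior_linear_Cons[OF Nil(1)]] by fastforce
    then have "linear (\<lambda>v. alternation (\<lambda>u. interior_product v (t u)) vs)"
      unfolding alternation_def interior_product_apply by (intro linear_compose_sum) simp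
    then show ?case
      using Nil(2) by (simp add: alternation_Cons linear_compose_sub)
  next
    case (Cons a us)
    show ?case
      using linear_compose_sub[OF exterior_linear[OF Cons.prems(1), of a us vs]
          Cons.IH[of "\<lambda>u. interior_product a (t u)"]] exterior_interior[OF Cons.prems(1)] Cons.prems(2)
      by (simp add: alternation_Cons) (simp add: interior_product_apply)
  qed
  moreover have "alternation t (us @ v # vs @ v # ws) = 0" for us v vs ws
    using assms
  proof (induction us arbitrary: t)
    case Nil
    then show ?case
      by (simp add: alternation_Cons alternation_alt_aux)
  next
    case (Cons a us)
    show ?case
      using Cons.IH[of "\<lambda>u. interior_product a (t u)"] exterior_interior[OF Cons.prems(1)]
        exterior_alt[OF Cons.prems(1)] Cons.prems(2)
      by (simp add: alternation_Cons) (simp add: interior_product_apply)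
  qed
  ultimately show ?thesis
    by (simp add: exterior_def)
qed

text \<open>The minus sign in \<open>deriv_action\<close> makes the dual action a homomorphism of
  Lie algebras rather than an antihomomorphism.\<close>

lemma deriv_action_commutator:
  assumes "exterior \<alpha>"
  shows "deriv_action A (deriv_action B \<alpha>) vs - deriv_action B (deriv_action A \<alpha>) vs =
    deriv_action (\<lambda>v. A (B v) - B (A v)) \<alpha> vs"
  using assms
proof (induction vs arbitrary: \<alpha>)
  case (Cons v vs)
  show ?case
    using Cons.IH[OF exterior_interior[OF Cons.prems]]
    by (simp add: deriv_action_Cons interior_deriv_action deriv_action_diff
        interior_diff[OF Cons.prems])
qed simp

lemma deriv_action_commute:
  assumes "\<And>v. A (B v) = B (A v)"
  shows "deriv_action A (deriv_action B \<alpha>) vs = deriv_action B (deriv_action A \<alpha>) vs"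
proof (induction vs arbitrary: \<alpha>)
  case (Cons v vs)
  then show ?case
    by (simp add: deriv_action_Cons interior_deriv_action deriv_action_diff assms)
qed simp

lemma deriv_action_lin_endo:
  assumes "exterior \<alpha>"
  shows "deriv_action (\<lambda>v. a *\<^sub>R A v + b *\<^sub>R B v) \<alpha> vs = a * deriv_action A \<alpha> vs + b * deriv_action B \<alpha> vs"
  using assms
proof (induction vs arbitrary: \<alpha>)
  case (Cons v vs)
  show ?case
    using Cons.IH[OF exterior_interior[OF Cons.prems]]
    by (simp add: deriv_action_Cons interior_lin[OF Cons.prems] algebra_simps)
qed simp

lemma deriv_action_add_endo:
  "exterior \<alpha> \<Longrightarrow> deriv_action (\<lambda>v. A v + B v) \<alpha> vs = deriv_action A \<alpha> vs + deriv_action B \<alpha> vs"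
  using deriv_action_lin_endo[of \<alpha> 1 A 1 B] by simp

lemma deriv_action_diff_endo:
  "exterior \<alpha> \<Longrightarrow> deriv_action (\<lambda>v. A v - B v) \<alpha> vs = deriv_action A \<alpha> vs - deriv_action B \<alpha> vs"
  using deriv_action_lin_endo[of \<alpha> 1 A "-1" B] by simp

lemma linear_deriv_action_endo:
  assumes "exterior \<alpha>" "\<And>v. linear (\<lambda>u. G u v)"
  shows "linear (\<lambda>u. deriv_action (G u) \<alpha> vs)"
proof (rule linearI)
  have "G (u + w) = (\<lambda>v. G u v + G w v)" for u w
    by (simp add: fun_eq_iff linear_add[OF assms(2)])
  then show "deriv_action (G (u + w)) \<alpha> vs = deriv_action (G u) \<alpha> vs + deriv_action (G w) \<alpha> vs" for u w
    by (simp add: deriv_action_add_endo[OF assms(1)])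
  have "G (c *\<^sub>R u) = (\<lambda>v. c *\<^sub>R G u v + 0 *\<^sub>R G u v)" for c u
    by (simp add: fun_eq_iff linear_scale[OF assms(2)])
  then show "deriv_action (G (c *\<^sub>R u)) \<alpha> vs = c *\<^sub>R deriv_action (G u) \<alpha> vs" for c u
    by (simp only: deriv_action_lin_endo[OF assms(1)]) simp
qed

section \<open>Alternation of contractions and of derivations\<close>

lemma alternation_interior_endo:
  assumes "exterior \<alpha>"
  shows "alternation (\<lambda>u. interior_product (G u) \<alpha>) vs = - deriv_action G \<alpha> vs"
  using assms
proof (induction vs arbitrary: \<alpha>)
  case (Cons v vs)
  show ?case
    using Cons.IH[OF exterior_interior[OF Cons.prems], of v]
    by (simp add: alternation_Cons interior_swap[OF Cons.prems, of v] alternation_minus deriv_action_Cons)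
qed simp

text \<open>This is how torsion-freeness enters: with \<open>G\<close> a Christoffel symbol, the
  terms that distinguish the covariant derivative from the ordinary one disappear under
  alternation.\<close>

lemma alternation_symmetric_endo:
  assumes "exterior \<alpha>" "\<And>u v. G u v = G v u"
  shows "alternation (\<lambda>u. deriv_action (G u) \<alpha>) vs = 0"
  using assms(1)
proof (induction vs arbitrary: \<alpha>)
  case (Cons v vs)
  have "G v = (\<lambda>u. G u v)"
    using assms(2) by auto
  then show ?case
    using Cons.IH[OF exterior_interior[OF Cons.prems]] alternation_interior_endo[OF Cons.prems, of "G v" vs]
    by (simp add: alternation_Cons interior_deriv_action alternation_diff )
qed simp

text \<open>Contracting with u and wedging back counts the degree. Forms of positive degree are
  thereby alternations of maps into forms of one degree less, which feeds the induction for the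
  isotypic decomposition.\<close>

lemma alternation_interior:
  assumes "exterior \<alpha>"
  shows "alternation (\<lambda>u. interior_product u \<alpha>) vs = real (length vs) * \<alpha> vs"
  using assms
proof (induction vs arbitrary: \<alpha>)
  case (Cons v vs)
  show ?case
    using Cons.IH[OF exterior_interior[OF Cons.prems], of v]
    by (simp add: alternation_Cons interior_swap[OF Cons.prems, of v] alternation_minus)
       (simp add: interior_product_apply algebra_simps)
qed simp

subsection \<open>Degrees\<close>

lemma exterior_power_exterior: "\<alpha> \<in> exterior_power k \<Longrightarrow> exterior \<alpha>"
  by (simp add: exterior_power_def)

lemma exterior_power_degree: "\<alpha> \<in> exterior_power k \<Longrightarrow> length vs \<noteq> k \<Longrightarrow> \<alpha> vs = 0"
  by (simp add: exterior_power_def)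

lemma exterior_power_zero: "(\<lambda>vs. 0) \<in> exterior_power k"
  by (simp add: exterior_power_def exterior_zero)

lemma exterior_power_lin2:
  "\<alpha> \<in> exterior_power k \<Longrightarrow> \<beta> \<in> exterior_power k \<Longrightarrow> lin2 a \<alpha> b \<beta> \<in> exterior_power k"
  by (simp add: exterior_power_def exterior_lin2)

lemma exterior_power_interior:
  "\<alpha> \<in> exterior_power (Suc k) \<Longrightarrow> interior_product v \<alpha> \<in> exterior_power k"
  by (simp add: exterior_power_def exterior_interior) (simp add: interior_product_apply)

lemma exterior_power_deriv_action:
  "linear J \<Longrightarrow> \<alpha> \<in> exterior_power k \<Longrightarrow> deriv_action J \<alpha> \<in> exterior_power k"
  by (simp add: exterior_power_def exterior_deriv_action deriv_action_def)

lemma exterior_power_alternation: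
  assumes "\<And>u. t u \<in> exterior_power k" "\<And>vs. linear (\<lambda>u. t u vs)"
  shows "alternation t \<in> exterior_power (Suc k)"
proof -
  have "t (vs ! m) (take m vs @ drop (Suc m) vs) = 0" if "length vs \<noteq> Suc k" "m < length vs" for m vs
    using that by (intro exterior_power_degree[OF assms(1)]) auto
  then show ?thesis
    using exterior_alternation[of t] assms by (simp add: exterior_power_def alternation_def)
qed

lemma exterior_power_degree_part: "exterior \<alpha> \<Longrightarrow> degree_part k \<alpha> \<in> exterior_power k"
  by (simp add: exterior_power_def exterior_degree_part) (simp add: degree_part_def)

lemma exterior_expand_Cons:
  assumes "exterior \<alpha>"
  shows "\<alpha> (v # vs) = (\<Sum>b\<in>Basis. (v \<bullet> b) * \<alpha> (b # vs))"
proof -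
  have "\<alpha> (v # vs) = \<alpha> ((\<Sum>b\<in>Basis. (v \<bullet> b) *\<^sub>R b) # vs)"
    by (simp add: euclidean_representation)
  also have "\<dots> = (\<Sum>b\<in>Basis. (v \<bullet> b) * \<alpha> (b # vs))"
    by (simp add: linear_sum[OF exterior_linear_Cons[OF assms]] linear_scale[OF exterior_linear_Cons[OF assms]])
  finally show ?thesis .
qed

lemma exterior_zero_on_Basis:
  assumes "exterior \<alpha>" "\<And>bs. length bs = length vs \<Longrightarrow> set bs \<subseteq> Basis \<Longrightarrow> \<alpha> bs = 0"
  shows "\<alpha> vs = 0"
  using assms
proof (induction vs arbitrary: \<alpha>)
  case (Cons v vs)
  have "interior_product b \<alpha> vs = 0" if "b \<in> Basis" for b
  proof (rule Cons.IH[OF exterior_interior[OF Cons.prems(1)]])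
    fix bs :: "'a list" assume "length bs = length vs" "set bs \<subseteq> Basis"
    with that show "interior_product b \<alpha> bs = 0"
      unfolding interior_product_apply by (intro Cons.prems(2)) auto
  qed
  then show ?case
    by (subst exterior_expand_Cons[OF Cons.prems(1)]) (simp add: interior_product_apply)
qed simp

text \<open>Pigeonhole principle on lists of basis vectors. It guarantees that the sums in
  \<open>D_op\<close> and \<open>Dbar_op\<close>, which stop at the degree 4n, miss nothing.\<close>

lemma exterior_zero_above_dim:
  fixes \<alpha> :: "'e::euclidean_space multiform"
  assumes "exterior \<alpha>" "length vs > DIM('e)"
  shows "\<alpha> vs = 0"
proof (rule exterior_zero_on_Basis[OF assms(1)])
  fix bs :: "'e list" assume bs: "length bs = length vs" "set bs \<subseteq> Basis"
  have "\<not> distinct bs"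
  proof
    assume "distinct bs"
    then have "card (set bs) = length vs"
      using bs(1) by (simp add: distinct_card)
    then show False
      using card_mono[OF finite_Basis bs(2)] assms(2) by linarith
  qed
  then obtain xs y ys zs where "bs = xs @ [y] @ ys @ [y] @ zs"
    using not_distinct_decomp[of bs] by blast
  then show "\<alpha> bs = 0"
    using exterior_alt[OF assms(1)] by simp
qed

section \<open>The action of sp(1) in a frame\<close>

lemma qmul_component [simp]:
  "qmul p q $ 1 = p$1 * q$1 - p$2 * q$2 - p$3 * q$3 - p$4 * q$4"
  "qmul p q $ 2 = p$1 * q$2 + p$2 * q$1 + p$3 * q$4 - p$4 * q$3"
  "qmul p q $ 3 = p$1 * q$3 - p$2 * q$4 + p$3 * q$1 + p$4 * q$2"
  "qmul p q $ 4 = p$1 * q$4 + p$2 * q$3 - p$3 * q$2 + p$4 * q$1"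
  by (simp_all add: qmul_def)

lemma quat_unit_component [simp]:
  "q1 $ 1 = 1" "q1 $ 2 = 0" "q1 $ 3 = 0" "q1 $ 4 = 0"
  "qi $ 1 = 0" "qi $ 2 = 1" "qi $ 3 = 0" "qi $ 4 = 0"
  "qj $ 1 = 0" "qj $ 2 = 0" "qj $ 3 = 1" "qj $ 4 = 0"
  "qk $ 1 = 0" "qk $ 2 = 0" "qk $ 3 = 0" "qk $ 4 = 1"
  by (simp_all add: q1_def qi_def qj_def qk_def axis_def)

lemma quat_eq_iff: "(p :: quat) = q \<longleftrightarrow> p$1 = q$1 \<and> p$2 = q$2 \<and> p$3 = q$3 \<and> p$4 = q$4"
  by (simp add: vec_eq_iff forall_4)

lemma qmul_assoc: "qmul (qmul p q) r = qmul p (qmul q r)"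
  by (simp add: quat_eq_iff algebra_simps)

lemma linear_qmul_right: "linear (qmul p)"
  by (rule linearI) (simp_all add: quat_eq_iff algebra_simps)

lemma linear_qmul_left: "linear (\<lambda>p. qmul p q)"
  by (rule linearI) (simp_all add: quat_eq_iff algebra_simps)

lemma qmul_units:
  "qmul qi qi = - q1" "qmul qj qj = - q1" "qmul qk qk = - q1"
  "qmul qi qj = qk" "qmul qj qi = - qk" "qmul qj qk = qi"
  "qmul qk qj = - qi" "qmul qk qi = qj" "qmul qi qk = - qj"
  by (simp_all add: quat_eq_iff)

lemma linear_left_mult: "linear (left_mult p)"
  by (rule linearI)
     (simp_all add: left_mult_def vec_eq_iff linear_add[OF linear_qmul_right] linear_scale[OF linear_qmul_right])

lemma linear_left_mult_left: "linear (\<lambda>p. left_mult p v)"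
  by (rule linearI)
     (simp_all add: left_mult_def vec_eq_iff linear_add[OF linear_qmul_left] linear_scale[OF linear_qmul_left])

lemma linear_right_mult: "linear (right_mult B)"
  by (rule linearI)
     (simp_all add: right_mult_def vec_eq_iff linear_add[OF linear_qmul_left] linear_scale[OF linear_qmul_left]
      sum.distrib scaleR_sum_right sum_distrib_left)

lemma left_mult_left_mult: "left_mult p (left_mult q v) = left_mult (qmul p q) v"
  by (simp add: left_mult_def vec_eq_iff qmul_assoc)

lemma left_mult_right_mult: "left_mult p (right_mult B v) = right_mult B (left_mult p v)"
  unfolding left_mult_def right_mult_def
  by (rule vec_eq_iff[THEN iffD2]) (simp add: linear_sum[OF linear_qmul_right] qmul_assoc)

lemma left_mult_q1 [simp]: "left_mult q1 v = v"
  by (simp add: left_mult_def vec_eq_iff[of _ v] quat_eq_iff)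

lemma qmul_skew: "p$1 = 0 \<Longrightarrow> qmul p v \<bullet> w = - (v \<bullet> qmul p w)"
  by (simp add: inner_vec_def sum_4 algebra_simps)

lemma left_mult_skew: "p$1 = 0 \<Longrightarrow> left_mult p v \<bullet> w = - (v \<bullet> left_mult p w)"
  unfolding left_mult_def inner_vec_def[of _ w] inner_vec_def[of v] sum_negf[symmetric]
  by (intro sum.cong refl) (simp add: qmul_skew)

text \<open>The operator \<open>casimir\<close> with the frame as a parameter in place of a choice,
  so that it can be differentiated along a section of frames.\<close>

definition frame_casimir :: "(quat^'n \<Rightarrow> quat^'n) \<Rightarrow> (quat^'n) multiform \<Rightarrow> (quat^'n) multiform" where
  "frame_casimir f \<alpha> vs =
     deriv_action (complex_structure f qi) (deriv_action (complex_structure f qi) \<alpha>) vs +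
     deriv_action (complex_structure f qj) (deriv_action (complex_structure f qj) \<alpha>) vs +
     deriv_action (complex_structure f qk) (deriv_action (complex_structure f qk) \<alpha>) vs"

definition eigenspace :: "(quat^'n \<Rightarrow> quat^'n::finite) \<Rightarrow> nat \<Rightarrow> int \<Rightarrow> (quat^'n) multiform set" where
  "eigenspace f k r = {\<alpha> \<in> exterior_power k.
     (\<forall>vs. frame_casimir f \<alpha> vs = - of_int (r * (r + 2)) * \<alpha> vs) \<and> (r < 0 \<longrightarrow> \<alpha> = (\<lambda>_. 0))}"

lemma eigenspace_negative: "r < 0 \<Longrightarrow> eigenspace f k r = {\<lambda>_. 0}"
  by (auto simp: eigenspace_def exterior_power_zero frame_casimir_def deriv_action_zero)

text \<open>Up to the factor k!, the inner product on k-forms induced by the metric for which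
  \<open>f\<close> is an isometry. Contracting one basis vector at a time matches the inductions on
  argument lists.\<close>

primrec form_inner :: "('e::euclidean_space \<Rightarrow> 'e) \<Rightarrow> nat \<Rightarrow> 'e multiform \<Rightarrow> 'e multiform \<Rightarrow> real" where
  "form_inner f 0 \<alpha> \<beta> = \<alpha> [] * \<beta> []"
| "form_inner f (Suc k) \<alpha> \<beta> =
     (\<Sum>b\<in>Basis. form_inner f k (interior_product (f b) \<alpha>) (interior_product (f b) \<beta>))"

lemma form_inner_commute: "form_inner f k \<alpha> \<beta> = form_inner f k \<beta> \<alpha>"
proof (induction k arbitrary: \<alpha> \<beta>)
  case (Suc k)
  then show ?case by simp
qed simp

lemma interior_lin2: "interior_product v (lin2 a \<alpha> b \<beta>) = lin2 a (interior_product v \<alpha>) b (interior_product v \<beta>)"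
  by (simp add: fun_eq_iff interior_product_apply)

lemma form_inner_lin2:
  "form_inner f k (lin2 a \<alpha> b \<beta>) \<gamma> = a * form_inner f k \<alpha> \<gamma> + b * form_inner f k \<beta> \<gamma>"
  by (induction k arbitrary: \<alpha> \<beta> \<gamma>)
     (simp_all add: interior_lin2 sum.distrib sum_distrib_left algebra_simps)

lemma form_inner_zero: "form_inner f k (\<lambda>vs. 0) \<gamma> = 0"
  using form_inner_lin2[of f k 0 "\<lambda>vs. 0" 0 "\<lambda>vs. 0" \<gamma>] by simp

lemma form_inner_diff: "form_inner f k (\<lambda>vs. \<alpha> vs - \<beta> vs) \<gamma> = form_inner f k \<alpha> \<gamma> - form_inner f k \<beta> \<gamma>"
  using form_inner_lin2[of f k 1 \<alpha> "-1" \<beta>] by simp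

lemma form_inner_add: "form_inner f k (\<lambda>vs. \<alpha> vs + \<beta> vs) \<gamma> = form_inner f k \<alpha> \<gamma> + form_inner f k \<beta> \<gamma>"
  using form_inner_lin2[of f k 1 \<alpha> 1 \<beta>] by simp

lemma form_inner_cmult: "form_inner f k (\<lambda>vs. a * \<alpha> vs) \<gamma> = a * form_inner f k \<alpha> \<gamma>"
  using form_inner_lin2[of f k a \<alpha> 0 \<alpha>] by simp

lemma form_inner_sum:
  "form_inner f k (\<lambda>vs. \<Sum>i\<in>S. c i * t i vs) \<gamma> = (\<Sum>i\<in>S. c i * form_inner f k (t i) \<gamma>)"
  by (induction S rule: infinite_finite_induct) (simp_all add: form_inner_zero form_inner_add form_inner_cmult)

lemma form_inner_nonneg: "form_inner f k \<alpha> \<alpha> \<ge> 0"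
  by (induction k arbitrary: \<alpha>) (simp_all add: sum_nonneg)

lemma form_inner_zero_on_Basis:
  assumes "form_inner f k \<alpha> \<alpha> = 0" "length bs = k" "set bs \<subseteq> Basis"
  shows "\<alpha> (map f bs) = 0"
  using assms
proof (induction k arbitrary: \<alpha> bs)
  case (Suc k)
  from Suc.prems(2) obtain b cs where bs: "bs = b # cs" "length cs = k"
    by (metis length_Suc_conv)
  have "\<forall>b\<in>Basis. form_inner f k (interior_product (f b) \<alpha>) (interior_product (f b) \<alpha>) = 0"
    using Suc.prems(1) by (simp add: sum_nonneg_eq_0_iff form_inner_nonneg)
  then have "interior_product (f b) \<alpha> (map f cs) = 0"
    using Suc.IH[of "interior_product (f b) \<alpha>" cs] Suc.prems(3) bs by auto
  then show ?case
    by (simp add: bs interior_product_apply)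
qed simp

lemma exterior_map:
  assumes "linear f" "exterior \<alpha>"
  shows "exterior (\<lambda>vs. \<alpha> (map f vs))"
  using assms unfolding exterior_def
  by (auto intro!: linear_compose[of f, unfolded o_def])

lemma form_inner_definite:
  assumes "linear f" "surj f" "\<alpha> \<in> exterior_power k" "form_inner f k \<alpha> \<alpha> = 0"
  shows "\<alpha> = (\<lambda>vs. 0)"
proof
  fix vs
  show "\<alpha> vs = 0"
  proof (cases "length vs = k")
    case True
    have "\<alpha> (map f (map (inv f) vs)) = 0"
    proof (rule exterior_zero_on_Basis[OF exterior_map[OF assms(1) exterior_power_exterior[OF assms(3)]]])
      fix bs :: "'a list"
      assume "length bs = length (map (inv f) vs)" "set bs \<subseteq> Basis"
      then show "\<alpha> (map f bs) = 0"
        using True by (intro form_inner_zero_on_Basis[OF assms(4)]) simp_all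
    qed
    moreover have "map f (map (inv f) vs) = vs"
      using surj_f_inv_f[OF assms(2)] by (simp add: map_idI)
    ultimately show ?thesis
      by simp
  qed (rule exterior_power_degree[OF assms(3)])
qed

lemma interior_endo_expand:
  fixes f :: "'e::euclidean_space \<Rightarrow> 'e"
  assumes "linear f" "exterior \<alpha>"
  shows "interior_product (f v) \<alpha> = (\<lambda>vs. \<Sum>c\<in>Basis. (v \<bullet> c) * interior_product (f c) \<alpha> vs)"
proof
  fix vs
  have "linear (\<lambda>v. \<alpha> (f v # vs))"
    using linear_compose[OF assms(1) exterior_linear_Cons[OF assms(2)]] by (simp add: o_def)
  from linear_sum[OF this, of "\<lambda>c. (v \<bullet> c) *\<^sub>R c" Basis]
  have "\<alpha> (f v # vs) = (\<Sum>c\<in>Basis. \<alpha> (f ((v \<bullet> c) *\<^sub>R c) # vs))"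
    by (simp only: euclidean_representation)
  then show "interior_product (f v) \<alpha> vs = (\<Sum>c\<in>Basis. (v \<bullet> c) * interior_product (f c) \<alpha> vs)"
    using linear_scale[OF \<open>linear (\<lambda>v. \<alpha> (f v # vs))\<close>] by (simp add: interior_product_apply)
qed

text \<open>A skew endomorphism acts on forms as a skew operator. In the induction step the extra
  term pairs the antisymmetric matrix of \<open>L\<close> with the family \<open>G\<close>, which is
  unchanged when the forms and the indices are exchanged simultaneously.\<close>

lemma form_inner_skew:
  fixes f :: "'e::euclidean_space \<Rightarrow> 'e"
  assumes "linear f" "\<And>v. J (f v) = f (L v)" "\<And>v w. L v \<bullet> w = - (v \<bullet> L w)"
    and "exterior \<alpha>" "exterior \<beta>"
  shows "form_inner f k (deriv_action J \<alpha>) \<beta> = - form_inner f k \<alpha> (deriv_action J \<beta>)"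
  using assms(4,5)
proof (induction k arbitrary: \<alpha> \<beta>)
  case (Suc k)
  define G where "G \<alpha> \<beta> b c = form_inner f k (interior_product (f c) \<alpha>) (interior_product (f b) \<beta>)" for \<alpha> \<beta> b c
  have *: "form_inner f (Suc k) (deriv_action J \<alpha>) \<beta> =
      (\<Sum>b\<in>Basis. form_inner f k (deriv_action J (interior_product (f b) \<alpha>)) (interior_product (f b) \<beta>))
      - (\<Sum>b\<in>Basis. \<Sum>c\<in>Basis. (L b \<bullet> c) * G \<alpha> \<beta> b c)" if "exterior \<alpha>" for \<alpha> \<beta>
    by (simp add: interior_deriv_action form_inner_diff assms(2) sum_subtractf G_def
        interior_endo_expand[OF assms(1) that, of "L _"] form_inner_sum)
  have "(\<Sum>b\<in>Basis. \<Sum>c\<in>Basis. (L b \<bullet> c) * G \<alpha> \<beta> b c) = (\<Sum>c\<in>Basis. \<Sum>b\<in>Basis. (L b \<bullet> c) * G \<alpha> \<beta> b c)"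
    by (rule sum.swap)
  also have "\<dots> = (\<Sum>c\<in>Basis. \<Sum>b\<in>Basis. - ((L c \<bullet> b) * G \<beta> \<alpha> c b))"
  proof (intro sum.cong refl)
    fix c b
    have "L b \<bullet> c = - (L c \<bullet> b)"
      using assms(3)[of b c] by (simp add: inner_commute)
    then show "L b \<bullet> c * G \<alpha> \<beta> b c = - (L c \<bullet> b * G \<beta> \<alpha> c b)"
      by (simp add: G_def form_inner_commute[of f k "interior_product (f c) \<alpha>"])
  qed
  finally have s: "(\<Sum>b\<in>Basis. \<Sum>c\<in>Basis. (L b \<bullet> c) * G \<alpha> \<beta> b c) = - (\<Sum>b\<in>Basis. \<Sum>c\<in>Basis. (L b \<bullet> c) * G \<beta> \<alpha> b c)"
    by (simp add: sum_negf)
  have "form_inner f (Suc k) \<alpha> (deriv_action J \<beta>) = form_inner f (Suc k) (deriv_action J \<beta>) \<alpha>"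
    by (rule form_inner_commute)
  then show ?case
    unfolding *[OF Suc.prems(1)] *[OF Suc.prems(2)] s
    using Suc.IH[OF exterior_interior exterior_interior, OF Suc.prems]
    by (simp add: sum_negf form_inner_commute[of f k "deriv_action J (interior_product _ \<beta>)"])
qed simp

section \<open>The sp(1)-action and its Casimir operator in a fixed frame\<close>

locale frame =
  fixes f :: "quat^'n::finite \<Rightarrow> quat^'n"
  assumes linear_frame: "linear f" and bij_frame: "bij f"
begin

abbreviation "cstr \<equiv> complex_structure f"
abbreviation "act p \<equiv> deriv_action (complex_structure f p)"
abbreviation "cas \<equiv> frame_casimir f"

lemma linear_inv_frame: "linear (inv f)"
  using linear_frame bij_frame by (simp add: bij_is_inj linear_injective_imp_surjective inj_linear_imp_inv_linear)

lemma inv_frame_simps [simp]: "inv f (f v) = v" "f (inv f v) = v"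
  using bij_frame by (simp_all add: bij_is_inj bij_is_surj surj_f_inv_f)

lemma linear_cstr: "linear (cstr p)"
  unfolding complex_structure_def by (intro linear_compose linear_frame linear_left_mult linear_inv_frame)

lemma linear_cstr_left: "linear (\<lambda>p. cstr p v)"
  unfolding complex_structure_def o_def
  by (intro linear_compose[OF linear_left_mult_left linear_frame, unfolded o_def])

lemma cstr_cstr: "cstr p (cstr q v) = cstr (qmul p q) v"
  by (simp add: complex_structure_def left_mult_left_mult)

lemma cstr_q1: "cstr q1 v = v"
  by (simp add: complex_structure_def)

lemma cstr_neg: "cstr (- p) v = - cstr p v"
  using linear_neg[OF linear_cstr_left] .

lemma exterior_act: "exterior \<alpha> \<Longrightarrow> exterior (act p \<alpha>)"
  by (rule exterior_deriv_action[OF linear_cstr])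

lemma act_lin: "exterior \<alpha> \<Longrightarrow> act (a *\<^sub>R p + b *\<^sub>R q) \<alpha> vs = a * act p \<alpha> vs + b * act q \<alpha> vs"
  by (simp add: linear_add[OF linear_cstr_left] linear_scale[OF linear_cstr_left] deriv_action_lin_endo
      ext[of "cstr (a *\<^sub>R p + b *\<^sub>R q)" "\<lambda>v. a *\<^sub>R cstr p v + b *\<^sub>R cstr q v"])

lemma act_commutator:
  assumes "exterior \<alpha>"
  shows "act p (act q \<alpha>) vs = act q (act p \<alpha>) vs + act (qmul p q - qmul q p) \<alpha> vs"
  using deriv_action_commutator[OF assms, of "cstr p" "cstr q" vs]
  by (simp add: cstr_cstr linear_diff[OF linear_cstr_left, symmetric])

text \<open>Oriented as rewrite rules: words in the three generators are sorted into the order i, j,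
  k, so that simplification decides identities in the enveloping algebra of sp(1).\<close>

lemma act_commute:
  assumes "exterior \<alpha>"
  shows "act qj (act qi \<alpha>) = (\<lambda>vs. act qi (act qj \<alpha>) vs - 2 * act qk \<alpha> vs)"
    "act qk (act qi \<alpha>) = (\<lambda>vs. act qi (act qk \<alpha>) vs + 2 * act qj \<alpha> vs)"
    "act qk (act qj \<alpha>) = (\<lambda>vs. act qj (act qk \<alpha>) vs - 2 * act qi \<alpha> vs)"
proof -
  have 1: "qmul qj qi - qmul qi qj = (- 2) *\<^sub>R qk + 0 *\<^sub>R qk"
    and 2: "qmul qk qi - qmul qi qk = 2 *\<^sub>R qj + 0 *\<^sub>R qj"
    and 3: "qmul qk qj - qmul qj qk = (- 2) *\<^sub>R qi + 0 *\<^sub>R qi"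
    by (simp_all add: quat_eq_iff)
  show "act qj (act qi \<alpha>) = (\<lambda>vs. act qi (act qj \<alpha>) vs - 2 * act qk \<alpha> vs)"
    using act_commutator[OF assms, of qj qi] unfolding 1 act_lin[OF assms] by auto
  show "act qk (act qi \<alpha>) = (\<lambda>vs. act qi (act qk \<alpha>) vs + 2 * act qj \<alpha> vs)"
    using act_commutator[OF assms, of qk qi] unfolding 2 act_lin[OF assms] by auto
  show "act qk (act qj \<alpha>) = (\<lambda>vs. act qj (act qk \<alpha>) vs - 2 * act qi \<alpha> vs)"
    using act_commutator[OF assms, of qk qj] unfolding 3 act_lin[OF assms] by auto
qed

lemmas act_linear = deriv_action_add deriv_action_diff deriv_action_cmult deriv_action_minus

text \<open>The Casimir element is central; both sides have the same normal form.\<close>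

lemma cas_act_unit:
  assumes "exterior \<alpha>"
  shows "cas (act qi \<alpha>) vs = act qi (cas \<alpha>) vs" "cas (act qj \<alpha>) vs = act qj (cas \<alpha>) vs"
    "cas (act qk \<alpha>) vs = act qk (cas \<alpha>) vs"
  using assms
  by (simp_all add: frame_casimir_def[abs_def] act_linear act_commute exterior_act)

lemma quat_expand: "p = p$1 *\<^sub>R q1 + p$2 *\<^sub>R qi + p$3 *\<^sub>R qj + p$4 *\<^sub>R qk"
  by (simp add: quat_eq_iff)

lemma act_expand:
  assumes "exterior \<alpha>"
  shows "act p \<alpha> = (\<lambda>vs. p$1 * act q1 \<alpha> vs + p$2 * act qi \<alpha> vs + p$3 * act qj \<alpha> vs + p$4 * act qk \<alpha> vs)"
proof
  fix vs
  have "act p \<alpha> vs = act (1 *\<^sub>R (1 *\<^sub>R (p$1 *\<^sub>R q1 + p$2 *\<^sub>R qi) + p$3 *\<^sub>R qj) + p$4 *\<^sub>R qk) \<alpha> vs"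
    by (subst quat_expand[of p]) simp
  then show "act p \<alpha> vs = p$1 * act q1 \<alpha> vs + p$2 * act qi \<alpha> vs + p$3 * act qj \<alpha> vs + p$4 * act qk \<alpha> vs"
    unfolding act_lin[OF assms] by simp
qed

lemma exterior_cas: "exterior \<alpha> \<Longrightarrow> exterior (cas \<alpha>)"
  unfolding frame_casimir_def[abs_def] by (intro exterior_add exterior_act)

lemma cas_lin2: "cas (lin2 a \<alpha> b \<beta>) = lin2 a (cas \<alpha>) b (cas \<beta>)"
  by (simp add: fun_eq_iff frame_casimir_def deriv_action_lin2 algebra_simps)

lemma cas_cmult: "cas (\<lambda>vs. a * \<alpha> vs) = (\<lambda>vs. a * cas \<alpha> vs)"
  by (simp add: fun_eq_iff frame_casimir_def deriv_action_cmult algebra_simps)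

lemma cas_add: "cas (\<lambda>vs. \<alpha> vs + \<beta> vs) = (\<lambda>vs. cas \<alpha> vs + cas \<beta> vs)"
  by (simp add: fun_eq_iff frame_casimir_def deriv_action_add algebra_simps)

text \<open>Meant for right multiplications by quaternionic matrices, which commute with all the
  complex structures, and for the identity.\<close>

lemma cas_commute_endo:
  assumes "\<And>p v. B (cstr p v) = cstr p (B v)"
  shows "cas (deriv_action B \<alpha>) vs = deriv_action B (cas \<alpha>) vs"
proof -
  have c: "act p (deriv_action B \<alpha>) = deriv_action B (act p \<alpha>)" for p \<alpha>
    by (rule ext, rule deriv_action_commute) (simp add: assms)
  show ?thesis
    by (simp add: frame_casimir_def[abs_def] act_linear c)
qed

lemma cas_act:
  assumes "exterior \<alpha>"
  shows "cas (act p \<alpha>) vs = act p (cas \<alpha>) vs"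
proof -
  \<comment> \<open>\<open>p\<close> may have a real part, which acts through the identity
    endomorphism; the imaginary part is a combination of the three generators.\<close>
  have "cas (act q1 \<alpha>) vs = act q1 (cas \<alpha>) vs" for vs
    by (rule cas_commute_endo) (simp add: cstr_q1)
  then show ?thesis
    unfolding act_expand[OF assms, of p] act_expand[OF exterior_cas[OF assms], of p]
    by (simp add: cas_add cas_cmult cas_act_unit[OF assms])
qed

lemma eigenspaceD: "\<alpha> \<in> eigenspace f k r \<Longrightarrow> cas \<alpha> = (\<lambda>vs. - of_int (r * (r + 2)) * \<alpha> vs)"
  by (auto simp: eigenspace_def)

lemma eigenspace_power: "\<alpha> \<in> eigenspace f k r \<Longrightarrow> \<alpha> \<in> exterior_power k"
  by (auto simp: eigenspace_def)

lemma eigenspace_zero: "(\<lambda>vs. 0) \<in> eigenspace f k r"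
  by (auto simp: eigenspace_def exterior_power_zero frame_casimir_def deriv_action_zero)

lemma eigenspace_lin2:
  "\<alpha> \<in> eigenspace f k r \<Longrightarrow> \<beta> \<in> eigenspace f k r \<Longrightarrow> lin2 a \<alpha> b \<beta> \<in> eigenspace f k r"
  using eigenspaceD[of \<alpha> k r] eigenspaceD[of \<beta> k r]
  by (cases "r < 0")
     (simp_all add: eigenspace_negative,
      simp add: eigenspace_def exterior_power_lin2 cas_lin2 algebra_simps)

lemma eigenspace_cmult: "\<alpha> \<in> eigenspace f k r \<Longrightarrow> (\<lambda>vs. a * \<alpha> vs) \<in> eigenspace f k r"
  using eigenspace_lin2[of \<alpha> k r \<alpha> a 0] by simp

lemma eigenspace_act: "\<alpha> \<in> eigenspace f k r \<Longrightarrow> act p \<alpha> \<in> eigenspace f k r"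
  using eigenspaceD[of \<alpha> k r]
  by (auto simp: eigenspace_def exterior_power_deriv_action linear_cstr cas_act exterior_power_exterior
    deriv_action_cmult deriv_action_minus deriv_action_zero simp del: of_int_mult of_int_add)

text \<open>The Casimir operator is a sum of squares of operators which are skew for an inner product.\<close>

lemma cas_positive_eigenvalue:
  assumes "\<alpha> \<in> exterior_power k" "cas \<alpha> = (\<lambda>vs. l * \<alpha> vs)" "l > 0"
  shows "\<alpha> = (\<lambda>vs. 0)"
proof -
  have e: "exterior \<alpha>"
    using assms(1) by (rule exterior_power_exterior)
  have "form_inner f k (act p (act p \<alpha>)) \<alpha> \<le> 0" if "p $ 1 = 0" for p
  proof -
    have "form_inner f k (act p (act p \<alpha>)) \<alpha> = - form_inner f k (act p \<alpha>) (act p \<alpha>)"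
      using left_mult_skew[OF that]
      by (intro form_inner_skew[where L="left_mult p"] linear_frame exterior_act e)
         (auto simp: complex_structure_def)
    then show ?thesis
      using form_inner_nonneg[of f k "act p \<alpha>"] by simp
  qed
  from this[of qi] this[of qj] this[of qk] have "form_inner f k (cas \<alpha>) \<alpha> \<le> 0"
    by (simp add: frame_casimir_def[abs_def] form_inner_add)
  then have "form_inner f k \<alpha> \<alpha> \<le> 0"
    using assms(3) by (simp add: assms(2) form_inner_cmult mult_le_0_iff)
  then show ?thesis
    using form_inner_nonneg[of f k \<alpha>] form_inner_definite[OF linear_frame bij_is_surj[OF bij_frame] assms(1)]
    by simp
qed

subsection \<open>Covectors tensor forms\<close>

text \<open>The mixed operator on covectors tensor forms; the minus sign is that of the dual action
  on the covector slot.\<close>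

definition tensor_act :: "(quat^'n \<Rightarrow> (quat^'n) multiform) \<Rightarrow> quat^'n \<Rightarrow> (quat^'n) multiform" where
  "tensor_act t v vs = - (act qi (t (cstr qi v)) vs + act qj (t (cstr qj v)) vs + act qk (t (cstr qk v)) vs)"

text \<open>The Casimir operator of a tensor product is the sum of those of the factors plus twice
  the mixed operator. The covectors have weight 1, hence the constant - 1 (1 + 2) = - 3.\<close>

lemma cas_alternation:
  assumes "\<And>vs. linear (\<lambda>v. t v vs)"
  shows "cas (alternation t) = alternation (\<lambda>v vs. cas (t v) vs - 3 * t v vs + 2 * tensor_act t v vs)"
proof -
  have n: "t (- v) = (\<lambda>vs. - t v vs)" for v
    using linear_neg[OF assms] by auto
  have a: "alternation t vs + alternation s vs = alternation (\<lambda>u ws. t u ws + s u ws) vs" for t s :: "quat^'n \<Rightarrow> (quat^'n) multiform" and vs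
    by (simp add: alternation_add)
  show ?thesis
    unfolding frame_casimir_def[abs_def] deriv_action_alternation
    by (simp add: act_linear cstr_cstr qmul_units cstr_neg cstr_q1 n tensor_act_def)
       (simp only: a, rule arg_cong[where f=alternation], simp add: fun_eq_iff)
qed

lemma tensor_act_lin2:
  "tensor_act (\<lambda>v vs. a * t v vs + b * s v vs) = (\<lambda>v vs. a * tensor_act t v vs + b * tensor_act s v vs)"
  by (simp add: fun_eq_iff tensor_act_def deriv_action_lin2 algebra_simps)

lemma linear_tensor_act:
  assumes "\<And>vs. linear (\<lambda>v. t v vs)"
  shows "linear (\<lambda>v. tensor_act t v vs)"
proof -
  have "linear (\<lambda>v. act p (t (cstr p v)) vs)" for p
    using linear_compose[OF linear_cstr linear_deriv_action_family[of t, OF assms]] by (simp add: o_def)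
  then show ?thesis
    unfolding tensor_act_def by (intro linear_compose_add linear_compose_neg)
qed

text \<open>The diagonal terms give \<open>- cas\<close>, because each complex structure squares to
  -1 on vectors. In the other terms the complex structures anticommute on vectors, so the actions on
  forms pair up into commutators such as [I,J] = 2 K, which rebuild the operator itself
  twice.\<close>

lemma tensor_act_tensor_act:
  assumes "\<And>vs. linear (\<lambda>v. t v vs)" "\<And>v. exterior (t v)"
  shows "tensor_act (tensor_act t) v vs = 2 * tensor_act t v vs - cas (t v) vs"
proof -
  have n: "t (- v) = (\<lambda>vs. - t v vs)" for v
    using linear_neg[OF assms(1)] by auto
  show ?thesis
    unfolding tensor_act_def[abs_def] frame_casimir_def[abs_def]
    by (simp add: act_linear cstr_cstr qmul_units cstr_neg cstr_q1 n act_commute assms(2))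
qed

lemma eigenspace_tensor_act:
  "(\<And>v. t v \<in> eigenspace f k r) \<Longrightarrow> tensor_act t v \<in> eigenspace f k r"
  using eigenspace_lin2[OF eigenspace_lin2[OF eigenspace_act[of "t (cstr qi v)" k r qi]
      eigenspace_act[of "t (cstr qj v)" k r qj], of "-1" "-1"] eigenspace_act[of "t (cstr qk v)" k r qk], of 1 "-1"]
  by (simp add: tensor_act_def[abs_def] algebra_simps)

text \<open>An eigenvector of \<open>tensor_act\<close> for \<open>c\<close>, with weight \<open>r\<close>, has the Casimir eigenvalue
  \<open>- r (r + 2) - 3 + 2 c\<close>; the eigenvalues \<open>r + 2\<close> and \<open>- r\<close> of \<open>tensor_act\<close> correspond to the
  weights \<open>r - 1\<close> and \<open>r + 1\<close>.\<close>

lemma alternation_eigen: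
  assumes t: "\<And>v. t v \<in> eigenspace f k r" and lin: "\<And>vs. linear (\<lambda>v. t v vs)"
    and c: "tensor_act t = (\<lambda>v vs. c * t v vs)"
    and s: "- of_int (r * (r + 2)) - 3 + 2 * c = - of_int (s * (s + 2))" "s \<ge> -1"
  shows "alternation t \<in> eigenspace f (k + 1) s"
proof -
  have "cas (alternation t) = alternation (\<lambda>v vs. - of_int (s * (s + 2)) * t v vs)"
    unfolding cas_alternation[OF lin] eigenspaceD[OF t] c
    by (rule arg_cong[where f=alternation]) (unfold s(1)[symmetric], simp add: fun_eq_iff algebra_simps)
  then have 1: "cas (alternation t) = (\<lambda>vs. - of_int (s * (s + 2)) * alternation t vs)"
    unfolding alternation_cmult .
  have 2: "alternation t \<in> exterior_power (k + 1)"
    using exterior_power_alternation[OF eigenspace_power[OF t] lin] by simp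
  \<comment> \<open>Only s = -1 is left, with the positive Casimir eigenvalue 1.\<close>
  have "alternation t = (\<lambda>_. 0)" if "s < 0"
    using that s(2) cas_positive_eigenvalue[OF 2 1] by (cases "s = -1") auto
  with 1 2 show ?thesis
    by (simp add: eigenspace_def)
qed

text \<open>For the weight r the quadratic equation reads (T - (r + 2)) (T + r) = 0. Hence
  \<open>t1\<close>, which is (T + r) t, and \<open>t2\<close>, which is (T - (r + 2)) t, are
  eigenvectors for r + 2 and - r respectively.\<close>

lemma alternation_eigenspace_decomp:
  assumes t: "\<And>v. t v \<in> eigenspace f k r" and lin: "\<And>vs. linear (\<lambda>v. t v vs)" and r: "r \<ge> 0"
  shows "\<exists>a\<in>eigenspace f (k + 1) (r + 1). \<exists>b\<in>eigenspace f (k + 1) (r - 1). alternation t = (\<lambda>vs. a vs + b vs)"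
proof -
  let ?r = "of_int r :: real"
  let ?T = "tensor_act t"
  define t1 where "t1 = (\<lambda>v vs. 1 * ?T v vs + ?r * t v vs)"
  define t2 where "t2 = (\<lambda>v vs. 1 * ?T v vs + (- (?r + 2)) * t v vs)"
  have TT: "tensor_act ?T = (\<lambda>v vs. 2 * ?T v vs + ?r * (?r + 2) * t v vs)"
    using tensor_act_tensor_act[of t, OF lin exterior_power_exterior[OF eigenspace_power[OF t]]]
    by (simp add: fun_eq_iff eigenspaceD[OF t])
  have l: "linear (\<lambda>v. 1 * ?T v vs + a * t v vs)" for a vs
    using linear_tensor_act[of t, OF lin, of vs] lin[of vs]
    by (simp add: linear_iff algebra_simps)
  have e: "(\<lambda>vs. 1 * ?T v vs + a * t v vs) \<in> eigenspace f k r" for a v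
    by (rule eigenspace_lin2[OF eigenspace_tensor_act[OF t] t])
  have t1: "t1 v \<in> eigenspace f k r" "linear (\<lambda>v. t1 v vs)" for v vs
    unfolding t1_def by (rule e, rule l)
  have t2: "t2 v \<in> eigenspace f k r" "linear (\<lambda>v. t2 v vs)" for v vs
    unfolding t2_def by (rule e, rule l)
  have "tensor_act t1 = (\<lambda>v vs. (?r + 2) * t1 v vs)"
    unfolding t1_def tensor_act_lin2 TT by (simp add: fun_eq_iff algebra_simps)
  then have w1: "alternation t1 \<in> eigenspace f (k + 1) (r - 1)"
    using r t1 by (intro alternation_eigen[where r=r and c="?r + 2"]) (simp_all add: algebra_simps)
  have "tensor_act t2 = (\<lambda>v vs. (- ?r) * t2 v vs)"
    unfolding t2_def tensor_act_lin2 TT by (simp add: fun_eq_iff algebra_simps)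
  then have w2: "alternation t2 \<in> eigenspace f (k + 1) (r + 1)"
    using r t2 by (intro alternation_eigen[where r=r and c="- ?r"]) (simp_all add: algebra_simps)
  \<comment> \<open>The inverse of the difference of the two roots, which is positive since r \<ge>
    0; it recovers \<open>t\<close> from \<open>t1\<close> and \<open>t2\<close>.\<close>
  define d where "d = 1 / (2 * ?r + 2)"
  have "t = (\<lambda>v vs. d * t1 v vs - d * t2 v vs)"
  proof (intro ext)
    fix v vs
    have "2 * ?r + 2 > 0"
      using r by (simp add: add_nonneg_pos)
    then have "d * (2 * ?r + 2) = 1"
      by (simp add: d_def)
    then have "t v vs = d * (2 * ?r + 2) * t v vs"
      by simp
    also have "\<dots> = d * t1 v vs - d * t2 v vs"
      by (simp add: t1_def t2_def algebra_simps)
    finally show "t v vs = d * t1 v vs - d * t2 v vs" .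
  qed
  then have "alternation t = alternation (\<lambda>v vs. d * t1 v vs - d * t2 v vs)" by simp
  also have "\<dots> = (\<lambda>vs. (- d) * alternation t2 vs + d * alternation t1 vs)"
    by (simp add: alternation_diff alternation_cmult)
  finally show ?thesis
    using eigenspace_cmult[OF w1, of d] eigenspace_cmult[OF w2, of "- d"]
    by (intro bexI[of _ "\<lambda>vs. - d * alternation t2 vs"] bexI[of _ "\<lambda>vs. d * alternation t1 vs"])
qed

end

section \<open>The decomposition into isotypic components\<close>

primrec casimir_poly :: "(quat^'n \<Rightarrow> quat^'n) \<Rightarrow> real list \<Rightarrow> (quat^'n) multiform \<Rightarrow> (quat^'n) multiform" where
  "casimir_poly f [] \<alpha> = \<alpha>"
| "casimir_poly f (c # cs) \<alpha> = casimir_poly f cs (\<lambda>vs. frame_casimir f \<alpha> vs - c * \<alpha> vs)"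

definition weight_eigenvalue :: "int \<Rightarrow> real" where
  "weight_eigenvalue r = - of_int (r * (r + 2))"

definition other_eigenvalues :: "nat \<Rightarrow> int \<Rightarrow> real list" where
  "other_eigenvalues k r = map weight_eigenvalue (filter (\<lambda>s. s \<noteq> r) [0..int k])"

text \<open>Lagrange interpolation in the Casimir operator.\<close>

definition frame_proj ::
    "(quat^'n \<Rightarrow> quat^'n) \<Rightarrow> nat \<Rightarrow> int \<Rightarrow> (quat^'n) multiform \<Rightarrow> (quat^'n) multiform" where
  "frame_proj f k r \<alpha> = (if r < 0 then (\<lambda>vs. 0) else
     (\<lambda>vs. casimir_poly f (other_eigenvalues k r) \<alpha> vs /
        (\<Prod>c\<leftarrow>other_eigenvalues k r. weight_eigenvalue r - c)))"

lemma weight_eigenvalue_inj: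
  assumes "r \<ge> 0" "s \<ge> 0" "weight_eigenvalue r = weight_eigenvalue s" shows "r = s"
proof -
  have "r * (r + 2) = s * (s + 2)"
    using assms(3) unfolding weight_eigenvalue_def by (metis neg_equal_iff_equal of_int_eq_iff)
  then have "(r - s) * (r + s + 2) = 0"
    by (simp add: algebra_simps)
  then show ?thesis
    using assms(1,2) by auto
qed

context frame begin

abbreviation "cpoly \<equiv> casimir_poly f"

lemma cpoly_lin2: "cpoly cs (lin2 a \<alpha> b \<beta>) = lin2 a (cpoly cs \<alpha>) b (cpoly cs \<beta>)"
proof (induction cs arbitrary: \<alpha> \<beta>)
  case (Cons c cs)
  show ?case
    using Cons.IH[of "\<lambda>vs. cas \<alpha> vs - c * \<alpha> vs" "\<lambda>vs. cas \<beta> vs - c * \<beta> vs"]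
    by (simp add: cas_lin2 algebra_simps)
qed simp

lemma cpoly_zero: "cpoly cs (\<lambda>vs. 0) = (\<lambda>vs. 0)"
  using cpoly_lin2[of cs 0 "\<lambda>vs. 0" 0 "\<lambda>vs. 0"] by simp

lemma cpoly_sum: "cpoly cs (\<lambda>vs. \<Sum>i\<in>S. t i vs) = (\<lambda>vs. \<Sum>i\<in>S. cpoly cs (t i) vs)"
proof (induction S rule: infinite_finite_induct)
  case (insert x F)
  then show ?case
    using cpoly_lin2[of cs 1 "t x" 1 "\<lambda>vs. \<Sum>i\<in>F. t i vs"] by simp
qed (simp_all add: cpoly_zero)

lemma cpoly_eigen:
  assumes "cas \<alpha> = (\<lambda>vs. l * \<alpha> vs)"
  shows "cpoly cs \<alpha> = (\<lambda>vs. (\<Prod>c\<leftarrow>cs. l - c) * \<alpha> vs)"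
proof (induction cs)
  case (Cons c cs)
  have e: "(\<lambda>vs. cas \<alpha> vs - c * \<alpha> vs) = lin2 (l - c) \<alpha> 0 \<alpha>"
    by (simp add: fun_eq_iff assms algebra_simps)
  show ?case
    unfolding casimir_poly.simps e cpoly_lin2 Cons by (simp add: algebra_simps)
qed simp

lemma frame_proj_lin2: "frame_proj f k r (lin2 a \<alpha> b \<beta>) = lin2 a (frame_proj f k r \<alpha>) b (frame_proj f k r \<beta>)"
  by (simp add: frame_proj_def cpoly_lin2 fun_eq_iff add_divide_distrib)

text \<open>The interpolation polynomial vanishes at the eigenvalue of every other weight and is
  normalised at \<open>r\<close>. So the components of any decomposition are determined by \<alpha>
  alone.\<close>

lemma frame_proj_unique:
  assumes h: "\<And>s. h s \<in> eigenspace f k s" and a: "\<alpha> = (\<lambda>vs. \<Sum>s = 0..int k. h s vs)" and r: "r \<le> int k"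
  shows "frame_proj f k r \<alpha> = h r"
proof (cases "r < 0")
  case True
  then show ?thesis
    using h[of r] by (simp add: frame_proj_def eigenspace_negative)
next
  case False
  let ?L = "other_eigenvalues k r"
  let ?P = "\<lambda>s. \<Prod>c\<leftarrow>?L. weight_eigenvalue s - c"
  have nz: "?P r \<noteq> 0"
    using weight_eigenvalue_inj False by (auto simp: prod_list_zero_iff other_eigenvalues_def)
  have "?P s = 0" if "s \<in> {0..int k}" "s \<noteq> r" for s
    using that by (simp add: prod_list_zero_iff other_eigenvalues_def image_iff) (metis atLeastAtMost_iff)
  then have s: "(\<Sum>s = 0..int k. ?P s * h s vs) = (\<Sum>s = 0..int k. if s = r then ?P r * h r vs else 0)" for vs
    by (intro sum.cong refl) auto
  have e: "cas (h s) = (\<lambda>vs. weight_eigenvalue s * h s vs)" for s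
    unfolding weight_eigenvalue_def by (rule eigenspaceD[OF h])
  have "cpoly ?L \<alpha> = (\<lambda>vs. \<Sum>s = 0..int k. ?P s * h s vs)"
    unfolding a cpoly_sum cpoly_eigen[OF e] ..
  then have "cpoly ?L \<alpha> = (\<lambda>vs. ?P r * h r vs)"
    unfolding s using False r by simp
  then show ?thesis
    using nz False by (simp add: frame_proj_def)
qed

definition decomposable :: "nat \<Rightarrow> (quat^'n) multiform \<Rightarrow> bool" where
  "decomposable k \<alpha> \<longleftrightarrow> (\<exists>h. (\<forall>s. h s \<in> eigenspace f k s) \<and> \<alpha> = (\<lambda>vs. \<Sum>s = 0..int k. h s vs))"

lemma decomposable_eigenspace:
  assumes "\<alpha> \<in> eigenspace f k r" "r \<le> int k"
  shows "decomposable k \<alpha>"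
  unfolding decomposable_def
proof (intro exI conjI allI)
  show "(if s = r then \<alpha> else (\<lambda>vs. 0)) \<in> eigenspace f k s" for s
    using assms by (simp add: eigenspace_zero)
  show "\<alpha> = (\<lambda>vs. \<Sum>s = 0..int k. (if s = r then \<alpha> else (\<lambda>vs. 0)) vs)"
  proof (cases "r < 0")
    case True
    then have "\<alpha> = (\<lambda>vs. 0)"
      using assms(1) by (simp add: eigenspace_negative)
    then show ?thesis by (simp cong: if_cong)
  next
    case False
    then show ?thesis
      using assms(2) by (simp add: if_distrib[where f="\<lambda>\<beta>. \<beta> _"] cong: if_cong)
  qed
qed

lemma decomposable_lin2:
  assumes "decomposable k \<alpha>" "decomposable k \<beta>"
  shows "decomposable k (lin2 a \<alpha> b \<beta>)"
proof -
  from assms obtain g h where g: "\<And>s. g s \<in> eigenspace f k s" "\<alpha> = (\<lambda>vs. \<Sum>s = 0..int k. g s vs)"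
    and h: "\<And>s. h s \<in> eigenspace f k s" "\<beta> = (\<lambda>vs. \<Sum>s = 0..int k. h s vs)"
    unfolding decomposable_def by blast
  show ?thesis
    unfolding decomposable_def
    by (intro exI[of _ "\<lambda>s. lin2 a (g s) b (h s)"] conjI allI eigenspace_lin2 g(1) h(1))
       (simp add: g(2) h(2) sum.distrib sum_distrib_left)
qed

lemma decomposable_sum:
  "(\<And>i. i \<in> S \<Longrightarrow> decomposable k (t i)) \<Longrightarrow> decomposable k (\<lambda>vs. \<Sum>i\<in>S. t i vs)"
proof (induction S rule: infinite_finite_induct)
  case (insert x F)
  then show ?case
    using decomposable_lin2[of k "t x" "\<lambda>vs. \<Sum>i\<in>F. t i vs" 1 1] by simp
qed (use decomposable_eigenspace[OF eigenspace_zero[of k 0]] in simp_all)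

lemma frame_proj_of_decomposable:
  assumes "decomposable k \<alpha>" "r \<le> int k"
  shows "frame_proj f k r \<alpha> \<in> eigenspace f k r" "\<alpha> = (\<lambda>vs. \<Sum>s = 0..int k. frame_proj f k s \<alpha> vs)"
proof -
  from assms(1) obtain h where h: "\<And>s. h s \<in> eigenspace f k s" "\<alpha> = (\<lambda>vs. \<Sum>s = 0..int k. h s vs)"
    unfolding decomposable_def by blast
  note p = frame_proj_unique[OF h]
  show "frame_proj f k r \<alpha> \<in> eigenspace f k r"
    unfolding p[OF assms(2)] by (rule h(1))
  show "\<alpha> = (\<lambda>vs. \<Sum>s = 0..int k. frame_proj f k s \<alpha> vs)"
    by (subst h(2)) (simp add: p)
qed

text \<open>Complete reducibility together with the bound on the weights, by induction on the
  degree: each contraction of \<alpha> decomposes, and alternation changes the weight of its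
  components by one. In degree 0 derivations act by zero.\<close>

lemma exterior_power_decomposable: "\<alpha> \<in> exterior_power k \<Longrightarrow> decomposable k \<alpha>"
proof (induction k arbitrary: \<alpha>)
  case 0
  have c: "frame_casimir f \<alpha> \<in> exterior_power 0"
    unfolding frame_casimir_def[abs_def] exterior_power_def
    using exterior_power_deriv_action[OF linear_cstr exterior_power_deriv_action[OF linear_cstr 0]]
    by (auto simp: exterior_power_def intro!: exterior_add)
  have "frame_casimir f \<alpha> vs = 0" for vs
    using exterior_power_degree[OF c, of vs] by (cases vs) (simp_all add: frame_casimir_def)
  with 0 have "\<alpha> \<in> eigenspace f 0 0"
    by (simp add: eigenspace_def)
  then show ?case
    by (rule decomposable_eigenspace) simp
next
  case (Suc k)
  have e: "exterior \<alpha>"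
    using Suc.prems by (rule exterior_power_exterior)
  \<comment> \<open>Taking the components through \<open>frame_proj\<close>, and not as arbitrary
    witnesses, makes them linear in \<open>u\<close>.\<close>
  define t where "t r u = frame_proj f k r (interior_product u \<alpha>)" for r u
  note d = frame_proj_of_decomposable[OF Suc.IH[OF exterior_power_interior[OF Suc.prems]]]
  have t: "t r u \<in> eigenspace f k r" if "r \<le> int k" for r u
    unfolding t_def by (rule d(1)[OF that])
  have tsum: "interior_product u \<alpha> = (\<lambda>vs. \<Sum>r = 0..int k. t r u vs)" for u
    unfolding t_def by (rule d(2)[OF order_refl])
  have lin: "linear (\<lambda>u. t r u vs)" for r vs
  proof (rule linearI)
    show "t r (u + v) vs = t r u vs + t r v vs" for u v
      using interior_lin[OF e, of 1 u 1 v] frame_proj_lin2[of k r 1 _ 1] by (simp add: t_def)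
    show "t r (c *\<^sub>R u) vs = c *\<^sub>R t r u vs" for c u
      using interior_lin[OF e, of c u 0 u] frame_proj_lin2[of k r c _ 0] by (simp add: t_def)
  qed
  have dec: "decomposable (Suc k) (alternation (t r))" if "r \<in> {0..int k}" for r
  proof -
    have "\<exists>a\<in>eigenspace f (k + 1) (r + 1). \<exists>b\<in>eigenspace f (k + 1) (r - 1).
        alternation (t r) = (\<lambda>vs. a vs + b vs)"
      using that by (intro alternation_eigenspace_decomp t lin) auto
    then obtain a b where ab: "a \<in> eigenspace f (k + 1) (r + 1)" "b \<in> eigenspace f (k + 1) (r - 1)"
      "alternation (t r) = (\<lambda>vs. a vs + b vs)"
      by blast
    show ?thesis
      using decomposable_lin2[of "Suc k" a b 1 1] decomposable_eigenspace[of a "Suc k" "r + 1"]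
        decomposable_eigenspace[of b "Suc k" "r - 1"] ab that by simp
  qed
  have "real (Suc k) * \<alpha> vs = (\<Sum>r = 0..int k. alternation (t r) vs)" for vs
  proof -
    have "real (Suc k) * \<alpha> vs = alternation (\<lambda>u. interior_product u \<alpha>) vs"
      using exterior_power_degree[OF Suc.prems, of vs] alternation_interior[OF e, of vs] by (cases "length vs = Suc k") auto
    then show ?thesis
      by (simp only: tsum alternation_sum)
  qed
  then have *: "\<alpha> = lin2 (1 / real (Suc k)) (\<lambda>vs. \<Sum>r = 0..int k. alternation (t r) vs) 0 (\<lambda>vs. \<Sum>r = 0..int k. alternation (t r) vs)"
    by (auto simp: fun_eq_iff field_simps)
  have "decomposable (Suc k) (\<lambda>vs. \<Sum>r = 0..int k. alternation (t r) vs)"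
    by (rule decomposable_sum[OF dec])
  then show ?case
    by (subst *) (intro decomposable_lin2)
qed

end

section \<open>Independence of the frame\<close>

definition qconj :: "quat \<Rightarrow> quat" where
  "qconj q = (2 * q$1) *\<^sub>R q1 - q"

lemma qconj_component [simp]:
  "qconj q $ 1 = q$1" "qconj q $ 2 = - q$2" "qconj q $ 3 = - q$3" "qconj q $ 4 = - q$4"
  by (simp_all add: qconj_def)

lemma norm_quat: "norm (q :: quat) ^ 2 = q$1 ^ 2 + q$2 ^ 2 + q$3 ^ 2 + q$4 ^ 2"
  by (simp add: norm_vec_def L2_set_def sum_4 real_sqrt_pow2 add_nonneg_nonneg)

lemma qmul_qconj: "norm q = 1 \<Longrightarrow> qmul (qconj q) q = q1"
  using norm_quat[of q] by (simp add: quat_eq_iff power2_eq_square)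

abbreviation qrot :: "quat \<Rightarrow> quat \<Rightarrow> quat" where
  "qrot q p \<equiv> qmul q (qmul p (qconj q))"

context frame begin

lemma act_act_expand:
  assumes "exterior \<alpha>" "p$1 = 0"
  shows "act p (act p \<alpha>) vs =
    p$2 * (p$2 * act qi (act qi \<alpha>) vs + p$3 * act qi (act qj \<alpha>) vs + p$4 * act qi (act qk \<alpha>) vs) +
    p$3 * (p$2 * act qj (act qi \<alpha>) vs + p$3 * act qj (act qj \<alpha>) vs + p$4 * act qj (act qk \<alpha>) vs) +
    p$4 * (p$2 * act qk (act qi \<alpha>) vs + p$3 * act qk (act qj \<alpha>) vs + p$4 * act qk (act qk \<alpha>) vs)"
proof -
  have 1: "act p (act p \<alpha>) vs = p$2 * act qi (act p \<alpha>) vs + p$3 * act qj (act p \<alpha>) vs + p$4 * act qk (act p \<alpha>) vs"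
    using act_expand[OF exterior_act[OF assms(1), of p], of p] assms(2) by simp
  have 2: "act p \<alpha> = (\<lambda>vs. p$2 * act qi \<alpha> vs + p$3 * act qj \<alpha> vs + p$4 * act qk \<alpha> vs)"
    using act_expand[OF assms(1), of p] assms(2) by simp
  show ?thesis
    unfolding 1 unfolding 2 by (simp add: act_linear)
qed

text \<open>Conjugation by a unit quaternion rotates the imaginary quaternions, and a sum of squares
  over an orthonormal basis does not see a rotation.\<close>

lemma casimir_rotation_invariant:
  assumes "exterior \<alpha>" "norm q = 1"
  shows "act (qrot q qi) (act (qrot q qi) \<alpha>) vs + act (qrot q qj) (act (qrot q qj) \<alpha>) vs
    + act (qrot q qk) (act (qrot q qk) \<alpha>) vs = cas \<alpha> vs"
proof -
  define a b c d where "a = q$1" and "b = q$2" and "c = q$3" and "d = q$4"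
  note abcd = a_def[symmetric] b_def[symmetric] c_def[symmetric] d_def[symmetric]
  have n: "a^2 + b^2 + c^2 + d^2 = 1"
    using norm_quat[of q] assms(2) by (simp add: a_def b_def c_def d_def)
  \<comment> \<open>The matrix of the conjugation; the indices 2, 3, 4 stand for i, j, k.\<close>
  define R where "R l m = qrot q (axis m 1) $ l" for l m :: 4
  have R: "R l 2 * R m 2 + R l 3 * R m 3 + R l 4 * R m 4 = (if l = m then 1 else 0)"
    if "l \<in> {2,3,4}" "m \<in> {2,3,4}" for l m
  proof -
    \<comment> \<open>Orthogonality of the rows is a polynomial identity up to the factor |q|^4; the
      norm is set to 1 only afterwards.\<close>
    have "R l 2 * R m 2 + R l 3 * R m 3 + R l 4 * R m 4 = (if l = m then (a^2 + b^2 + c^2 + d^2)^2 else 0)"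
      using that unfolding R_def qi_def[symmetric] qj_def[symmetric] qk_def[symmetric]
      by (elim insertE emptyE; simp add: abcd) (simp_all add: algebra_simps power2_eq_square)
    then show ?thesis
      by (simp add: n)
  qed
  have e: "act (qrot q p) (act (qrot q p) \<alpha>) vs =
    (\<Sum>l\<in>{2,3,4}. \<Sum>m\<in>{2,3,4}. R l s * R m s * act (axis l 1) (act (axis m 1) \<alpha>) vs)"
    if "p = axis s 1" "s \<in> {2,3,4}" for p s
  proof -
    have z: "qrot q p $ 1 = 0"
      using that by (auto simp: qi_def[symmetric] qj_def[symmetric] qk_def[symmetric] algebra_simps simp del: of_nat_numeral)
    show ?thesis
      unfolding act_act_expand[OF assms(1) z]
      by (simp add: R_def that qi_def qj_def qk_def algebra_simps del: qmul_component)
  qed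
  have "act (qrot q qi) (act (qrot q qi) \<alpha>) vs + act (qrot q qj) (act (qrot q qj) \<alpha>) vs
    + act (qrot q qk) (act (qrot q qk) \<alpha>) vs =
    (\<Sum>l\<in>{2,3,4}. \<Sum>m\<in>{2,3,4}. (R l 2 * R m 2 + R l 3 * R m 3 + R l 4 * R m 4) * act (axis l 1) (act (axis m 1) \<alpha>) vs)"
    by (subst e[OF qi_def], simp, subst e[OF qj_def], simp, subst e[OF qk_def], simp)
       (simp only: sum.distrib[symmetric] distrib_right)
  also have "\<dots> = (\<Sum>l\<in>{2,3,4}. \<Sum>m\<in>{2,3,4}. (if l = m then 1 else 0) * act (axis l 1) (act (axis m 1) \<alpha>) vs)"
    by (intro sum.cong refl) (simp only: R)
  also have "\<dots> = cas \<alpha> vs"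
    by (simp add: frame_casimir_def qi_def qj_def qk_def)
  finally show ?thesis .
qed

text \<open>A change of the frame by \<open>h v = q v B\<close> rotates the complex structures.\<close>

lemma casimir_change_frame:
  assumes g: "bij (f \<circ> h)" and h: "h \<in> Sp1GL" and \<alpha>: "exterior \<alpha>"
  shows "frame_casimir (f \<circ> h) \<alpha> vs = cas \<alpha> vs"
proof -
  from h obtain q B where q: "norm q = 1" and hq: "h = left_mult q \<circ> right_mult B"
    by (auto simp: Sp1GL_def)
  have "complex_structure (f \<circ> h) p v = cstr (qrot q p) v" for p v
  proof -
    define w where "w = inv (f \<circ> h) v"
    have v: "v = f (h w)"
      using g by (simp add: w_def bij_is_surj surj_f_inv_f[of "f \<circ> h", unfolded o_def] o_def)
    have "cstr (qrot q p) v = f (left_mult (qrot q p) (h w))"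
      by (simp add: v complex_structure_def)
    also have "left_mult (qrot q p) (h w) = h (left_mult p w)"
      unfolding hq o_def left_mult_left_mult left_mult_right_mult
      by (simp add: qmul_assoc qmul_qconj[OF q] flip: left_mult_left_mult)
    finally show ?thesis
      by (simp add: complex_structure_def w_def)
  qed
  then have c: "complex_structure (f \<circ> h) p = cstr (qrot q p)" for p
    by auto
  show ?thesis
    unfolding frame_casimir_def[of "f \<circ> h"] c by (rule casimir_rotation_invariant[OF \<alpha> q])
qed

end

section \<open>Smooth functions\<close>

lemma Ck_on_cong:
  assumes "open S" "\<And>x. x \<in> S \<Longrightarrow> f x = g x" "Ck_on k f S"
  shows "Ck_on k g S"
  using assms(2,3)
proof (induction k arbitrary: f g)
  case 0
  then show ?case
    by (simp cong: continuous_on_cong)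
next
  case (Suc k)
  have d: "f differentiable (at x)" if "x \<in> S" for x
    using Suc.prems(2) that by simp
  have g: "(g has_derivative frechet_derivative f (at x)) (at x)" if "x \<in> S" for x
    using d[OF that, unfolded frechet_derivative_works] assms(1) that Suc.prems(1)
    by (rule has_derivative_transform_within_open)
  then have "frechet_derivative f (at x) v = frechet_derivative g (at x) v" if "x \<in> S" for x v
    using that by (metis frechet_derivative_at)
  then have "Ck_on k (\<lambda>x. frechet_derivative g (at x) v) S" for v
    using Suc.IH[of "\<lambda>x. frechet_derivative f (at x) v"] Suc.prems(2) by simp
  then show ?case
    using g by (auto simp: differentiable_def)
qed

lemma Ck_on_SucD: "Ck_on (Suc k) f S \<Longrightarrow> Ck_on k f S"
proof (induction k arbitrary: f)
  case 0
  then show ?case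
    by (auto intro!: continuous_at_imp_continuous_on differentiable_imp_continuous_within)
next
  case (Suc k)
  then have "Ck_on k (\<lambda>x. frechet_derivative f (at x) v) S" for v
    by (metis Ck_on.simps(2))
  then show ?case
    using Suc.prems by simp
qed

lemma Ck_on_subset: "Ck_on k f S \<Longrightarrow> T \<subseteq> S \<Longrightarrow> Ck_on k f T"
  by (induction k arbitrary: f) (auto intro: continuous_on_subset)

lemma Ck_on_local:
  assumes "\<And>x. x \<in> S \<Longrightarrow> \<exists>W. open W \<and> x \<in> W \<and> Ck_on k f W"
  shows "Ck_on k f S"
  using assms
proof (induction k arbitrary: f)
  case 0
  have "continuous (at x) f" if "x \<in> S" for x
    using 0[OF that] by (auto simp: continuous_on_eq_continuous_at)
  then show ?case
    by (simp add: continuous_at_imp_continuous_on)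
next
  case (Suc k)
  have "f differentiable (at x)" if "x \<in> S" for x
    using Suc.prems[OF that] by auto
  moreover have "Ck_on k (\<lambda>x. frechet_derivative f (at x) v) S" for v
    using Suc.prems by (intro Suc.IH) (metis Ck_on.simps(2))
  ultimately show ?case by simp
qed

text \<open>Allows smoothness to be proved by recursion through an explicit formula for the
  derivative, without computing any \<open>frechet_derivative\<close>.\<close>

lemma Ck_on_has_derivativeI:
  assumes "open S" "\<And>x. x \<in> S \<Longrightarrow> (f has_derivative f' x) (at x)" "\<And>v. Ck_on k (\<lambda>x. f' x v) S"
  shows "Ck_on (Suc k) f S"
proof -
  have "f' x v = frechet_derivative f (at x) v" if "x \<in> S" for x v
    using frechet_derivative_at[OF assms(2)[OF that]] by simp
  then have "Ck_on k (\<lambda>x. frechet_derivative f (at x) v) S" for v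
    using Ck_on_cong[OF assms(1) _ assms(3)[of v]] by simp
  then show ?thesis
    using assms(2) by (auto simp: differentiable_def)
qed

lemma Ck_on_has_derivative:
  "Ck_on (Suc k) f S \<Longrightarrow> x \<in> S \<Longrightarrow> (f has_derivative frechet_derivative f (at x)) (at x)"
  by (simp add: frechet_derivative_works)

lemma Ck_on_const: "open S \<Longrightarrow> Ck_on k (\<lambda>x. c) S"
proof (induction k arbitrary: c)
  case (Suc k)
  then show ?case
    by (intro Ck_on_has_derivativeI[where f'="\<lambda>x v. 0"]) auto
qed simp

lemma Ck_on_add:
  "open S \<Longrightarrow> Ck_on k f S \<Longrightarrow> Ck_on k g S \<Longrightarrow> Ck_on k (\<lambda>x. f x + g x) S"
proof (induction k arbitrary: f g)
  case (Suc k)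
  show ?case
  proof (rule Ck_on_has_derivativeI[OF Suc.prems(1)])
    show "((\<lambda>x. f x + g x) has_derivative
        (\<lambda>v. frechet_derivative f (at x) v + frechet_derivative g (at x) v)) (at x)" if "x \<in> S" for x
      by (intro has_derivative_add Ck_on_has_derivative[OF Suc.prems(2) that] Ck_on_has_derivative[OF Suc.prems(3) that])
    show "Ck_on k (\<lambda>x. frechet_derivative f (at x) v + frechet_derivative g (at x) v) S" for v
      using Suc.prems by (intro Suc.IH) auto
  qed
qed (simp add: continuous_on_add)

lemma Ck_on_mult:
  fixes f g :: "'e::euclidean_space \<Rightarrow> real"
  shows "open S \<Longrightarrow> Ck_on k f S \<Longrightarrow> Ck_on k g S \<Longrightarrow> Ck_on k (\<lambda>x. f x * g x) S"
proof (induction k arbitrary: f g)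
  case (Suc k)
  show ?case
  proof (rule Ck_on_has_derivativeI[OF Suc.prems(1)])
    show "((\<lambda>x. f x * g x) has_derivative
        (\<lambda>v. f x * frechet_derivative g (at x) v + frechet_derivative f (at x) v * g x)) (at x)" if "x \<in> S" for x
      by (intro has_derivative_mult Ck_on_has_derivative[OF Suc.prems(2) that] Ck_on_has_derivative[OF Suc.prems(3) that])
    show "Ck_on k (\<lambda>x. f x * frechet_derivative g (at x) v + frechet_derivative f (at x) v * g x) S" for v
      using Suc.prems Suc.prems(2,3)[THEN Ck_on_SucD] by (intro Suc.IH Ck_on_add) auto
  qed
qed (simp add: continuous_on_mult)

lemma Ck_on_inner_const: "open S \<Longrightarrow> Ck_on k f S \<Longrightarrow> Ck_on k (\<lambda>x. f x \<bullet> c) S"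
proof (induction k arbitrary: f)
  case (Suc k)
  show ?case
  proof (rule Ck_on_has_derivativeI[OF Suc.prems(1)])
    show "((\<lambda>x. f x \<bullet> c) has_derivative (\<lambda>v. frechet_derivative f (at x) v \<bullet> c)) (at x)" if "x \<in> S" for x
      by (intro has_derivative_inner_left Ck_on_has_derivative[OF Suc.prems(2) that])
    show "Ck_on k (\<lambda>x. frechet_derivative f (at x) v \<bullet> c) S" for v
      using Suc.prems by (intro Suc.IH) auto
  qed
qed (simp add: continuous_on_inner)

lemma smooth_on_const: "open S \<Longrightarrow> smooth_on (\<lambda>x. c) S"
  by (simp add: smooth_on_def Ck_on_const)

lemma smooth_on_add: "open S \<Longrightarrow> smooth_on f S \<Longrightarrow> smooth_on g S \<Longrightarrow> smooth_on (\<lambda>x. f x + g x) S"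
  by (simp add: smooth_on_def Ck_on_add)

lemma smooth_on_mult:
  fixes f g :: "'e::euclidean_space \<Rightarrow> real"
  shows "open S \<Longrightarrow> smooth_on f S \<Longrightarrow> smooth_on g S \<Longrightarrow> smooth_on (\<lambda>x. f x * g x) S"
  by (simp add: smooth_on_def Ck_on_mult)

lemma smooth_on_cmult:
  fixes f :: "'e::euclidean_space \<Rightarrow> real"
  shows "open S \<Longrightarrow> smooth_on f S \<Longrightarrow> smooth_on (\<lambda>x. c * f x) S"
  by (intro smooth_on_mult smooth_on_const)

lemma smooth_on_diff:
  fixes f g :: "'e::euclidean_space \<Rightarrow> real"
  shows "open S \<Longrightarrow> smooth_on f S \<Longrightarrow> smooth_on g S \<Longrightarrow> smooth_on (\<lambda>x. f x - g x) S"
  using smooth_on_add[of S f "\<lambda>x. (- 1) * g x"] smooth_on_cmult[of S g "-1"] by simp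

lemma smooth_on_sum:
  "open S \<Longrightarrow> (\<And>i. i \<in> I \<Longrightarrow> smooth_on (f i) S) \<Longrightarrow> smooth_on (\<lambda>x. \<Sum>i\<in>I. f i x) S"
  by (induction I rule: infinite_finite_induct) (simp_all add: smooth_on_const smooth_on_add)

lemma smooth_on_inner_const: "open S \<Longrightarrow> smooth_on f S \<Longrightarrow> smooth_on (\<lambda>x. f x \<bullet> c) S"
  by (simp add: smooth_on_def Ck_on_inner_const)

lemma smooth_on_cong: "open S \<Longrightarrow> (\<And>x. x \<in> S \<Longrightarrow> f x = g x) \<Longrightarrow> smooth_on f S \<Longrightarrow> smooth_on g S"
  unfolding smooth_on_def using Ck_on_cong by blast

lemma smooth_on_subset: "smooth_on f S \<Longrightarrow> T \<subseteq> S \<Longrightarrow> smooth_on f T"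
  unfolding smooth_on_def using Ck_on_subset by blast

text \<open>Needed because the projections can be compared with smooth expressions only where a
  local section of frames exists.\<close>

lemma smooth_on_local:
  assumes "\<And>x. x \<in> S \<Longrightarrow> \<exists>W. open W \<and> x \<in> W \<and> smooth_on f W"
  shows "smooth_on f S"
  unfolding smooth_on_def
proof (intro allI Ck_on_local)
  fix k x assume "x \<in> S"
  then show "\<exists>W. open W \<and> x \<in> W \<and> Ck_on k f W"
    using assms[of x] unfolding smooth_on_def by blast
qed

lemma smooth_on_derivative: "smooth_on f S \<Longrightarrow> smooth_on (\<lambda>x. frechet_derivative f (at x) v) S"
  unfolding smooth_on_def by (metis Ck_on.simps(2))

lemma smooth_on_has_derivative:
  "smooth_on f S \<Longrightarrow> x \<in> S \<Longrightarrow> (f has_derivative frechet_derivative f (at x)) (at x)"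
  unfolding smooth_on_def using Ck_on_has_derivative by blast

lemma smooth_on_continuous_on: "smooth_on f S \<Longrightarrow> continuous_on S f"
  unfolding smooth_on_def by (metis Ck_on.simps(1))

subsection \<open>Symmetry of the second derivative\<close>

text \<open>The mean value theorem is applied twice: along \<open>u\<close> to the increment of
  \<open>f\<close> by \<open>t\<close> times \<open>v\<close>, then along \<open>v\<close> to the
  derivative of \<open>f\<close> in the direction \<open>u\<close>. The second difference is
  symmetric in \<open>u\<close> and \<open>v\<close>, whereas the right-hand side is not visibly
  so.\<close>

lemma second_difference:
  fixes f :: "'e::euclidean_space \<Rightarrow> real"
  assumes f: "smooth_on f (ball x d)" and t: "t > 0" "t * (norm u + norm v) < d"
  obtains p where "p \<in> ball x d" "dist x p \<le> t * (norm u + norm v)"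
    "f (x + t *\<^sub>R u + t *\<^sub>R v) - f (x + t *\<^sub>R u) - f (x + t *\<^sub>R v) + f x =
      t ^ 2 * frechet_derivative (\<lambda>y. frechet_derivative f (at y) u) (at p) v"
proof -
  have near: "dist x (x + a *\<^sub>R u + b *\<^sub>R v) \<le> t * (norm u + norm v)"
    if "0 \<le> a" "a \<le> t" "0 \<le> b" "b \<le> t" for a b
  proof -
    have "norm (a *\<^sub>R u + b *\<^sub>R v) \<le> a * norm u + b * norm v"
      using norm_triangle_ineq[of "a *\<^sub>R u" "b *\<^sub>R v"] that by simp
    also have "\<dots> \<le> t * norm u + t * norm v"
      using that by (intro add_mono mult_right_mono) auto
    finally show ?thesis
      by (simp add: dist_norm algebra_simps norm_minus_commute)
  qed
  then have inS: "x + a *\<^sub>R u + b *\<^sub>R v \<in> ball x d"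
    if "0 \<le> a" "a \<le> t" "0 \<le> b" "b \<le> t" for a b
    using that t(2) by (fastforce simp: mem_ball)
  let ?Du = "\<lambda>y. frechet_derivative f (at y) u"
  have DERIV_line: "((\<lambda>s. g (z + s *\<^sub>R w)) has_real_derivative frechet_derivative g (at (z + s *\<^sub>R w)) w) (at s)"
    if "smooth_on g (ball x d)" "z + s *\<^sub>R w \<in> ball x d" for g :: "'e \<Rightarrow> real" and z w s
  proof -
    have g: "(g has_derivative frechet_derivative g (at (z + s *\<^sub>R w))) (at (z + s *\<^sub>R w))"
      by (rule smooth_on_has_derivative[OF that])
    have "((\<lambda>s. g (z + s *\<^sub>R w)) has_derivative (\<lambda>h. frechet_derivative g (at (z + s *\<^sub>R w)) (h *\<^sub>R w))) (at s)"
      by (rule has_derivative_compose[of "\<lambda>s. z + s *\<^sub>R w" "\<lambda>h. h *\<^sub>R w", OF _ g])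
         (auto intro!: derivative_eq_intros)
    then show ?thesis
      using linear_scale[OF has_derivative_linear[OF g]]
      by (simp add: has_field_derivative_def mult.commute[of _ "frechet_derivative g _ _"])
  qed
  define \<phi> where "\<phi> s = f (x + t *\<^sub>R v + s *\<^sub>R u) - f (x + s *\<^sub>R u)" for s
  have "\<exists>a. a > 0 \<and> a < t \<and> \<phi> t - \<phi> 0 = (t - 0) * (?Du (x + t *\<^sub>R v + a *\<^sub>R u) - ?Du (x + a *\<^sub>R u))"
  proof (rule MVT2[OF t(1)])
    fix s assume s: "0 \<le> s" "s \<le> t"
    show "DERIV \<phi> s :> ?Du (x + t *\<^sub>R v + s *\<^sub>R u) - ?Du (x + s *\<^sub>R u)"
      unfolding \<phi>_def
      using inS[of s t] inS[of s 0] s t(1) by (intro DERIV_diff DERIV_line f) (simp_all add: algebra_simps)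
  qed
  then obtain a where a: "0 < a" "a < t" "\<phi> t - \<phi> 0 = t * (?Du (x + t *\<^sub>R v + a *\<^sub>R u) - ?Du (x + a *\<^sub>R u))"
    by auto
  define \<psi> where "\<psi> s = ?Du (x + a *\<^sub>R u + s *\<^sub>R v)" for s
  have "\<exists>b. b > 0 \<and> b < t \<and> \<psi> t - \<psi> 0 = (t - 0) * frechet_derivative ?Du (at (x + a *\<^sub>R u + b *\<^sub>R v)) v"
  proof (rule MVT2[OF t(1)])
    fix s assume s: "0 \<le> s" "s \<le> t"
    show "DERIV \<psi> s :> frechet_derivative ?Du (at (x + a *\<^sub>R u + s *\<^sub>R v)) v"
      unfolding \<psi>_def
      using inS[of a s] s a by (intro DERIV_line smooth_on_derivative f) simp_all
  qed
  then obtain b where b: "0 < b" "b < t" "\<psi> t - \<psi> 0 = t * frechet_derivative ?Du (at (x + a *\<^sub>R u + b *\<^sub>R v)) v"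
    by auto
  show thesis
  proof (rule that[of "x + a *\<^sub>R u + b *\<^sub>R v"])
    show "f (x + t *\<^sub>R u + t *\<^sub>R v) - f (x + t *\<^sub>R u) - f (x + t *\<^sub>R v) + f x =
      t ^ 2 * frechet_derivative ?Du (at (x + a *\<^sub>R u + b *\<^sub>R v)) v"
      using a(3) b(3) by (simp add: \<phi>_def \<psi>_def power2_eq_square ac_simps)
  qed (use inS near a b in \<open>auto simp: less_imp_le\<close>)
qed

text \<open>For small \<open>t\<close> the two mixed derivatives, taken at two points close to
  \<open>x\<close>, equal the same second difference divided by \<open>t ^ 2\<close>; continuity of
  both at \<open>x\<close> concludes.\<close>

lemma second_derivative_symmetric:
  fixes f :: "'e::euclidean_space \<Rightarrow> real"
  assumes S: "open S" "x \<in> S" and f: "smooth_on f S"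
  shows "frechet_derivative (\<lambda>y. frechet_derivative f (at y) u) (at x) v =
    frechet_derivative (\<lambda>y. frechet_derivative f (at y) v) (at x) u"
proof -
  define D where "D u v y = frechet_derivative (\<lambda>y. frechet_derivative f (at y) u) (at y) v" for u v y
  have cont: "isCont (D u v) x" for u v
    using smooth_on_continuous_on[OF smooth_on_derivative[OF smooth_on_derivative[OF f]]] S
    unfolding D_def by (simp add: continuous_on_eq_continuous_at)
  have "\<bar>D u v x - D v u x\<bar> < e" if e: "e > 0" for e
  proof -
    obtain d0 where d0: "d0 > 0" "ball x d0 \<subseteq> S"
      using S open_contains_ball by blast
    obtain d1 where d1: "d1 > 0" "\<And>y. dist y x < d1 \<Longrightarrow> dist (D u v y) (D u v x) < e / 2"
      using cont[of u v] e unfolding continuous_at_eps_delta by (metis half_gt_zero)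
    obtain d2 where d2: "d2 > 0" "\<And>y. dist y x < d2 \<Longrightarrow> dist (D v u y) (D v u x) < e / 2"
      using cont[of v u] e unfolding continuous_at_eps_delta by (metis half_gt_zero)
    define d where "d = min d0 (min d1 d2)"
    have d: "d > 0" "smooth_on f (ball x d)"
      using d0 d1 d2 by (auto simp: d_def intro!: smooth_on_subset[OF f])
    \<comment> \<open>Keeps the parallelogram within distance d/2; the summand 1 avoids division by
      zero when both vectors vanish.\<close>
    define t where "t = d / (2 * (norm u + norm v + 1))"
    have t: "t > 0" "t * (norm u + norm v) < d"
    proof -
      have p: "2 * (norm u + norm v + 1) > 0"
        by (simp add: add_nonneg_pos)
      then show "t > 0"
        using d by (simp add: t_def)
      have "t * (norm u + norm v) \<le> t * (norm u + norm v + 1)"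
        using \<open>t > 0\<close> by simp
      also have "\<dots> = d / 2"
        using p by (simp add: t_def field_simps)
      finally show "t * (norm u + norm v) < d"
        using d by simp
    qed
    obtain p where p: "p \<in> ball x d"
      "f (x + t *\<^sub>R u + t *\<^sub>R v) - f (x + t *\<^sub>R u) - f (x + t *\<^sub>R v) + f x = t ^ 2 * D u v p"
      using second_difference[OF d(2) t] unfolding D_def by metis
    have "t * (norm v + norm u) < d"
      using t(2) by (simp add: add.commute)
    then obtain q where q: "q \<in> ball x d"
      "f (x + t *\<^sub>R v + t *\<^sub>R u) - f (x + t *\<^sub>R v) - f (x + t *\<^sub>R u) + f x = t ^ 2 * D v u q"
      using second_difference[OF d(2) t(1)] unfolding D_def by metis
    have "t ^ 2 * D u v p = t ^ 2 * D v u q"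
      using p(2) q(2) by (simp add: algebra_simps)
    then have "D u v p = D v u q"
      using t(1) by simp
    moreover have "\<bar>D u v p - D u v x\<bar> < e / 2" "\<bar>D v u q - D v u x\<bar> < e / 2"
      using d1(2)[of p] d2(2)[of q] p(1) q(1) by (auto simp: d_def dist_commute dist_real_def)
    ultimately show ?thesis
      by linarith
  qed
  then have "\<bar>D u v x - D v u x\<bar> = 0"
    by (metis abs_ge_zero less_irrefl not_le order_le_less)
  then show ?thesis
    by (simp add: D_def)
qed

section \<open>Derivatives of families of forms\<close>

text \<open>A product rule in which \<open>k\<close> is merely continuous, at a zero of
  \<open>h\<close>. It lets inverse frames be differentiated when only their continuity is
  known.\<close>

lemma has_derivative_scaleR_vanishing:
  fixes h :: "'a::real_normed_vector \<Rightarrow> real" and k :: "'a \<Rightarrow> 'b::real_normed_vector"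
  assumes h: "(h has_derivative h') (at x)" and z: "h x = 0" and k: "isCont k x"
  shows "((\<lambda>y. h y *\<^sub>R k y) has_derivative (\<lambda>u. h' u *\<^sub>R k x)) (at x)"
proof -
  have bl: "bounded_linear h'"
    using h by (rule has_derivative_bounded_linear)
  obtain C where C: "\<And>u. norm (h' u) \<le> norm u * C"
    using bounded_linear.bounded[OF bl] by blast
  have k0: "((\<lambda>y. k y - k x) \<longlongrightarrow> 0) (at x)"
    using k by (simp add: isCont_def LIM_zero)
  have h0: "((\<lambda>y. (h y - h' (y - x)) / norm (y - x)) \<longlongrightarrow> 0) (at x)"
    using h z unfolding has_derivative_at2 by (simp add: divide_inverse mult.commute)
  have 1: "((\<lambda>y. ((h y - h' (y - x)) / norm (y - x)) *\<^sub>R k y) \<longlongrightarrow> 0) (at x)"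
    using tendsto_scaleR[OF h0 k[unfolded isCont_def]] by simp
  have 2: "((\<lambda>y. (h' (y - x) / norm (y - x)) *\<^sub>R (k y - k x)) \<longlongrightarrow> 0) (at x)"
  proof (rule Lim_null_comparison)
    show "((\<lambda>y. \<bar>C\<bar> * norm (k y - k x)) \<longlongrightarrow> 0) (at x)"
      using tendsto_mult[OF tendsto_const tendsto_norm_zero[OF k0], of "\<bar>C\<bar>"] by simp
    have "\<bar>h' u\<bar> / norm u \<le> \<bar>C\<bar>" for u
    proof (cases "u = 0")
      case False
      have "\<bar>h' u\<bar> \<le> norm u * \<bar>C\<bar>"
        using C[of u] mult_left_mono[OF abs_ge_self[of C] norm_ge_zero[of u]] by simp
      then show ?thesis
        using False by (simp add: field_simps)
    qed simp
    then show "\<forall>\<^sub>F y in at x. norm ((h' (y - x) / norm (y - x)) *\<^sub>R (k y - k x)) \<le> \<bar>C\<bar> * norm (k y - k x)"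
      by (intro always_eventually allI) (simp only: norm_scaleR real_norm_def abs_divide abs_norm_cancel mult_right_mono norm_ge_zero)
  qed
  have "((\<lambda>y. (1 / norm (y - x)) *\<^sub>R (h y *\<^sub>R k y - (h x *\<^sub>R k x + h' (y - x) *\<^sub>R k x))) \<longlongrightarrow> 0) (at x)"
    using tendsto_add[OF 1 2] by (simp add: z algebra_simps diff_divide_distrib)
  then show ?thesis
    by (simp add: has_derivative_at2 bounded_linear_scaleR_left[THEN bounded_linear_compose, OF bl] divide_inverse)
qed

lemma linear_expand:
  fixes f :: "'e::euclidean_space \<Rightarrow> 'b::real_vector"
  assumes "linear f"
  shows "f v = (\<Sum>b\<in>Basis. (v \<bullet> b) *\<^sub>R f b)"
  using linear_sum[OF assms, of "\<lambda>b. (v \<bullet> b) *\<^sub>R b" Basis]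
  by (simp add: euclidean_representation linear_scale[OF assms])

text \<open>Derivatives are known only for each fixed argument \<open>v\<close>; linearity and a
  finite basis upgrade this to linearity of the derivative in \<open>v\<close> and to a product rule
  with a moving argument.\<close>

lemma linear_family_derivative:
  fixes h :: "'e::euclidean_space \<Rightarrow> 'e \<Rightarrow> 'b::real_normed_vector"
  assumes W: "open W" "x \<in> W" and lin: "\<And>y. y \<in> W \<Longrightarrow> linear (h y)"
    and d: "\<And>v. ((\<lambda>y. h y v) has_derivative (\<lambda>u. h' u v)) (at x)"
  shows "h' u v = (\<Sum>a\<in>Basis. (v \<bullet> a) *\<^sub>R h' u a)"
    and "(g has_derivative g') (at x) \<Longrightarrow>
      ((\<lambda>y. h y (g y)) has_derivative (\<lambda>u. h' u (g x) + h x (g' u))) (at x)"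
proof -
  have e: "h' u v = (\<Sum>a\<in>Basis. (v \<bullet> a) *\<^sub>R h' u a)" for u v
  proof -
    have "((\<lambda>y. \<Sum>a\<in>Basis. (v \<bullet> a) *\<^sub>R h y a) has_derivative (\<lambda>u. \<Sum>a\<in>Basis. (v \<bullet> a) *\<^sub>R h' u a)) (at x)"
      by (intro has_derivative_sum has_derivative_scaleR_right d)
    then have "((\<lambda>y. h y v) has_derivative (\<lambda>u. \<Sum>a\<in>Basis. (v \<bullet> a) *\<^sub>R h' u a)) (at x)"
      by (rule has_derivative_transform_within_open[OF _ W]) (simp add: linear_expand[OF lin, of _ v])
    from has_derivative_unique[OF d this] show ?thesis
      by (rule fun_cong)
  qed
  then show "h' u v = (\<Sum>a\<in>Basis. (v \<bullet> a) *\<^sub>R h' u a)" .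
  assume g: "(g has_derivative g') (at x)"
  have "((\<lambda>y. \<Sum>b\<in>Basis. (g y \<bullet> b) *\<^sub>R h y b) has_derivative
      (\<lambda>u. \<Sum>b\<in>Basis. (g x \<bullet> b) *\<^sub>R h' u b + (g' u \<bullet> b) *\<^sub>R h x b)) (at x)"
    by (intro has_derivative_sum has_derivative_scaleR has_derivative_inner_left g d)
  then have "((\<lambda>y. \<Sum>b\<in>Basis. (g y \<bullet> b) *\<^sub>R h y b) has_derivative (\<lambda>u. h' u (g x) + h x (g' u))) (at x)"
    by (simp add: sum.distrib flip: e linear_expand[OF lin[OF W(2)]])
  then show "((\<lambda>y. h y (g y)) has_derivative (\<lambda>u. h' u (g x) + h x (g' u))) (at x)"
    by (rule has_derivative_transform_within_open[OF _ W]) (simp flip: linear_expand[OF lin])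
qed

locale smooth_iso_family =
  fixes W :: "'e::euclidean_space set" and s :: "'e \<Rightarrow> 'e \<Rightarrow> 'e"
  assumes open_W: "open W"
    and linear_s: "\<And>y. y \<in> W \<Longrightarrow> linear (s y)"
    and bij_s: "\<And>y. y \<in> W \<Longrightarrow> bij (s y)"
    and smooth_s: "\<And>v. smooth_on (\<lambda>y. s y v) W"
begin

definition ds :: "'e \<Rightarrow> 'e \<Rightarrow> 'e \<Rightarrow> 'e" where
  "ds x v u = frechet_derivative (\<lambda>y. s y v) (at x) u"

lemma inv_s_simps [simp]: "y \<in> W \<Longrightarrow> inv (s y) (s y v) = v" "y \<in> W \<Longrightarrow> s y (inv (s y) v) = v"
  using bij_s by (simp_all add: bij_is_inj bij_is_surj surj_f_inv_f)

lemma linear_inv_s: "y \<in> W \<Longrightarrow> linear (inv (s y))"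
  using linear_s bij_s by (simp add: bij_is_inj linear_injective_imp_surjective inj_linear_imp_inv_linear)

lemma s_has_derivative: "x \<in> W \<Longrightarrow> ((\<lambda>y. s y v) has_derivative ds x v) (at x)"
  unfolding ds_def[abs_def] by (rule smooth_on_has_derivative[OF smooth_s])

lemma eventually_W: "x \<in> W \<Longrightarrow> \<forall>\<^sub>F y in at x. y \<in> W"
  using open_W by (rule eventually_at_in_open')

text \<open>The injective map \<open>s x\<close> is bounded below by some m, and nearby maps differ
  from it by at most m/2 in operator norm; so they are bounded below by m/2 and their inverses are
  bounded by 2/m.\<close>

lemma inv_s_bounded:
  assumes x: "x \<in> W"
  obtains B where "B > 0" "\<forall>\<^sub>F y in at x. y \<in> W \<and> (\<forall>z. norm (inv (s y) z) \<le> B * norm z)"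
proof -
  obtain m where m: "m > 0" "\<And>z. m * norm z \<le> norm (s x z)"
    using linear_inj_bounded_below_pos[OF linear_s[OF x] bij_is_inj[OF bij_s[OF x]]] by blast
  have "isCont (\<lambda>y. s y v) x" for v
    using has_derivative_continuous[OF s_has_derivative[OF x]] by simp
  then have "((\<lambda>y. \<Sum>b\<in>Basis. norm (s y b - s x b)) \<longlongrightarrow> (\<Sum>b\<in>(Basis::'e set). 0)) (at x)"
    by (intro tendsto_sum tendsto_norm_zero LIM_zero) (simp add: isCont_def)
  then have "((\<lambda>y. \<Sum>b\<in>Basis. norm (s y b - s x b)) \<longlongrightarrow> 0) (at x)" by simp
  then have "\<forall>\<^sub>F y in at x. (\<Sum>b\<in>Basis. norm (s y b - s x b)) < m / 2"
    using m(1) by (intro order_tendstoD(2)) auto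
  with eventually_W[OF x] have "\<forall>\<^sub>F y in at x. y \<in> W \<and> (\<forall>z. norm (inv (s y) z) \<le> (2 / m) * norm z)"
  proof eventually_elim
    case (elim y)
    have low: "m / 2 * norm z \<le> norm (s y z)" for z
    proof -
      have "linear (\<lambda>v. s y v - s x v)"
        by (intro linear_compose_sub linear_s x elim)
      then have "s y z - s x z = (\<Sum>b\<in>Basis. (z \<bullet> b) *\<^sub>R (s y b - s x b))"
        by (rule linear_expand)
      then have "norm (s y z - s x z) \<le> (\<Sum>b\<in>Basis. norm z * norm (s y b - s x b))"
        by (auto intro!: sum_norm_le mult_right_mono Basis_le_norm)
      also have "\<dots> = norm z * (\<Sum>b\<in>Basis. norm (s y b - s x b))"
        by (simp add: sum_distrib_left)
      also have "\<dots> \<le> norm z * (m / 2)"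
        using elim(2) by (intro mult_left_mono) auto
      finally have "norm (s y z - s x z) \<le> norm z * (m / 2)" .
      moreover have "norm (s x z) \<le> norm (s y z) + norm (s y z - s x z)"
        by (metis add.commute norm_minus_commute norm_triangle_sub)
      ultimately show ?thesis
        using m(2)[of z] by (simp add: algebra_simps)
    qed
    have "norm (inv (s y) z) \<le> (2 / m) * norm z" for z
      using low[of "inv (s y) z"] m(1) elim(1) by (simp add: field_simps)
    with elim(1) show ?case by blast
  qed
  with m(1) that[of "2 / m"] show thesis by auto
qed

text \<open>The resolvent identity. It yields continuity of the inverse from local boundedness, and
  then differentiability from continuity.\<close>

lemma inv_s_diff:
  assumes "x \<in> W" "y \<in> W"
  shows "inv (s y) v = inv (s x) v - inv (s y) (s y (inv (s x) v) - s x (inv (s x) v))"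
  using assms by (simp add: linear_diff[OF linear_inv_s])

lemma isCont_inv_s:
  assumes x: "x \<in> W"
  shows "isCont (\<lambda>y. inv (s y) v) x"
proof -
  obtain B where B: "B > 0" "\<forall>\<^sub>F y in at x. y \<in> W \<and> (\<forall>z. norm (inv (s y) z) \<le> B * norm z)"
    using inv_s_bounded[OF x] by blast
  let ?w = "inv (s x) v"
  have "isCont (\<lambda>y. s y ?w) x"
    using has_derivative_continuous[OF s_has_derivative[OF x]] by simp
  then have "((\<lambda>y. B * norm (s y ?w - s x ?w)) \<longlongrightarrow> 0) (at x)"
    by (intro tendsto_mult_right_zero tendsto_norm_zero LIM_zero) (simp add: isCont_def)
  moreover have "\<forall>\<^sub>F y in at x. norm (inv (s y) v - inv (s x) v) \<le> B * norm (s y ?w - s x ?w)"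
    using B(2)
  proof eventually_elim
    case (elim y)
    then have "norm (inv (s y) v - inv (s x) v) = norm (inv (s y) (s y ?w - s x ?w))"
      using inv_s_diff[OF x, of y v] by (metis add_diff_cancel_left' diff_add_cancel norm_minus_commute)
    with elim show ?case by simp
  qed
  ultimately have "((\<lambda>y. inv (s y) v - inv (s x) v) \<longlongrightarrow> 0) (at x)"
    by (rule Lim_null_comparison[rotated])
  then show ?thesis
    by (simp add: isCont_def LIM_zero_iff)
qed

lemma ds_expand: "x \<in> W \<Longrightarrow> ds x w u = (\<Sum>a\<in>Basis. (w \<bullet> a) *\<^sub>R ds x a u)"
  by (rule linear_family_derivative(1)[where h=s and h'="\<lambda>u w. ds x w u", OF open_W])
     (use linear_s s_has_derivative in auto)

text \<open>In the resolvent identity, expanded in a basis, the coefficients vanish at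
  \<open>x\<close> and the factors \<open>inv (s y) b\<close> are continuous, so the product rule
  for a vanishing factor applies.\<close>

lemma inv_s_has_derivative:
  assumes x: "x \<in> W"
  shows "((\<lambda>y. inv (s y) v) has_derivative (\<lambda>u. - inv (s x) (ds x (inv (s x) v) u))) (at x)"
proof -
  let ?w = "inv (s x) v"
  have "((\<lambda>y. (s y ?w - s x ?w) \<bullet> b) has_derivative (\<lambda>u. ds x ?w u \<bullet> b)) (at x)" for b
    using has_derivative_diff[OF s_has_derivative[OF x, of ?w] has_derivative_const[of "s x ?w"]]
    by (intro has_derivative_inner_left) simp
  then have "((\<lambda>y. \<Sum>b\<in>Basis. ((s y ?w - s x ?w) \<bullet> b) *\<^sub>R inv (s y) b) has_derivative
      (\<lambda>u. \<Sum>b\<in>Basis. (ds x ?w u \<bullet> b) *\<^sub>R inv (s x) b)) (at x)"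
    by (intro has_derivative_sum has_derivative_scaleR_vanishing isCont_inv_s x) (simp_all only: diff_self inner_zero_left)
  then have "((\<lambda>y. ?w - (\<Sum>b\<in>Basis. ((s y ?w - s x ?w) \<bullet> b) *\<^sub>R inv (s y) b)) has_derivative
      (\<lambda>u. 0 - (\<Sum>b\<in>Basis. (ds x ?w u \<bullet> b) *\<^sub>R inv (s x) b))) (at x)"
    by (intro has_derivative_diff has_derivative_const)
  then have "((\<lambda>y. ?w - (\<Sum>b\<in>Basis. ((s y ?w - s x ?w) \<bullet> b) *\<^sub>R inv (s y) b)) has_derivative
      (\<lambda>u. - inv (s x) (ds x ?w u))) (at x)"
    by (simp flip: linear_expand[OF linear_inv_s[OF x]])
  then show ?thesis
  proof (rule has_derivative_transform_within_open[OF _ open_W x])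
    fix y assume y: "y \<in> W"
    show "?w - (\<Sum>b\<in>Basis. ((s y ?w - s x ?w) \<bullet> b) *\<^sub>R inv (s y) b) = inv (s y) v"
      unfolding linear_expand[OF linear_inv_s[OF y], symmetric] by (rule inv_s_diff[OF x y, symmetric])
  qed
qed

text \<open>Bootstrapping: the derivative of the inverse is a polynomial in components of the
  inverse itself and of the derivatives of \<open>s\<close>, so the class C^k improves to C^(k+1).
  Working with components keeps all products real-valued.\<close>

lemma smooth_inv_s: "smooth_on (\<lambda>y. inv (s y) v \<bullet> c) W"
proof -
  have "Ck_on k (\<lambda>y. inv (s y) v \<bullet> c) W" for k
  proof (induction k arbitrary: v c)
    case 0
    have "continuous_on W (\<lambda>y. inv (s y) v)"
      by (intro continuous_at_imp_continuous_on ballI isCont_inv_s)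
    then show ?case
      by (simp add: continuous_on_inner)
  next
    case (Suc k)
    show ?case
    proof (rule Ck_on_has_derivativeI[OF open_W])
      fix x assume x: "x \<in> W"
      have "((\<lambda>y. inv (s y) v \<bullet> c) has_derivative (\<lambda>u. (- inv (s x) (ds x (inv (s x) v) u)) \<bullet> c)) (at x)"
        by (intro has_derivative_inner_left inv_s_has_derivative x)
      moreover have "- inv (s x) (ds x (inv (s x) v) u) \<bullet> c =
          (\<Sum>b\<in>Basis. \<Sum>a\<in>Basis. (-1) * ((inv (s x) v \<bullet> a) * ((ds x a u \<bullet> b) * (inv (s x) b \<bullet> c))))" for u
        by (subst linear_expand[OF linear_inv_s[OF x], of "ds x _ u"], subst ds_expand[OF x])
           (simp add: inner_sum_left sum_distrib_left sum_distrib_right sum_negf mult.assoc)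
      ultimately show "((\<lambda>y. inv (s y) v \<bullet> c) has_derivative (\<lambda>u.
        (\<Sum>b\<in>Basis. \<Sum>a\<in>Basis. (-1) * ((inv (s x) v \<bullet> a) * ((ds x a u \<bullet> b) * (inv (s x) b \<bullet> c)))))) (at x)"
        by simp
    next
      have C: "Ck_on k (\<lambda>y. \<Sum>i\<in>I. f i y) W" if "finite I" "\<And>i. Ck_on k (f i) W" for I and f :: "'e \<Rightarrow> 'e \<Rightarrow> real"
        using that by (induction I rule: finite_induct) (simp_all add: Ck_on_const Ck_on_add open_W)
      have "Ck_on k (\<lambda>x. ds x a u \<bullet> b) W" for a b u
        using smooth_on_inner_const[OF open_W smooth_on_derivative[OF smooth_s]] unfolding ds_def smooth_on_def by blast
      then show "Ck_on k (\<lambda>x. \<Sum>b\<in>Basis. \<Sum>a\<in>Basis. (-1) * ((inv (s x) v \<bullet> a) * ((ds x a u \<bullet> b) * (inv (s x) b \<bullet> c)))) W" for u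
        by (intro C finite_Basis Ck_on_mult Ck_on_const open_W Suc)
    qed
  qed
  then show ?thesis
    by (simp add: smooth_on_def)
qed

lemma s_apply_has_derivative:
  assumes "x \<in> W" "(g has_derivative g') (at x)"
  shows "((\<lambda>y. s y (g y)) has_derivative (\<lambda>u. ds x (g x) u + s x (g' u))) (at x)"
  by (rule linear_family_derivative(2)[where h=s and h'="\<lambda>u w. ds x w u", OF open_W])
     (use linear_s s_has_derivative assms in auto)

end

section \<open>Families of forms\<close>

lemma exterior_expand_nth:
  assumes "exterior \<alpha>" "m < length vs"
  shows "\<alpha> (vs[m := v]) = (\<Sum>b\<in>Basis. (v \<bullet> b) * \<alpha> (vs[m := b]))"
proof -
  have "vs[m := w] = take m vs @ w # drop (Suc m) vs" for w
    using assms(2) by (rule upd_conv_take_nth_drop)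
  then show ?thesis
    using linear_expand[OF exterior_linear[OF assms(1), of "take m vs" "drop (Suc m) vs"], of v] by simp
qed

locale form_family =
  fixes W :: "'e::euclidean_space set" and \<omega> :: "'e \<Rightarrow> 'e multiform"
  assumes open_dom: "open W" and exterior_family: "\<And>y. y \<in> W \<Longrightarrow> exterior (\<omega> y)"
begin

lemma exterior_derivative:
  assumes x: "x \<in> W" and d: "\<And>vs. ((\<lambda>y. \<omega> y vs) has_derivative (\<lambda>u. \<omega>' u vs)) (at x)"
  shows "exterior (\<omega>' u)"
proof -
  have "linear (\<lambda>v. \<omega>' u (us @ v # vs))" for us vs
  proof (rule linearI)
    fix v w :: 'e and c :: real
    have "((\<lambda>y. \<omega> y (us @ v # vs) + \<omega> y (us @ w # vs)) has_derivative
        (\<lambda>u. \<omega>' u (us @ v # vs) + \<omega>' u (us @ w # vs))) (at x)"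
      by (intro has_derivative_add d)
    then have "((\<lambda>y. \<omega> y (us @ (v + w) # vs)) has_derivative
        (\<lambda>u. \<omega>' u (us @ v # vs) + \<omega>' u (us @ w # vs))) (at x)"
      by (rule has_derivative_transform_within_open[OF _ open_dom x])
         (simp add: linear_add[OF exterior_linear[OF exterior_family]])
    from has_derivative_unique[OF d this]
    show "\<omega>' u (us @ (v + w) # vs) = \<omega>' u (us @ v # vs) + \<omega>' u (us @ w # vs)"
      by (rule fun_cong)
    have "((\<lambda>y. c *\<^sub>R \<omega> y (us @ v # vs)) has_derivative (\<lambda>u. c *\<^sub>R \<omega>' u (us @ v # vs))) (at x)"
      by (intro has_derivative_scaleR_right d)
    then have "((\<lambda>y. \<omega> y (us @ (c *\<^sub>R v) # vs)) has_derivative (\<lambda>u. c *\<^sub>R \<omega>' u (us @ v # vs))) (at x)"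
      by (rule has_derivative_transform_within_open[OF _ open_dom x])
         (simp add: linear_scale[OF exterior_linear[OF exterior_family]])
    from has_derivative_unique[OF d this]
    show "\<omega>' u (us @ (c *\<^sub>R v) # vs) = c *\<^sub>R \<omega>' u (us @ v # vs)"
      by (rule fun_cong)
  qed
  moreover have "\<omega>' u (us @ v # vs @ v # ws) = 0" for us v vs ws
  proof -
    have "((\<lambda>y. \<omega> y (us @ v # vs @ v # ws)) has_derivative (\<lambda>u. 0)) (at x)"
      by (rule has_derivative_transform_within_open[OF has_derivative_const open_dom x])
         (simp add: exterior_alt[OF exterior_family])
    from has_derivative_unique[OF d this] show ?thesis
      by (rule fun_cong)
  qed
  ultimately show ?thesis
    by (simp add: exterior_def)
qed

lemma deriv_action_has_derivative:
  assumes x: "x \<in> W" and d: "\<And>vs. ((\<lambda>y. \<omega> y vs) has_derivative (\<lambda>u. \<omega>' u vs)) (at x)"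
    and J: "\<And>v. ((\<lambda>y. J y v) has_derivative (\<lambda>u. J' u v)) (at x)"
  shows "((\<lambda>y. deriv_action (J y) (\<omega> y) vs) has_derivative
     (\<lambda>u. deriv_action (J x) (\<omega>' u) vs + deriv_action (J' u) (\<omega> x) vs)) (at x)"
proof -
  have "((\<lambda>y. \<omega> y (vs[m := J y (vs ! m)])) has_derivative
      (\<lambda>u. \<omega>' u (vs[m := J x (vs ! m)]) + \<omega> x (vs[m := J' u (vs ! m)]))) (at x)"
    if m: "m < length vs" for m
  proof -
    have "((\<lambda>y. \<Sum>b\<in>Basis. (J y (vs ! m) \<bullet> b) * \<omega> y (vs[m := b])) has_derivative
      (\<lambda>u. \<Sum>b\<in>Basis. (J x (vs ! m) \<bullet> b) * \<omega>' u (vs[m := b]) + (J' u (vs ! m) \<bullet> b) * \<omega> x (vs[m := b]))) (at x)"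
      by (intro has_derivative_sum has_derivative_mult has_derivative_inner_left d J)
    then have "((\<lambda>y. \<Sum>b\<in>Basis. (J y (vs ! m) \<bullet> b) * \<omega> y (vs[m := b])) has_derivative
      (\<lambda>u. \<omega>' u (vs[m := J x (vs ! m)]) + \<omega> x (vs[m := J' u (vs ! m)]))) (at x)"
      unfolding sum.distrib exterior_expand_nth[OF exterior_derivative[OF x d] m, symmetric]
        exterior_expand_nth[OF exterior_family[OF x] m, symmetric] .
    then show ?thesis
      by (rule has_derivative_transform_within_open[OF _ open_dom x])
         (rule exterior_expand_nth[OF exterior_family m, symmetric])
  qed
  then have "((\<lambda>y. - (\<Sum>m<length vs. \<omega> y (vs[m := J y (vs ! m)]))) has_derivative
      (\<lambda>u. - (\<Sum>m<length vs. \<omega>' u (vs[m := J x (vs ! m)]) + \<omega> x (vs[m := J' u (vs ! m)])))) (at x)"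
    by (intro has_derivative_minus has_derivative_sum) simp
  then show ?thesis
    by (simp add: deriv_action_def sum.distrib)
qed

lemma smooth_deriv_action:
  assumes d: "\<And>vs. smooth_on (\<lambda>y. \<omega> y vs) W" and J: "\<And>v b. smooth_on (\<lambda>y. J y v \<bullet> b) W"
  shows "smooth_on (\<lambda>y. deriv_action (J y) (\<omega> y) vs) W"
proof (rule smooth_on_cong[OF open_dom])
  show "(\<Sum>m<length vs. (- 1) * (\<Sum>b\<in>Basis. (J y (vs ! m) \<bullet> b) * \<omega> y (vs[m := b]))) =
      deriv_action (J y) (\<omega> y) vs" if "y \<in> W" for y
    using exterior_expand_nth[OF exterior_family[OF that], symmetric]
    by (simp add: deriv_action_def sum_negf)
  show "smooth_on (\<lambda>y. \<Sum>m<length vs. (- 1) * (\<Sum>b\<in>Basis. (J y (vs ! m) \<bullet> b) * \<omega> y (vs[m := b]))) W"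
    by (intro smooth_on_sum smooth_on_cmult smooth_on_mult open_dom d J)
qed

end

section \<open>Frames depending on a point\<close>

locale frame_section = smooth_iso_family W s for W :: "(quat^'n::finite) set" and s
begin

lemma frame_at: "y \<in> W \<Longrightarrow> frame (s y)"
  by (simp add: frame_def linear_s bij_s)

lemma smooth_complex_structure: "smooth_on (\<lambda>y. complex_structure (s y) p v \<bullet> c) W"
proof (rule smooth_on_cong[OF open_W])
  fix y assume y: "y \<in> W"
  have l: "linear (\<lambda>v. s y (left_mult p v))"
    using linear_compose[OF linear_left_mult linear_s[OF y]] by (simp add: o_def)
  show "(\<Sum>b\<in>Basis. (inv (s y) v \<bullet> b) * (s y (left_mult p b) \<bullet> c)) = complex_structure (s y) p v \<bullet> c"
    unfolding complex_structure_def o_def linear_expand[OF l, of "inv (s y) v"]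
    by (simp add: inner_sum_left)
next
  show "smooth_on (\<lambda>y. \<Sum>b\<in>Basis. (inv (s y) v \<bullet> b) * (s y (left_mult p b) \<bullet> c)) W"
    by (intro smooth_on_sum smooth_on_mult smooth_inv_s smooth_on_inner_const smooth_s open_W)
qed

lemma smooth_casimir_poly:
  assumes "\<And>vs. smooth_on (\<lambda>y. \<omega> y vs) W" "\<And>y. y \<in> W \<Longrightarrow> exterior (\<omega> y)"
  shows "smooth_on (\<lambda>y. casimir_poly (s y) cs (\<omega> y) vs) W"
  using assms
proof (induction cs arbitrary: \<omega>)
  case (Cons c cs)
  have a: "smooth_on (\<lambda>y. deriv_action (complex_structure (s y) p) (\<beta> y) vs) W"
    if "\<And>vs. smooth_on (\<lambda>y. \<beta> y vs) W" "\<And>y. y \<in> W \<Longrightarrow> exterior (\<beta> y)" for p vs \<beta>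
    using that open_W
    by (intro form_family.smooth_deriv_action smooth_complex_structure) (auto simp: form_family_def)
  show ?case
    unfolding casimir_poly.simps
  proof (rule Cons.IH)
    show "smooth_on (\<lambda>y. frame_casimir (s y) (\<omega> y) vs - c * \<omega> y vs) W" for vs
      unfolding frame_casimir_def
      by (intro smooth_on_diff smooth_on_cmult smooth_on_add a open_W Cons.prems frame.exterior_act frame_at)
    show "exterior (\<lambda>vs. frame_casimir (s y) (\<omega> y) vs - c * \<omega> y vs)" if "y \<in> W" for y
      using that by (intro exterior_diff exterior_cmult Cons.prems frame.exterior_cas[OF frame_at])
  qed
qed simp

text \<open>The benefit of interpolation: the projection is a polynomial in an operator with smooth
  coefficients.\<close>

lemma smooth_frame_proj:
  assumes "\<And>vs. smooth_on (\<lambda>y. \<omega> y vs) W" "\<And>y. y \<in> W \<Longrightarrow> exterior (\<omega> y)"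
  shows "smooth_on (\<lambda>y. frame_proj (s y) k r (\<omega> y) vs) W"
  using smooth_on_cmult[OF open_W smooth_casimir_poly[OF assms], of "inverse (\<Prod>c\<leftarrow>other_eigenvalues k r. weight_eigenvalue r - c)"]
  by (cases "r < 0") (simp_all add: frame_proj_def smooth_on_const open_W divide_inverse mult.commute[of "inverse _"])

end

text \<open>The data of a torsion-free connection near a point: its Christoffel symbol \<open>G\<close> and its
  connection form \<open>\<theta>\<close> with respect to the local frame \<open>s\<close>.\<close>

locale connection_at = frame_section W s for W :: "(quat^'n::finite) set" and s +
  fixes x G \<theta>
  assumes x: "x \<in> W"
    and bilinear_G: "bilinear G" and symmetric_G: "G u v = G v u"
    and \<theta>: "\<theta> u \<in> sp1gl"
    and connection: "frechet_derivative (\<lambda>y. s y v) (at x) u + G u (s x v) = s x (\<theta> u v)"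
begin

text \<open>The value of the connection form, carried from H^n to the tangent space by the frame
  \<open>s x\<close>.\<close>

definition twist :: "quat^'n \<Rightarrow> quat^'n \<Rightarrow> quat^'n" where
  "twist u v = s x (\<theta> u (inv (s x) v))"

text \<open>By the equation \<open>connection\<close>, this is the logarithmic derivative of the
  frame in the direction \<open>u\<close>, that is, its derivative composed with the inverse
  frame.\<close>

definition defect :: "quat^'n \<Rightarrow> quat^'n \<Rightarrow> quat^'n" where
  "defect u v = twist u v - G u v"

lemma linear_G: "linear (G u)" "linear (\<lambda>u. G u v)"
  using bilinear_G by (simp_all add: bilinear_def)

lemma linear_theta: "linear (\<theta> u)"
  using \<theta>[of u] by (auto simp: sp1gl_def intro!: linear_compose_add linear_left_mult linear_right_mult)

lemma linear_twist: "linear (twist u)"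
  unfolding twist_def
  using linear_compose[OF linear_compose[OF linear_inv_s[OF x] linear_theta] linear_s[OF x]] by (simp add: o_def)

lemma linear_defect: "linear (defect u)"
  unfolding defect_def by (intro linear_compose_sub linear_twist linear_G)

text \<open>A conjugate s p s^-1 varies by its commutator with the logarithmic derivative of
  s.\<close>

lemma complex_structure_has_derivative:
  "((\<lambda>y. complex_structure (s y) p v) has_derivative
     (\<lambda>u. defect u (complex_structure (s x) p v) - complex_structure (s x) p (defect u v))) (at x)"
proof -
  let ?N = "inv (s x)"
  have ds: "ds x w u = s x (\<theta> u w) - G u (s x w)" for w u
    using connection[of w u] by (simp add: ds_def algebra_simps)
  have "((\<lambda>y. left_mult p (inv (s y) v)) has_derivative (\<lambda>u. left_mult p (- ?N (ds x (?N v) u)))) (at x)"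
    by (rule bounded_linear.has_derivative[OF linear_conv_bounded_linear[THEN iffD1, OF linear_left_mult] inv_s_has_derivative[OF x]])
  from s_apply_has_derivative[OF x this]
  show ?thesis
    by (simp add: complex_structure_def ds defect_def twist_def x linear_diff[OF linear_s[OF x]]
        linear_diff[OF linear_inv_s[OF x]] linear_diff[OF linear_left_mult] linear_neg[OF linear_left_mult]
        linear_neg[OF linear_s[OF x]] algebra_simps)
qed

sublocale frame "s x"
  by (rule frame_at[OF x])

text \<open>This is the derivative of the form as measured in the moving frame. With B the action of
  \<open>defect u\<close> and l the eigenvalue, differentiating C \<omega> = l \<omega> gives C
  \<omega>' + [B, C] \<omega> = l \<omega>', hence (C - l) (\<omega>' - B \<omega>) = 0.\<close>

lemma cas_covariant_derivative:
  assumes \<omega>: "\<And>y. y \<in> W \<Longrightarrow> \<omega> y \<in> eigenspace (s y) k r"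
    and d: "\<And>vs. ((\<lambda>y. \<omega> y vs) has_derivative (\<lambda>u. \<omega>' u vs)) (at x)"
    and r: "r \<ge> 0"
  shows "(\<lambda>vs. \<omega>' u vs - deriv_action (defect u) (\<omega> x) vs) \<in> eigenspace (s x) k r"
proof -
  let ?B = "\<lambda>u. deriv_action (defect u)"
  let ?l = "- of_int (r * (r + 2)) :: real"
  have ext: "exterior (\<omega> y)" if "y \<in> W" for y
    using frame.eigenspace_power[OF frame_at \<omega>] that exterior_power_exterior by blast
  interpret F: form_family W \<omega>
    using open_W ext by unfold_locales
  have ext': "exterior (\<omega>' u)" for u
    by (rule F.exterior_derivative[OF x d])
  have comm: "deriv_action (\<lambda>v. defect u (cstr p v) - cstr p (defect u v)) \<beta> vs =
      ?B u (act p \<beta>) vs - act p (?B u \<beta>) vs" if "exterior \<beta>" for p \<beta> u vs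
    using deriv_action_commutator[OF that, of "defect u" "cstr p" vs] by simp
  have 1: "((\<lambda>y. deriv_action (complex_structure (s y) p) (\<omega> y) vs) has_derivative
      (\<lambda>u. act p (\<omega>' u) vs + (?B u (act p (\<omega> x)) vs - act p (?B u (\<omega> x)) vs))) (at x)" for p vs
    using F.deriv_action_has_derivative[where J="\<lambda>y. complex_structure (s y) p" and J'="\<lambda>u v. defect u (cstr p v) - cstr p (defect u v)" and vs=vs,
      OF x d complex_structure_has_derivative]
    unfolding comm[OF ext[OF x]] .
  \<comment> \<open>Applying the product rule to the outer action gives a second commutator; the
    terms with B in the middle cancel.\<close>
  have 2: "((\<lambda>y. deriv_action (complex_structure (s y) p) (deriv_action (complex_structure (s y) p) (\<omega> y)) vs) has_derivative
      (\<lambda>u. act p (act p (\<omega>' u)) vs + (?B u (act p (act p (\<omega> x))) vs - act p (act p (?B u (\<omega> x))) vs))) (at x)" for p vs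
  proof -
    interpret F': form_family W "\<lambda>y. deriv_action (complex_structure (s y) p) (\<omega> y)"
      using open_W ext frame.exterior_act[OF frame_at] by (simp add: form_family_def)
    have "((\<lambda>y. deriv_action (complex_structure (s y) p) (deriv_action (complex_structure (s y) p) (\<omega> y)) vs) has_derivative
      (\<lambda>u. act p (\<lambda>vs. act p (\<omega>' u) vs + (?B u (act p (\<omega> x)) vs - act p (?B u (\<omega> x)) vs)) vs +
         (?B u (act p (act p (\<omega> x))) vs - act p (?B u (act p (\<omega> x))) vs))) (at x)"
      using F'.deriv_action_has_derivative[where J="\<lambda>y. complex_structure (s y) p" and J'="\<lambda>u v. defect u (cstr p v) - cstr p (defect u v)" and vs=vs,
      OF x 1 complex_structure_has_derivative]
      unfolding comm[OF exterior_act[OF ext[OF x]]] .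
    then show ?thesis
      by (simp add: act_linear)
  qed
  have 3: "((\<lambda>y. frame_casimir (s y) (\<omega> y) vs) has_derivative
      (\<lambda>u. cas (\<omega>' u) vs + (?B u (cas (\<omega> x)) vs - cas (?B u (\<omega> x)) vs))) (at x)" for vs
    using has_derivative_add[OF has_derivative_add[OF 2[of qi vs] 2[of qj vs]] 2[of qk vs]]
    by (simp add: frame_casimir_def[abs_def] deriv_action_add algebra_simps)
  have "((\<lambda>y. ?l * \<omega> y vs) has_derivative (\<lambda>u. ?l * \<omega>' u vs)) (at x)" for vs
    by (intro has_derivative_mult_right d)
  then have "((\<lambda>y. frame_casimir (s y) (\<omega> y) vs) has_derivative (\<lambda>u. ?l * \<omega>' u vs)) (at x)" for vs
    by (rule has_derivative_transform_within_open[OF _ open_W x])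
       (simp add: frame.eigenspaceD[OF frame_at \<omega>])
  from has_derivative_unique[OF 3 this]
  have c: "cas (\<omega>' u) vs + (?B u (cas (\<omega> x)) vs - cas (?B u (\<omega> x)) vs) = ?l * \<omega>' u vs" for vs
    by (rule fun_cong)
  have cx: "?B u (cas (\<omega> x)) = (\<lambda>vs. ?l * ?B u (\<omega> x) vs)"
    unfolding eigenspaceD[OF \<omega>[OF x]] by (rule deriv_action_cmult)
  have "\<omega>' u vs = 0" if "length vs \<noteq> k" for vs
  proof -
    have "((\<lambda>y. \<omega> y vs) has_derivative (\<lambda>u. 0)) (at x)"
      using exterior_power_degree[OF frame.eigenspace_power[OF frame_at \<omega>] that]
      by (intro has_derivative_transform_within_open[OF has_derivative_const open_W x]) auto
    from has_derivative_unique[OF d this] show ?thesis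
      by (rule fun_cong)
  qed
  with ext' have "\<omega>' u \<in> exterior_power k"
    by (simp add: exterior_power_def)
  then have "(\<lambda>vs. 1 * \<omega>' u vs + (- 1) * deriv_action (defect u) (\<omega> x) vs) \<in> exterior_power k"
    by (intro exterior_power_lin2 exterior_power_deriv_action linear_defect eigenspace_power[OF \<omega>[OF x]])
  moreover have "cas (lin2 1 (\<omega>' u) (- 1) (deriv_action (defect u) (\<omega> x))) vs =
     ?l * lin2 1 (\<omega>' u) (- 1) (deriv_action (defect u) (\<omega> x)) vs" for vs
    using c[of vs] unfolding cx cas_lin2 by (simp add: algebra_simps)
  ultimately show ?thesis
    using r by (simp add: eigenspace_def)
qed

text \<open>The left part of an element of \<open>sp1gl\<close> acts through sp(1), under which the
  Casimir operator is central; the right part commutes with all complex structures.\<close>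

lemma eigenspace_twist:
  assumes "\<alpha> \<in> eigenspace (s x) k r"
  shows "deriv_action (twist u) \<alpha> \<in> eigenspace (s x) k r"
proof -
  have e: "exterior \<alpha>"
    using assms by (intro exterior_power_exterior eigenspace_power)
  obtain p B where pB: "\<theta> u = (\<lambda>v. left_mult p v + right_mult B v)"
    using \<theta>[of u] by (auto simp: sp1gl_def)
  define R where "R v = s x (right_mult B (inv (s x) v))" for v
  have linR: "linear R"
    unfolding R_def
    using linear_compose[OF linear_compose[OF linear_inv_s[OF x] linear_right_mult] linear_s[OF x]] by (simp add: o_def)
  have tw: "twist u = (\<lambda>v. cstr p v + R v)"
    by (simp add: fun_eq_iff twist_def pB R_def complex_structure_def linear_add[OF linear_s[OF x]])
  have t: "deriv_action (twist u) \<alpha> = (\<lambda>vs. act p \<alpha> vs + deriv_action R \<alpha> vs)"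
    unfolding tw by (rule ext) (rule deriv_action_add_endo[OF e])
  have "R (cstr q v) = cstr q (R v)" for q v
    by (simp add: R_def complex_structure_def left_mult_right_mult)
  then have "cas (deriv_action R \<alpha>) vs = deriv_action R (cas \<alpha>) vs" for vs
    by (rule cas_commute_endo)
  moreover have "deriv_action R (cas \<alpha>) = (\<lambda>vs. - of_int (r * (r + 2)) * deriv_action R \<alpha> vs)"
    unfolding eigenspaceD[OF assms] by (rule deriv_action_cmult)
  ultimately have "deriv_action R \<alpha> \<in> eigenspace (s x) k r"
    using assms exterior_power_deriv_action[OF linR eigenspace_power[OF assms]]
    by (auto simp: eigenspace_def deriv_action_zero)
  from eigenspace_lin2[OF eigenspace_act[OF assms, of p] this, of 1 1] show ?thesis
    by (simp add: t)
qed

text \<open>The covariant derivative preserves the isotypic components, and the exterior derivative is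
  its alternation because the connection is torsion-free.\<close>

lemma exterior_derivative_components:
  assumes \<omega>: "\<And>y. y \<in> W \<Longrightarrow> \<omega> y \<in> eigenspace (s y) k r"
    and d: "\<And>vs. ((\<lambda>y. \<omega> y vs) has_derivative (\<lambda>u. \<omega>' u vs)) (at x)"
    and r: "r \<ge> 0"
  shows "\<exists>a\<in>eigenspace (s x) (k + 1) (r + 1). \<exists>b\<in>eigenspace (s x) (k + 1) (r - 1).
     alternation \<omega>' = (\<lambda>vs. a vs + b vs)"
proof -
  have e: "exterior (\<omega> x)"
    using \<omega>[OF x] by (intro exterior_power_exterior eigenspace_power)
  \<comment> \<open>The covariant derivative of \<omega> along u at the point. As \<open>G u\<close>
    is \<open>twist u\<close> minus \<open>defect u\<close>, it splits into the derivative in the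
    moving frame and the action of the connection form.\<close>
  define t where "t u vs = \<omega>' u vs + deriv_action (G u) (\<omega> x) vs" for u vs
  have t: "t u = lin2 1 (\<lambda>vs. \<omega>' u vs - deriv_action (defect u) (\<omega> x) vs) 1 (deriv_action (twist u) (\<omega> x))" for u
    unfolding t_def defect_def[abs_def] deriv_action_diff_endo[OF e] by simp
  have "t u \<in> eigenspace (s x) k r" for u
    unfolding t by (rule eigenspace_lin2[OF cas_covariant_derivative[OF \<omega> d r] eigenspace_twist[OF \<omega>[OF x]]])
  moreover have "linear (\<lambda>u. t u vs)" for vs
    unfolding t_def
    by (intro linear_compose_add has_derivative_linear[OF d] linear_deriv_action_endo e linear_G)
  ultimately have "\<exists>a\<in>eigenspace (s x) (k + 1) (r + 1). \<exists>b\<in>eigenspace (s x) (k + 1) (r - 1).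
     alternation t = (\<lambda>vs. a vs + b vs)"
    using r by (rule alternation_eigenspace_decomp)
  moreover have "alternation t = alternation \<omega>'"
    unfolding t_def alternation_add using alternation_symmetric_endo[OF e symmetric_G] by simp
  ultimately show ?thesis by simp
qed

end

section \<open>The connections of quaternionic manifolds\<close>

text \<open>For n = 1, the Lie algebra of Sp(1)GL(1,H) consists of the conformal endomorphisms of H.\<close>

lemma conformal_sp1gl:
  fixes \<theta> :: "quat^'n::finite \<Rightarrow> quat^'n"
  assumes n: "CARD('n) = 1" and lin: "linear \<theta>"
    and conf: "\<And>a b. \<theta> a \<bullet> b + a \<bullet> \<theta> b = \<mu> * (a \<bullet> b)"
  shows "\<theta> \<in> sp1gl"
proof -
  obtain m0 :: 'n where U: "UNIV = {m0}"
    using n by (rule card_1_singletonE)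
  then have m0: "m = m0" for m :: 'n
    by auto
  define T where "T q = \<theta> (vec q) $ m0" for q :: quat
  have vec_inner: "(vec q :: quat^'n) \<bullet> v = q \<bullet> v $ m0" "v \<bullet> vec q = v $ m0 \<bullet> q" for q v
    by (simp_all add: inner_vec_def[of _ v] inner_vec_def[of v] U)
  have v: "v = vec (v $ m0)" for v :: "quat^'n"
    by (simp add: vec_eq_iff) (metis m0)
  have linT: "linear T"
  proof (rule linearI)
    have "(vec (p + q) :: quat^'n) = vec p + vec q" "(vec (c *\<^sub>R p) :: quat^'n) = c *\<^sub>R vec p" for p q :: quat and c
      by (simp_all add: vec_eq_iff)
    then show "T (p + q) = T p + T q" "T (c *\<^sub>R p) = c *\<^sub>R T p" for p q c
      by (simp_all add: T_def linear_add[OF lin] linear_scale[OF lin])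
  qed
  have conf': "T p \<bullet> q + p \<bullet> T q = \<mu> * (p \<bullet> q)" for p q
    using conf[of "vec p" "vec q"] by (simp add: vec_inner T_def)
  define t where "t i j = T (axis j 1) $ i" for i j
  have t: "t i j + t j i = (if i = j then \<mu> else 0)" for i j
    using conf'[of "axis j 1" "axis i 1"] by (simp add: t_def inner_axis inner_axis') (simp add: axis_def)
  \<comment> \<open>The solution of T q = p q + q b with p imaginary: the image of 1 gives p + b,
    while the entries \<open>t 4 3\<close>, \<open>t 4 2\<close>, \<open>t 3 2\<close> give, up to
    sign, the imaginary components of p - b. The real part of b is \<mu> / 2.\<close>
  define p b :: quat where
    "p = vector [0, (t 2 1 + t 4 3) / 2, (t 3 1 - t 4 2) / 2, (t 4 1 + t 3 2) / 2]" and
    "b = vector [t 1 1, (t 2 1 - t 4 3) / 2, (t 3 1 + t 4 2) / 2, (t 4 1 - t 3 2) / 2]"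
  have pb [simp]: "p $ 1 = 0" "p $ 2 = (t 2 1 + t 4 3) / 2" "p $ 3 = (t 3 1 - t 4 2) / 2" "p $ 4 = (t 4 1 + t 3 2) / 2"
    "b $ 1 = t 1 1" "b $ 2 = (t 2 1 - t 4 3) / 2" "b $ 3 = (t 3 1 + t 4 2) / 2" "b $ 4 = (t 4 1 - t 3 2) / 2"
    by (simp_all add: p_def b_def vector_def)
  have T: "T q = qmul p q + qmul q b" for q
  proof -
    have "T q $ i = q$1 * t i 1 + q$2 * t i 2 + q$3 * t i 3 + q$4 * t i 4" for i
    proof -
      have "q = q$1 *\<^sub>R axis 1 1 + q$2 *\<^sub>R axis 2 1 + q$3 *\<^sub>R axis 3 1 + q$4 *\<^sub>R axis 4 1"
        by (simp add: quat_eq_iff axis_def)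
      then have "T q = T (q$1 *\<^sub>R axis 1 1 + q$2 *\<^sub>R axis 2 1 + q$3 *\<^sub>R axis 3 1 + q$4 *\<^sub>R axis 4 1)"
        by (rule arg_cong)
      then show ?thesis
        by (simp add: linear_add[OF linT] linear_scale[OF linT] t_def)
    qed
    moreover have "t 2 2 = t 1 1" "t 3 3 = t 1 1" "t 4 4 = t 1 1"
      using t[of 1 1] t[of 2 2] t[of 3 3] t[of 4 4] by simp_all
    moreover have "t 1 2 = - t 2 1" "t 1 3 = - t 3 1" "t 1 4 = - t 4 1" "t 2 3 = - t 3 2" "t 2 4 = - t 4 2" "t 3 4 = - t 4 3"
      using t[of 1 2] t[of 1 3] t[of 1 4] t[of 2 3] t[of 2 4] t[of 3 4] by simp_all
    ultimately show ?thesis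
      by (simp add: quat_eq_iff field_simps)
  qed
  have "\<theta> v = left_mult p v + right_mult (\<chi> l m. b) v" for v
  proof -
    have "\<theta> v $ m = (left_mult p v + right_mult (\<chi> l m. b) v) $ m" for m
      unfolding m0[of m] using T[of "v $ m0"] by (simp add: T_def left_mult_def right_mult_def U flip: v)
    then show ?thesis
      unfolding vec_eq_iff[of "\<theta> v"] by blast
  qed
  then have "\<theta> = (\<lambda>v. left_mult p v + right_mult (\<chi> l m. b) v)"
    by (rule ext)
  then show ?thesis
    unfolding sp1gl_def using pb(1) by blast
qed

text \<open>The frames pull \<open>g\<close> back to a multiple of the standard inner product.
  Differentiating this relation with a metric connection shows that the connection form is an
  infinitesimal conformal endomorphism of H.\<close>

lemma (in frame_section) levi_civita_sp1gl:
  assumes n: "CARD('n) = 1" and x: "x \<in> W"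
    and bil: "\<And>y. y \<in> W \<Longrightarrow> bilinear (g y)"
    and conf: "\<And>y. y \<in> W \<Longrightarrow> \<exists>l>0. \<forall>u v. g y (s y u) (s y v) = l * (u \<bullet> v)"
    and smooth: "\<And>u v. smooth_on (\<lambda>y. g y u v) W"
    and G: "bilinear G"
    and lc: "\<And>u v w. frechet_derivative (\<lambda>y. g y v w) (at x) u = g x (G u v) w + g x v (G u w)"
  shows "(\<lambda>v. inv (s x) (frechet_derivative (\<lambda>y. s y v) (at x) u + G u (s x v))) \<in> sp1gl"
proof -
  let ?N = "\<lambda>v. ds x v u + G u (s x v)"
  let ?\<theta> = "\<lambda>v. inv (s x) (?N v)"
  \<comment> \<open>The hypothesis \<open>conf\<close> provides the conformal factor pointwise only;
    evaluating the metric on the image of a fixed unit vector expresses it as a differentiable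
    function.\<close>
  obtain b0 :: "quat^'n" where "b0 \<in> Basis"
    using nonempty_Basis by blast
  then have b0: "b0 \<bullet> b0 = 1"
    by simp
  have lin_g: "linear (g y v)" "linear (\<lambda>v. g y v w)" if "y \<in> W" for y v w
    using bil[OF that] by (simp_all add: bilinear_def)
  have "linear (\<lambda>v. \<Sum>a\<in>Basis. (v \<bullet> a) *\<^sub>R ds x a u)"
    by (intro linear_compose_sum ballI linearI) (simp_all add: inner_add_left scaleR_add_left)
  then have "linear (\<lambda>v. ds x v u)"
    by (subst ds_expand[OF x])
  moreover have "linear (\<lambda>v. G u (s x v))"
    using linear_compose[OF linear_s[OF x], of "G u"] G by (simp add: bilinear_def o_def)
  ultimately have lin: "linear ?\<theta>"
    using linear_compose[OF linear_compose_add linear_inv_s[OF x]] by (auto simp: o_def)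
  have dg: "((\<lambda>y. g y v w) has_derivative (\<lambda>u. g x (G u v) w + g x v (G u w))) (at x)" for v w
    using smooth_on_has_derivative[OF smooth x, of v w] unfolding lc[abs_def, symmetric] by simp
  have dg2: "((\<lambda>y. g y v (s y b)) has_derivative
      (\<lambda>u. (g x (G u v) (s x b) + g x v (G u (s x b))) + g x v (ds x b u))) (at x)" for v b
    using linear_family_derivative(2)[of W x "\<lambda>y w. g y v w", OF open_W x lin_g(1) dg s_has_derivative[OF x]] .
  have dg3: "((\<lambda>y. g y (s y a) (s y b)) has_derivative
      (\<lambda>u. (g x (G u (s x a)) (s x b) + g x (s x a) (G u (s x b)) + g x (s x a) (ds x b u)) + g x (ds x a u) (s x b))) (at x)" for a b
    using linear_family_derivative(2)[of W x "\<lambda>y v. g y v (s y b)", OF open_W x lin_g(2) dg2 s_has_derivative[OF x]] .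
  have l: "g y (s y a) (s y b) = g y (s y b0) (s y b0) * (a \<bullet> b)" if "y \<in> W" for y a b
    using conf[OF that] b0 by auto
  define L where "L u = g x (G u (s x b0)) (s x b0) + g x (s x b0) (G u (s x b0)) + g x (s x b0) (ds x b0 u) + g x (ds x b0 u) (s x b0)" for u
  have "((\<lambda>y. g y (s y b0) (s y b0) * (a \<bullet> b)) has_derivative (\<lambda>u. L u * (a \<bullet> b))) (at x)" for a b
    unfolding L_def by (intro has_derivative_mult_left dg3)
  then have "((\<lambda>y. g y (s y a) (s y b)) has_derivative (\<lambda>u. L u * (a \<bullet> b))) (at x)" for a b
    by (rule has_derivative_transform_within_open[OF _ open_W x]) (rule l[symmetric])
  from has_derivative_unique[OF dg3 this]
  have e: "g x (G u (s x a)) (s x b) + g x (s x a) (G u (s x b)) + g x (s x a) (ds x b u) + g x (ds x a u) (s x b) = L u * (a \<bullet> b)" for a b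
    by (rule fun_cong)
  have "g x (?N a) (s x b) + g x (s x a) (?N b) = L u * (a \<bullet> b)" for a b
    using e[of a b] by (simp add: linear_add[OF lin_g(1)[OF x]] linear_add[OF lin_g(2)[OF x]])
  then have e2: "g x (s x (?\<theta> a)) (s x b) + g x (s x a) (s x (?\<theta> b)) = L u * (a \<bullet> b)" for a b
    by (simp add: x)
  obtain l where l: "l > 0" "\<And>u v. g x (s x u) (s x v) = l * (u \<bullet> v)"
    using conf[OF x] by blast
  have "?\<theta> a \<bullet> b + a \<bullet> ?\<theta> b = (L u / l) * (a \<bullet> b)" for a b
    using e2[of a b] l(1) unfolding l(2) by (simp add: field_simps)
  then have "?\<theta> \<in> sp1gl"
    by (rule conformal_sp1gl[OF n lin])
  then show ?thesis
    by (simp add: ds_def)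
qed

text \<open>Merges the two cases of the definition into one kind of data, a smooth local section
  together with a symmetric \<open>G\<close> and a connection form at the single point
  \<open>x\<close>.\<close>

lemma quaternionic_manifold_connection:
  fixes A :: "('a, 'n::finite) chart set"
  assumes M: "quaternionic_manifold X A Q" and c: "c \<in> A" and x: "x \<in> chart_image c"
  shows "\<exists>W s G \<theta>. connection_at W s x G \<theta> \<and> W \<subseteq> chart_image c \<and> (\<forall>y\<in>W. s y \<in> Q c y)"
proof -
  have S: "Sp1GL_structure A Q"
    using M by (simp add: quaternionic_manifold_def)
  have "\<exists>W s. open W \<and> x \<in> W \<and> W \<subseteq> chart_image c \<and> smooth_section Q c W s"
    using S c x by (simp add: Sp1GL_structure_def)
  then obtain W s where W: "open W" "x \<in> W" "W \<subseteq> chart_image c" and s: "smooth_section Q c W s"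
    by blast
  have sQ: "s y \<in> Q c y" if "y \<in> W" for y
    using s that by (simp add: smooth_section_def)
  have iso: "linear (s y)" "bij (s y)" if "y \<in> W" for y
    using S c sQ[OF that] that W(3) by (auto simp: Sp1GL_structure_def)
  interpret frame_section W s
    using W(1) iso s by unfold_locales (auto simp: smooth_section_def linear_iff)
  have "\<exists>G. bilinear G \<and> (\<forall>u v. G u v = G v u) \<and>
    (\<forall>u. \<exists>\<theta>\<in>sp1gl. \<forall>v. frechet_derivative (\<lambda>y. s y v) (at x) u + G u (s x v) = s x (\<theta> v))"
  proof (cases "CARD('n) = 1")
    case False
    then obtain \<Gamma> where \<Gamma>: "structure_connection A Q \<Gamma>" "torsion_free A \<Gamma>"
      using M by (auto simp: quaternionic_manifold_def)
    have "bilinear (\<Gamma> c x)"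
      using \<Gamma>(1) c x by (simp add: structure_connection_def affine_connection_def)
    moreover have "\<Gamma> c x u v = \<Gamma> c x v u" for u v
      using \<Gamma>(2) c x by (simp add: torsion_free_def)
    moreover have "\<exists>\<theta>\<in>sp1gl. \<forall>v. frechet_derivative (\<lambda>y. s y v) (at x) u + \<Gamma> c x u (s x v) = s x (\<theta> v)" for u
      using \<Gamma>(1) c W s by (simp add: structure_connection_def)
    ultimately show ?thesis by blast
  next
    case True
    then obtain g \<nu> where g: "riemannian_metric A g" and "self_dual_metric A g \<nu>"
      and Q: "\<And>y. y \<in> chart_image c \<Longrightarrow> Q c y = induced_structure g \<nu> c y"
      using M c by (auto simp: quaternionic_manifold_def self_dual_conformal4_def)
    then obtain \<Gamma> where \<Gamma>: "levi_civita A g \<Gamma>"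
      by (auto simp: self_dual_metric_def)
    have bil: "bilinear (\<Gamma> c x)"
      using \<Gamma> c x by (simp add: levi_civita_def affine_connection_def)
    moreover have "\<Gamma> c x u v = \<Gamma> c x v u" for u v
      using \<Gamma> c x by (simp add: levi_civita_def torsion_free_def)
    moreover have "\<exists>\<theta>\<in>sp1gl. \<forall>v. frechet_derivative (\<lambda>y. s y v) (at x) u + \<Gamma> c x u (s x v) = s x (\<theta> v)" for u
    proof (rule bexI)
      show "(\<lambda>v. inv (s x) (frechet_derivative (\<lambda>y. s y v) (at x) u + \<Gamma> c x u (s x v))) \<in> sp1gl"
      proof (rule levi_civita_sp1gl[where g = "g c"])
        show "\<exists>l>0. \<forall>u v. g c y (s y u) (s y v) = l * (u \<bullet> v)" if "y \<in> W" for y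
          using sQ[OF that] Q[of y] W(3) that by (auto simp: induced_structure_def)
        show "smooth_on (\<lambda>y. g c y u v) W" for u v
          using g c by (intro smooth_on_subset[OF _ W(3)]) (simp add: riemannian_metric_def)
        show "frechet_derivative (\<lambda>y. g c y v w) (at x) u = g c x (\<Gamma> c x u v) w + g c x v (\<Gamma> c x u w)" for u v w
          using \<Gamma> c x by (simp add: levi_civita_def)
        show "bilinear (g c y)" if "y \<in> W" for y
          using g c W(3) that by (auto simp: riemannian_metric_def)
      qed (use True W(2) bil in auto)
    qed (simp add: W(2))
    ultimately show ?thesis by blast
  qed
  then obtain G where G: "bilinear G" "\<And>u v. G u v = G v u"
    and "\<forall>u. \<exists>\<theta>. \<theta> \<in> sp1gl \<and> (\<forall>v. frechet_derivative (\<lambda>y. s y v) (at x) u + G u (s x v) = s x (\<theta> v))"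
    by blast
  then obtain \<theta> where \<theta>: "\<And>u. \<theta> u \<in> sp1gl"
    "\<And>u v. frechet_derivative (\<lambda>y. s y v) (at x) u + G u (s x v) = s x (\<theta> u v)"
    by metis
  have "connection_at W s x G \<theta>"
    by (intro connection_at.intro connection_at_axioms.intro frame_section_axioms W(2) G \<theta>)
  then show ?thesis
    using W(3) sQ by blast
qed

section \<open>The operators on forms in a chart\<close>

text \<open>The exterior derivative, the projections and both operators act on the representation in
  each chart separately, so the argument runs in one fixed chart.\<close>

locale quaternionic_chart =
  fixes Q :: "('a, 'n::finite) frame_bundle" and c :: "('a, 'n) chart"
  assumes open_image: "open (chart_image c)"
    and frames: "x \<in> chart_image c \<Longrightarrow> f \<in> Q c x \<Longrightarrow> linear f \<and> bij f \<and> Q c x = {f \<circ> h | h. h \<in> Sp1GL}"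
    and connection: "x \<in> chart_image c \<Longrightarrow>
      \<exists>W s G \<theta>. connection_at W s x G \<theta> \<and> W \<subseteq> chart_image c \<and> (\<forall>y\<in>W. s y \<in> Q c y)"
begin

abbreviation "U \<equiv> chart_image c"

definition smooth_family :: "('a, 'n) form_field \<Rightarrow> bool" where
  "smooth_family \<omega> \<longleftrightarrow> (\<forall>x\<in>U. exterior (\<omega> c x)) \<and> (\<forall>vs. smooth_on (\<lambda>x. \<omega> c x vs) U)"

definition has_type :: "nat \<Rightarrow> int \<Rightarrow> ('a, 'n) form_field \<Rightarrow> bool" where
  "has_type k r \<omega> \<longleftrightarrow> smooth_family \<omega> \<and> (\<forall>x\<in>U. \<omega> c x \<in> E_fibre Q c x k r)"

lemma smooth_familyD: "smooth_family \<omega> \<Longrightarrow> x \<in> U \<Longrightarrow> exterior (\<omega> c x)"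
  "smooth_family \<omega> \<Longrightarrow> smooth_on (\<lambda>x. \<omega> c x vs) U"
  by (simp_all add: smooth_family_def)

lemma obtain_section:
  assumes "x \<in> U"
  obtains W s G \<theta> where "connection_at W s x G \<theta>" "W \<subseteq> U" "\<And>y. y \<in> W \<Longrightarrow> s y \<in> Q c y"
  using connection[OF assms] by blast

lemma ex_frame: "x \<in> U \<Longrightarrow> \<exists>f. f \<in> Q c x"
  using obtain_section connection_at.x by metis

lemma frame_in: "x \<in> U \<Longrightarrow> f \<in> Q c x \<Longrightarrow> frame f"
  using frames by (simp add: frame_def)

text \<open>Two frames at a point differ by an element of \<open>Sp1GL\<close>, so the chosen frame
  may be replaced by any convenient one.\<close>

lemma casimir_eq:
  assumes x: "x \<in> U" and f: "f \<in> Q c x" and \<alpha>: "exterior \<alpha>"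
  shows "casimir Q c x \<alpha> vs = frame_casimir f \<alpha> vs"
proof -
  have s: "(SOME f. f \<in> Q c x) \<in> Q c x"
    using f by (auto simp: some_in_eq)
  then obtain h where h: "(SOME f. f \<in> Q c x) = f \<circ> h" "h \<in> Sp1GL"
    using frames[OF x f] by auto
  have "casimir Q c x \<alpha> vs = frame_casimir (f \<circ> h) \<alpha> vs"
    by (simp add: casimir_def frame_casimir_def Let_def h(1))
  also have "\<dots> = frame_casimir f \<alpha> vs"
    using frames[OF x s] h \<alpha> by (intro frame.casimir_change_frame frame_in[OF x f]) auto
  finally show ?thesis .
qed

lemma E_fibre_eq:
  assumes "x \<in> U" "f \<in> Q c x"
  shows "E_fibre Q c x k r = eigenspace f k r"
proof -
  have "casimir Q c x \<alpha> vs = frame_casimir f \<alpha> vs" if "\<alpha> \<in> exterior_power k" for \<alpha> vs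
    using casimir_eq[OF assms exterior_power_exterior[OF that]] .
  then show ?thesis
    by (auto simp: E_fibre_def eigenspace_def)
qed

text \<open>Resolves the definite description: the witness comes from decomposability, its
  uniqueness from interpolation.\<close>

lemma proj_fibre_eq:
  assumes x: "x \<in> U" and f: "f \<in> Q c x" and \<alpha>: "exterior \<alpha>" and r: "r \<le> int k"
  shows "proj_fibre Q c x k r \<alpha> = frame_proj f k r (degree_part k \<alpha>)"
proof -
  interpret frame f
    by (rule frame_in[OF x f])
  let ?\<beta> = "degree_part k \<alpha>"
  note d = frame_proj_of_decomposable[OF exterior_power_decomposable[OF exterior_power_degree_part[OF \<alpha>, of k]]]
  \<comment> \<open>Cut off above \<open>k\<close>: the sum does not involve those indices, but
    membership in the eigenspace is demanded for all of them.\<close>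
  let ?h = "\<lambda>s. if s \<le> int k then frame_proj f k s ?\<beta> else (\<lambda>vs. 0)"
  have "?h s \<in> eigenspace f k s" for s
    using d(1) by (simp add: eigenspace_zero)
  moreover have "?\<beta> vs = (\<Sum>s = 0..int k. ?h s vs)" for vs
    by (subst fun_cong[OF d(2)[OF order_refl], of vs]) (intro sum.cong refl, simp)
  moreover have "h r = frame_proj f k r ?\<beta>"
    if "\<And>s. h s \<in> eigenspace f k s" "\<And>vs. ?\<beta> vs = (\<Sum>s = 0..int k. h s vs)" for h
    using frame_proj_unique[OF that(1) ext[OF that(2)] r] by simp
  ultimately show ?thesis
    unfolding proj_fibre_def E_fibre_eq[OF x f] using r
    by (intro the_equality exI[of _ ?h]) auto
qed

lemma proj_eq:
  assumes "x \<in> U" "f \<in> Q c x" "exterior (\<omega> c x)" "r \<le> int k"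
  shows "proj Q k r \<omega> c x = frame_proj f k r (degree_part k (\<omega> c x))"
  unfolding proj_def by (rule proj_fibre_eq[OF assms])

lemma proj_in:
  assumes "x \<in> U" "exterior (\<omega> c x)" "r \<le> int k"
  shows "proj Q k r \<omega> c x \<in> E_fibre Q c x k r"
    and "degree_part k (\<omega> c x) vs = (\<Sum>s = 0..int k. proj Q k s \<omega> c x vs)"
proof -
  obtain f where f: "f \<in> Q c x"
    using ex_frame[OF assms(1)] by blast
  interpret frame f
    by (rule frame_in[OF assms(1) f])
  note d = frame_proj_of_decomposable[OF exterior_power_decomposable[OF exterior_power_degree_part[OF assms(2), of k]]]
  show "proj Q k r \<omega> c x \<in> E_fibre Q c x k r"
    unfolding proj_eq[where \<omega>=\<omega>, OF assms(1) f assms(2,3)] E_fibre_eq[OF assms(1) f] by (rule d(1)[OF assms(3)])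
  show "degree_part k (\<omega> c x) vs = (\<Sum>s = 0..int k. proj Q k s \<omega> c x vs)"
    using fun_cong[OF d(2)[OF order_refl], of vs] proj_eq[where \<omega>=\<omega>, OF assms(1) f assms(2)] by simp
qed

lemma degree_part_lin2: "degree_part k (lin2 a \<alpha> b \<beta>) = lin2 a (degree_part k \<alpha>) b (degree_part k \<beta>)"
  by (simp add: fun_eq_iff degree_part_def)

lemma proj_lin2:
  assumes "x \<in> U" "exterior (\<omega> c x)" "exterior (\<eta> c x)" "r \<le> int k"
  shows "proj Q k r (\<lambda>c x. lin2 a (\<omega> c x) b (\<eta> c x)) c x = lin2 a (proj Q k r \<omega> c x) b (proj Q k r \<eta> c x)"
proof -
  obtain f where f: "f \<in> Q c x"
    using ex_frame[OF assms(1)] by blast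
  show ?thesis
    using assms frame.frame_proj_lin2[OF frame_in[OF assms(1) f]]
    by (simp add: proj_eq[OF assms(1) f] exterior_lin2 degree_part_lin2)
qed

lemma proj_zero:
  assumes "x \<in> U" "\<omega> c x = (\<lambda>vs. 0)" "r \<le> int k"
  shows "proj Q k r \<omega> c x = (\<lambda>vs. 0)"
  using proj_lin2[of x \<omega> \<omega> r k 0 0] assms exterior_zero by (simp add: proj_def)

lemma proj_add:
  assumes "x \<in> U" "exterior (\<omega> c x)" "exterior (\<eta> c x)" "r \<le> int k"
  shows "proj Q k r (\<lambda>c x vs. \<omega> c x vs + \<eta> c x vs) c x vs = proj Q k r \<omega> c x vs + proj Q k r \<eta> c x vs"
  using fun_cong[OF proj_lin2[where \<omega>=\<omega> and \<eta>=\<eta>, OF assms, of 1 1], of vs] by simp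

lemma proj_sum:
  assumes "x \<in> U" "\<And>i. i \<in> I \<Longrightarrow> exterior (\<omega> i c x)" "r \<le> int k"
  shows "proj Q k r (\<lambda>c x vs. \<Sum>i\<in>I. \<omega> i c x vs) c x vs = (\<Sum>i\<in>I. proj Q k r (\<omega> i) c x vs)"
  using assms(2)
proof (induction I rule: infinite_finite_induct)
  case (insert i I)
  then show ?case
    using proj_add[where \<omega>="\<omega> i" and \<eta>="\<lambda>c x vs. \<Sum>i\<in>I. \<omega> i c x vs", OF assms(1) _ _ assms(3)] by (simp add: exterior_sum)
qed (simp_all add: proj_zero[OF assms(1) _ assms(3)])

lemma proj_cong: "\<omega> c x = \<eta> c x \<Longrightarrow> proj Q k r \<omega> c x = proj Q k r \<eta> c x"
  by (simp add: proj_def)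

lemma proj_E_fibre:
  assumes x: "x \<in> U" and \<omega>: "\<omega> c x \<in> E_fibre Q c x l s" and "s \<le> int l" and r: "r \<le> int k"
  shows "proj Q k r \<omega> c x = (if k = l \<and> r = s then \<omega> c x else (\<lambda>vs. 0))"
proof -
  obtain f where f: "f \<in> Q c x"
    using ex_frame[OF x] by blast
  interpret frame f
    by (rule frame_in[OF x f])
  have E: "\<omega> c x \<in> eigenspace f l s"
    using \<omega> by (simp add: E_fibre_eq[OF x f])
  have p: "\<omega> c x \<in> exterior_power l"
    by (rule eigenspace_power[OF E])
  note q = proj_eq[where \<omega>=\<omega>, OF x f exterior_power_exterior[OF p] r]
  show ?thesis
  proof (cases "k = l")
    case True
    have dp: "degree_part k (\<omega> c x) = \<omega> c x"
      using exterior_power_degree[OF p] True by (auto simp: degree_part_def fun_eq_iff)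
    let ?h = "\<lambda>t. if t = s then \<omega> c x else (\<lambda>vs. 0)"
    have "\<omega> c x = (\<lambda>vs. \<Sum>t = 0..int k. ?h t vs)"
    proof (cases "s < 0")
      case True
      then have "\<omega> c x = (\<lambda>vs. 0)"
        using E by (simp add: eigenspace_negative)
      then show ?thesis by (simp cong: if_cong)
    next
      case False
      then show ?thesis
        using \<open>s \<le> int l\<close> \<open>k = l\<close> by (simp add: if_distrib[where f="\<lambda>\<beta>. \<beta> _"] cong: if_cong)
    qed
    moreover have "?h t \<in> eigenspace f k t" for t
      using E True by (simp add: eigenspace_zero)
    ultimately have "frame_proj f k r (\<omega> c x) = ?h r"
      using r by (intro frame_proj_unique)
    then show ?thesis
      unfolding q dp using True by simp
  next
    case False
    then have "degree_part k (\<omega> c x) = (\<lambda>vs. 0)"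
      using exterior_power_degree[OF p] by (auto simp: degree_part_def fun_eq_iff)
    moreover have "frame_proj f k r (\<lambda>vs. 0) = (\<lambda>vs. 0)"
      by (simp add: frame_proj_def cpoly_zero)
    ultimately show ?thesis
      unfolding q using False by simp
  qed
qed

text \<open>The frame inside \<open>casimir\<close> may jump from point to point; near each point it
  is traded for a smooth section of the structure, where the interpolation formula is
  smooth.\<close>

lemma smooth_family_proj:
  assumes \<omega>: "smooth_family \<omega>" and r: "r \<le> int k"
  shows "smooth_family (proj Q k r \<omega>)"
  unfolding smooth_family_def
proof (intro conjI ballI allI)
  fix x assume x: "x \<in> U"
  show "exterior (proj Q k r \<omega> c x)"
    using proj_in(1)[where \<omega>=\<omega>, OF x smooth_familyD(1)[OF \<omega> x] r] by (simp add: E_fibre_def exterior_power_def)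
next
  fix vs
  show "smooth_on (\<lambda>x. proj Q k r \<omega> c x vs) U"
  proof (rule smooth_on_local)
    fix x assume "x \<in> U"
    then obtain W s G \<theta> where W: "connection_at W s x G \<theta>" "W \<subseteq> U" "\<And>y. y \<in> W \<Longrightarrow> s y \<in> Q c y"
      using obtain_section by metis
    interpret connection_at W s x G \<theta>
      by (rule W(1))
    have "smooth_on (\<lambda>y. frame_proj (s y) k r (degree_part k (\<omega> c y)) vs) W"
    proof (rule smooth_frame_proj)
      show "smooth_on (\<lambda>y. degree_part k (\<omega> c y) vs) W" for vs
        using smooth_on_subset[OF smooth_familyD(2)[OF \<omega>] W(2)]
        by (cases "length vs = k") (simp_all add: degree_part_def smooth_on_const open_W)
      show "exterior (degree_part k (\<omega> c y))" if "y \<in> W" for y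
        using that W(2) by (intro exterior_degree_part smooth_familyD[OF \<omega>]) auto
    qed
    then have "smooth_on (\<lambda>x. proj Q k r \<omega> c x vs) W"
    proof (rule smooth_on_cong[OF open_W, rotated])
      show "frame_proj (s y) k r (degree_part k (\<omega> c y)) vs = proj Q k r \<omega> c y vs" if "y \<in> W" for y
        using proj_eq[where \<omega>=\<omega>, OF _ W(3)[OF that] smooth_familyD(1)[OF \<omega>] r] that W(2) by auto
    qed
    then show "\<exists>W. open W \<and> x \<in> W \<and> smooth_on (\<lambda>x. proj Q k r \<omega> c x vs) W"
      using open_W connection_at.x[OF W(1)] by blast
  qed
qed

lemma has_type_proj: "smooth_family \<omega> \<Longrightarrow> r \<le> int k \<Longrightarrow> has_type k r (proj Q k r \<omega>)"
  by (simp add: has_type_def smooth_family_proj proj_in(1) smooth_familyD(1))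

subsection \<open>The exterior derivative\<close>

definition total_derivative :: "('a, 'n) form_field \<Rightarrow> quat^'n \<Rightarrow> quat^'n \<Rightarrow> (quat^'n) multiform" where
  "total_derivative \<omega> x u vs = frechet_derivative (\<lambda>y. \<omega> c y vs) (at x) u"

lemma ext_deriv_alternation: "ext_deriv \<omega> c x = alternation (total_derivative \<omega> x)"
  by (simp add: fun_eq_iff ext_deriv_def alternation_def total_derivative_def)

lemma total_derivative:
  "smooth_family \<omega> \<Longrightarrow> x \<in> U \<Longrightarrow> ((\<lambda>y. \<omega> c y vs) has_derivative (\<lambda>u. total_derivative \<omega> x u vs)) (at x)"
  unfolding total_derivative_def by (rule smooth_on_has_derivative[OF smooth_familyD(2)])

lemma total_derivative_unique:
  assumes "smooth_family \<omega>" "x \<in> U" "((\<lambda>y. \<omega> c y vs) has_derivative D) (at x)"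
  shows "total_derivative \<omega> x u vs = D u"
  using has_derivative_unique[OF total_derivative[OF assms(1,2)] assms(3)] by (rule fun_cong)

lemma form_family_smooth: "smooth_family \<omega> \<Longrightarrow> form_family U (\<omega> c)"
  by (simp add: form_family_def open_image smooth_familyD)

lemma smooth_family_ext_deriv:
  assumes \<omega>: "smooth_family \<omega>"
  shows "smooth_family (ext_deriv \<omega>)"
  unfolding smooth_family_def
proof (intro conjI ballI allI)
  fix x assume x: "x \<in> U"
  show "exterior (ext_deriv \<omega> c x)"
    unfolding ext_deriv_alternation
    by (intro exterior_alternation form_family.exterior_derivative[OF form_family_smooth[OF \<omega>] x]
         total_derivative[OF \<omega> x] has_derivative_linear[OF total_derivative[OF \<omega> x]])
next
  show "smooth_on (\<lambda>x. ext_deriv \<omega> c x vs) U" for vs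
    unfolding ext_deriv_def
    by (intro smooth_on_sum smooth_on_cmult smooth_on_derivative smooth_familyD \<omega> open_image)
qed

lemma ext_deriv_cong:
  assumes "smooth_family \<omega>" "\<And>y. y \<in> U \<Longrightarrow> \<omega> c y = \<eta> c y" "x \<in> U"
  shows "ext_deriv \<omega> c x = ext_deriv \<eta> c x"
proof -
  have "total_derivative \<omega> x u vs = total_derivative \<eta> x u vs" for u vs
  proof -
    have "((\<lambda>y. \<eta> c y vs) has_derivative (\<lambda>u. total_derivative \<omega> x u vs)) (at x)"
      by (rule has_derivative_transform_within_open[OF total_derivative[OF assms(1,3)] open_image assms(3)])
         (simp add: assms(2))
    from fun_cong[OF frechet_derivative_at[OF this]] show ?thesis
      by (simp add: total_derivative_def)
  qed
  then show ?thesis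
    unfolding ext_deriv_alternation by (metis ext)
qed

lemma ext_deriv_zero:
  assumes "\<And>y. y \<in> U \<Longrightarrow> \<omega> c y = (\<lambda>vs. 0)" "x \<in> U"
  shows "ext_deriv \<omega> c x = (\<lambda>vs. 0)"
proof -
  let ?z = "(\<lambda>c y vs. 0) :: ('a, 'n) form_field"
  have "smooth_family ?z"
    by (simp add: smooth_family_def exterior_zero smooth_on_const open_image)
  then have "ext_deriv ?z c x = ext_deriv \<omega> c x"
    using assms by (intro ext_deriv_cong) simp_all
  then show ?thesis
    by (simp add: ext_deriv_def[abs_def])
qed

lemma smooth_family_sum:
  "(\<And>i. i \<in> I \<Longrightarrow> smooth_family (\<omega> i)) \<Longrightarrow> smooth_family (\<lambda>c x vs. \<Sum>i\<in>I. \<omega> i c x vs)"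
  by (auto simp: smooth_family_def open_image intro!: exterior_sum smooth_on_sum)

lemma ext_deriv_sum:
  assumes "\<And>i. i \<in> I \<Longrightarrow> smooth_family (\<omega> i)" "x \<in> U"
  shows "ext_deriv (\<lambda>c x vs. \<Sum>i\<in>I. \<omega> i c x vs) c x vs = (\<Sum>i\<in>I. ext_deriv (\<omega> i) c x vs)"
proof -
  have "total_derivative (\<lambda>c x vs. \<Sum>i\<in>I. \<omega> i c x vs) x u vs = (\<Sum>i\<in>I. total_derivative (\<omega> i) x u vs)" for u vs
    by (intro total_derivative_unique smooth_family_sum has_derivative_sum total_derivative assms)
  then have "total_derivative (\<lambda>c x vs. \<Sum>i\<in>I. \<omega> i c x vs) x = (\<lambda>u vs. \<Sum>i\<in>I. total_derivative (\<omega> i) x u vs)"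
    by (intro ext)
  then show ?thesis
    unfolding ext_deriv_alternation by (simp add: alternation_sum)
qed

lemma ext_deriv_ext_deriv:
  assumes \<omega>: "smooth_family \<omega>" and x: "x \<in> U"
  shows "ext_deriv (ext_deriv \<omega>) c x = (\<lambda>vs. 0)"
proof -
  define S where "S u v vs = frechet_derivative (\<lambda>y. frechet_derivative (\<lambda>z. \<omega> c z vs) (at y) v) (at x) u" for u v vs
  have "total_derivative (ext_deriv \<omega>) x u vs = alternation (S u) vs" for u vs
    unfolding alternation_def S_def
  proof (rule total_derivative_unique[OF smooth_family_ext_deriv[OF \<omega>] x])
    show "((\<lambda>y. ext_deriv \<omega> c y vs) has_derivative
      (\<lambda>u. \<Sum>m<length vs. (- 1) ^ m * frechet_derivative (\<lambda>y. frechet_derivative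
        (\<lambda>z. \<omega> c z (take m vs @ drop (Suc m) vs)) (at y) (vs ! m)) (at x) u)) (at x)"
      unfolding ext_deriv_def
      by (intro has_derivative_sum has_derivative_mult_right
           smooth_on_has_derivative[OF smooth_on_derivative[OF smooth_familyD(2)[OF \<omega>]] x])
  qed
  then have "total_derivative (ext_deriv \<omega>) x = (\<lambda>u. alternation (S u))"
    by (intro ext)
  moreover have "S u v = S v u" for u v
    unfolding S_def by (rule ext) (rule second_derivative_symmetric[OF open_image x smooth_familyD(2)[OF \<omega>]])
  ultimately show ?thesis
    unfolding ext_deriv_alternation by (simp add: alternation_alternation_symmetric)
qed

lemma has_type_negative: "has_type k r \<omega> \<Longrightarrow> r < 0 \<Longrightarrow> x \<in> U \<Longrightarrow> \<omega> c x = (\<lambda>vs. 0)"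
  by (simp add: has_type_def E_fibre_def)

lemma E_fibre_zero: "x \<in> U \<Longrightarrow> (\<lambda>vs. 0) \<in> E_fibre Q c x k r"
  using ex_frame[of x] frame.eigenspace_zero[OF frame_in] by (auto simp: E_fibre_eq)

lemma E_fibre_exterior: "\<alpha> \<in> E_fibre Q c x k r \<Longrightarrow> exterior \<alpha>"
  by (simp add: E_fibre_def exterior_power_def)

lemma ext_deriv_components:
  assumes \<omega>: "has_type k r \<omega>" and x: "x \<in> U"
  shows "\<exists>a\<in>E_fibre Q c x (k + 1) (r + 1). \<exists>b\<in>E_fibre Q c x (k + 1) (r - 1). ext_deriv \<omega> c x = (\<lambda>vs. a vs + b vs)"
proof (cases "r < 0")
  case True
  then have "ext_deriv \<omega> c x = (\<lambda>vs. 0 + 0)"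
    using ext_deriv_zero[of \<omega> x] has_type_negative[OF \<omega>] x by simp
  then show ?thesis
    using E_fibre_zero[OF x] by (intro bexI[of _ "\<lambda>vs. 0"]) auto
next
  case False
  obtain W s G \<theta> where W: "connection_at W s x G \<theta>" "W \<subseteq> U" "\<And>y. y \<in> W \<Longrightarrow> s y \<in> Q c y"
    using obtain_section[OF x] by metis
  have sx: "s x \<in> Q c x"
    by (rule W(3)[OF connection_at.x[OF W(1)]])
  show ?thesis
    unfolding E_fibre_eq[OF x sx] ext_deriv_alternation
  proof (rule connection_at.exterior_derivative_components[OF W(1)])
    show "\<omega> c y \<in> eigenspace (s y) k r" if y: "y \<in> W" for y
    proof -
      have "y \<in> U"
        using y W(2) by blast
      then show ?thesis
        using \<omega> by (simp add: has_type_def flip: E_fibre_eq[OF _ W(3)[OF y]])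
    qed
    show "((\<lambda>y. \<omega> c y vs) has_derivative (\<lambda>u. total_derivative \<omega> x u vs)) (at x)" for vs
      using \<omega> x by (intro total_derivative) (simp_all add: has_type_def)
  qed (use False in simp)
qed

lemma proj_ext_deriv:
  assumes \<omega>: "has_type k r \<omega>" and x: "x \<in> U" and r: "r \<le> int k"
  shows "ext_deriv \<omega> c x vs = proj Q (k + 1) (r + 1) (ext_deriv \<omega>) c x vs + proj Q (k + 1) (r - 1) (ext_deriv \<omega>) c x vs"
    and "q \<le> int k + 1 \<Longrightarrow> q \<noteq> r + 1 \<Longrightarrow> q \<noteq> r - 1 \<Longrightarrow> proj Q (k + 1) q (ext_deriv \<omega>) c x vs = 0"
proof -
  obtain a b where a: "a \<in> E_fibre Q c x (k + 1) (r + 1)" and b: "b \<in> E_fibre Q c x (k + 1) (r - 1)"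
    and ab: "ext_deriv \<omega> c x = (\<lambda>vs. a vs + b vs)"
    using ext_deriv_components[OF \<omega> x] by blast
  have p: "proj Q (k + 1) q (ext_deriv \<omega>) c x vs =
      (if q = r + 1 then a else (\<lambda>vs. 0)) vs + (if q = r - 1 then b else (\<lambda>vs. 0)) vs" if "q \<le> int k + 1" for q
  proof -
    have "proj Q (k + 1) q (ext_deriv \<omega>) c x vs = proj Q (k + 1) q (\<lambda>c x vs. a vs + b vs) c x vs"
      using ab by (intro fun_cong[OF proj_cong])
    also have "\<dots> = proj Q (k + 1) q (\<lambda>c x. a) c x vs + proj Q (k + 1) q (\<lambda>c x. b) c x vs"
      using that E_fibre_exterior[OF a] E_fibre_exterior[OF b] by (intro proj_add x) simp_all
    finally show ?thesis
      using proj_E_fibre[where \<omega>="\<lambda>c x. a", OF x a, of q "k + 1"] proj_E_fibre[where \<omega>="\<lambda>c x. b", OF x b, of q "k + 1"] that r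
      by simp
  qed
  show "ext_deriv \<omega> c x vs = proj Q (k + 1) (r + 1) (ext_deriv \<omega>) c x vs + proj Q (k + 1) (r - 1) (ext_deriv \<omega>) c x vs"
    using p[of "r + 1"] p[of "r - 1"] r by (simp add: ab)
  show "proj Q (k + 1) q (ext_deriv \<omega>) c x vs = 0" if "q \<le> int k + 1" "q \<noteq> r + 1" "q \<noteq> r - 1"
    using p[OF that(1)] that by simp
qed

subsection \<open>The operators\<close>

definition weights :: "(nat \<times> int) set" where
  "weights = (SIGMA k:{0..4 * CARD('n)}. {0..int k})"

definition component_op :: "int \<Rightarrow> ('a, 'n) form_field \<Rightarrow> nat \<times> int \<Rightarrow> ('a, 'n) form_field" where
  "component_op e \<omega> i = proj Q (fst i + 1) (snd i + e) (ext_deriv (proj Q (fst i) (snd i) \<omega>))"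

text \<open>Both operators at once: \<open>e\<close> is the change of weight, 1 or -1, so that the
  bookkeeping on types is done a single time.\<close>

definition shift_op :: "int \<Rightarrow> ('a, 'n) form_field \<Rightarrow> ('a, 'n) form_field" where
  "shift_op e \<omega> c' x vs = (\<Sum>i\<in>weights. component_op e \<omega> i c' x vs)"

lemma finite_weights: "finite weights"
  by (simp add: weights_def)

lemma shift_op_eq: "D_op Q = shift_op 1" "Dbar_op Q = shift_op (- 1)"
  by (simp_all add: fun_eq_iff D_op_def Dbar_op_def shift_op_def component_op_def weights_def sum.Sigma case_prod_unfold)

lemma smooth_family_component:
  "smooth_family \<omega> \<Longrightarrow> e \<le> 1 \<Longrightarrow> i \<in> weights \<Longrightarrow> has_type (fst i + 1) (snd i + e) (component_op e \<omega> i)"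
  unfolding component_op_def
  by (intro has_type_proj smooth_family_ext_deriv smooth_family_proj) (auto simp: weights_def)

lemma shift_op_sum:
  assumes \<omega>: "\<And>i. i \<in> I \<Longrightarrow> smooth_family (\<omega> i)" and x: "x \<in> U" and e: "e \<le> 1"
  shows "shift_op e (\<lambda>c x vs. \<Sum>i\<in>I. \<omega> i c x vs) c x vs = (\<Sum>i\<in>I. shift_op e (\<omega> i) c x vs)"
proof -
  have "component_op e (\<lambda>c x vs. \<Sum>i\<in>I. \<omega> i c x vs) j c x vs = (\<Sum>i\<in>I. component_op e (\<omega> i) j c x vs)"
    if j: "j \<in> weights" for j
  proof -
    have l: "snd j \<le> int (fst j)" "snd j + e \<le> int (fst j + 1)"
      using j e by (auto simp: weights_def)
    have "ext_deriv (proj Q (fst j) (snd j) (\<lambda>c x vs. \<Sum>i\<in>I. \<omega> i c x vs)) c x =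
        ext_deriv (\<lambda>c x vs. \<Sum>i\<in>I. proj Q (fst j) (snd j) (\<omega> i) c x vs) c x"
      by (intro ext_deriv_cong smooth_family_proj smooth_family_sum \<omega> l x ext proj_sum smooth_familyD)
    also have "\<dots> = (\<lambda>vs. \<Sum>i\<in>I. ext_deriv (proj Q (fst j) (snd j) (\<omega> i)) c x vs)"
      by (intro ext ext_deriv_sum smooth_family_proj \<omega> l x)
    finally have "proj Q (fst j + 1) (snd j + e) (ext_deriv (proj Q (fst j) (snd j) (\<lambda>c x vs. \<Sum>i\<in>I. \<omega> i c x vs))) c x =
        proj Q (fst j + 1) (snd j + e) (\<lambda>c x vs. \<Sum>i\<in>I. ext_deriv (proj Q (fst j) (snd j) (\<omega> i)) c x vs) c x"
      by (rule proj_cong)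
    then show ?thesis
      unfolding component_op_def
      by (simp only:) (intro proj_sum smooth_familyD smooth_family_ext_deriv smooth_family_proj \<omega> l x)
  qed
  then show ?thesis
    unfolding shift_op_def by (simp add: sum.swap[of _ I])
qed

text \<open>A form of pure type has a single nonzero component, so only the summand at (k, r) can
  survive.\<close>

lemma shift_op_has_type:
  assumes \<eta>: "has_type k r \<eta>" and x: "x \<in> U" and e: "e \<le> 1" and r: "r \<le> int k"
  shows "shift_op e \<eta> c x vs = proj Q (k + 1) (r + e) (ext_deriv \<eta>) c x vs"
proof -
  have s: "smooth_family \<eta>"
    using \<eta> by (simp add: has_type_def)
  have p: "proj Q l q \<eta> c y = (if l = k \<and> q = r then \<eta> c y else (\<lambda>vs. 0))" if "y \<in> U" "q \<le> int l" for l q y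
    using \<eta> that r by (intro proj_E_fibre) (auto simp: has_type_def)
  have c: "component_op e \<eta> i c x vs = (if i = (k, r) then proj Q (k + 1) (r + e) (ext_deriv \<eta>) c x vs else 0)"
    if i: "i \<in> weights" for i
  proof (cases "i = (k, r)")
    case True
    have "ext_deriv (proj Q k r \<eta>) c x = ext_deriv \<eta> c x"
      by (intro ext_deriv_cong smooth_family_proj s r x) (simp add: p r)
    then have "proj Q (k + 1) (r + e) (ext_deriv (proj Q k r \<eta>)) c x = proj Q (k + 1) (r + e) (ext_deriv \<eta>) c x"
      by (rule proj_cong)
    then show ?thesis
      using True by (simp add: component_op_def)
  next
    case False
    have "ext_deriv (proj Q (fst i) (snd i) \<eta>) c x = (\<lambda>vs. 0)"
      using i False x by (intro ext_deriv_zero) (auto simp: p weights_def prod_eq_iff)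
    then show ?thesis
      using False i e by (auto simp: component_op_def proj_zero[OF x] weights_def)
  qed
  show ?thesis
  proof (cases "(k, r) \<in> weights")
    case True
    then show ?thesis
      using finite_weights by (simp add: shift_op_def c cong: sum.cong)
  next
    \<comment> \<open>Types outside \<open>weights\<close> do occur: the operators can reach the
      degree 4n + 1 or the weight -1. In both situations the form is zero.\<close>
    case False
    then have "\<eta> c y = (\<lambda>vs. 0)" if y: "y \<in> U" for y
    proof (cases "r < 0")
      case True
      then show ?thesis
        using has_type_negative[OF \<eta>] y by blast
    next
      case f: False
      then have k: "k > 4 * CARD('n)"
        using False r by (auto simp: weights_def)
      have p: "\<eta> c y \<in> exterior_power k"
        using \<eta> y by (auto simp: has_type_def E_fibre_def)
      show ?thesis
      proof
        show "\<eta> c y vs = 0" for vs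
          using exterior_power_degree[OF p, of vs] exterior_zero_above_dim[OF exterior_power_exterior[OF p], of vs] k
          by (cases "length vs = k") simp_all
      qed
    qed
    then have "ext_deriv \<eta> c x = (\<lambda>vs. 0)"
      using x by (rule ext_deriv_zero)
    then have "proj Q (k + 1) (r + e) (ext_deriv \<eta>) c x vs = 0"
      using proj_zero[OF x, of "ext_deriv \<eta>" "r + e" "k + 1"] r e by simp
    then show ?thesis
      using False c by (auto simp: shift_op_def intro!: sum.neutral)
  qed
qed

lemma sum_components:
  assumes \<omega>: "exterior (\<omega> c x)" and x: "x \<in> U"
  shows "\<omega> c x vs = (\<Sum>i\<in>weights. proj Q (fst i) (snd i) \<omega> c x vs)"
proof -
  have "(\<Sum>i\<in>weights. proj Q (fst i) (snd i) \<omega> c x vs) = (\<Sum>k = 0..4 * CARD('n). degree_part k (\<omega> c x) vs)"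
    unfolding weights_def using proj_in(2)[where \<omega>=\<omega>, OF x \<omega> order_refl]
    by (simp add: sum.Sigma case_prod_unfold)
  also have "\<dots> = (if length vs \<le> 4 * CARD('n) then \<omega> c x vs else 0)"
    by (simp add: degree_part_def)
  also have "\<dots> = \<omega> c x vs"
    using exterior_zero_above_dim[OF \<omega>, of vs] by auto
  finally show ?thesis ..
qed

lemma shift_op_component:
  assumes \<omega>: "smooth_family \<omega>" and x: "x \<in> U" and i: "i \<in> weights" and e: "e \<le> 1" "e' \<le> 1"
  shows "shift_op e (component_op e' \<omega> i) c x vs =
     proj Q (fst i + 2) (snd i + e' + e) (ext_deriv (component_op e' \<omega> i)) c x vs"
  using shift_op_has_type[OF smooth_family_component[OF \<omega> e(2) i] x e(1)] i e by (auto simp: weights_def)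

lemma ext_deriv_decomposition:
  assumes \<omega>: "smooth_family \<omega>" and x: "x \<in> U"
  shows "ext_deriv \<omega> c x vs = shift_op 1 \<omega> c x vs + shift_op (- 1) \<omega> c x vs"
proof -
  have t: "has_type (fst i) (snd i) (proj Q (fst i) (snd i) \<omega>)" "snd i \<le> int (fst i)" if "i \<in> weights" for i
    using that by (auto simp: weights_def intro!: has_type_proj[OF \<omega>])
  have "ext_deriv \<omega> c x vs = ext_deriv (\<lambda>c x vs. \<Sum>i\<in>weights. proj Q (fst i) (snd i) \<omega> c x vs) c x vs"
    by (intro fun_cong[OF ext_deriv_cong] \<omega> x ext sum_components smooth_familyD)
  also have "\<dots> = (\<Sum>i\<in>weights. ext_deriv (proj Q (fst i) (snd i) \<omega>) c x vs)"
    using t by (intro ext_deriv_sum x) (auto simp: has_type_def)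
  also have "\<dots> = (\<Sum>i\<in>weights. component_op 1 \<omega> i c x vs + component_op (- 1) \<omega> i c x vs)"
    using proj_ext_deriv(1)[OF t(1) x t(2)] by (intro sum.cong refl) (simp add: component_op_def)
  finally show ?thesis
    by (simp add: shift_op_def sum.distrib)
qed

text \<open>For one component \<eta> the parts \<open>a\<close> and \<open>b\<close> of its
  derivative have the weights r + 1 and r - 1, and the sum of their derivatives vanishes. Projecting
  that relation to one weight at a time separates the identities.\<close>

lemma component_op_square:
  assumes \<omega>: "smooth_family \<omega>" and x: "x \<in> U" and i: "i \<in> weights"
  shows "shift_op 1 (component_op 1 \<omega> i) c x vs = 0"
    and "shift_op 1 (component_op (- 1) \<omega> i) c x vs + shift_op (- 1) (component_op 1 \<omega> i) c x vs = 0"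
    and "shift_op (- 1) (component_op (- 1) \<omega> i) c x vs = 0"
proof -
  obtain k r where kr: "i = (k, r)" "0 \<le> r" "r \<le> int k"
    using i by (auto simp: weights_def)
  define \<eta> where "\<eta> = proj Q k r \<omega>"
  define a b where "a = component_op 1 \<omega> i" and "b = component_op (- 1) \<omega> i"
  have \<eta>: "has_type k r \<eta>"
    unfolding \<eta>_def using kr by (intro has_type_proj \<omega>)
  have a: "has_type (k + 1) (r + 1) a" and b: "has_type (k + 1) (r - 1) b"
    using smooth_family_component[OF \<omega> _ i, of 1] smooth_family_component[OF \<omega> _ i, of "- 1"]
    by (simp_all add: a_def b_def kr)
  have sa: "smooth_family a" and sb: "smooth_family b" and s\<eta>: "smooth_family \<eta>"
    using a b \<eta> by (simp_all add: has_type_def)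
  \<comment> \<open>Written as a sum over the booleans so that the lemmas on finite sums of forms
    apply to a + b.\<close>
  have ab: "ext_deriv \<eta> c y vs = (\<Sum>j\<in>{True, False}. (if j then a else b) c y vs)" if "y \<in> U" for y vs
    using proj_ext_deriv(1)[OF \<eta> that kr(3)] by (simp add: a_def b_def component_op_def kr \<eta>_def)
  have "ext_deriv a c x vs + ext_deriv b c x vs = 0" for vs
  proof -
    have "0 = ext_deriv (ext_deriv \<eta>) c x vs"
      by (simp add: ext_deriv_ext_deriv[OF s\<eta> x])
    also have "\<dots> = ext_deriv (\<lambda>c y vs. \<Sum>j\<in>{True, False}. (if j then a else b) c y vs) c x vs"
      by (intro fun_cong[OF ext_deriv_cong] smooth_family_ext_deriv s\<eta> x ext ab)
    also have "\<dots> = (\<Sum>j\<in>{True, False}. ext_deriv (if j then a else b) c x vs)"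
      using sa sb by (intro ext_deriv_sum x) auto
    finally show ?thesis
      by simp
  qed
  then have z: "proj Q (k + 2) q (\<lambda>c x vs. ext_deriv a c x vs + ext_deriv b c x vs) c x = (\<lambda>vs. 0)"
    if "q \<le> int (k + 2)" for q
    using that by (intro proj_zero x ext)
  have s: "proj Q (k + 2) q (ext_deriv a) c x vs + proj Q (k + 2) q (ext_deriv b) c x vs = 0"
    if "q \<le> int (k + 2)" for q
    using fun_cong[OF z[OF that], of vs] smooth_familyD(1)[OF smooth_family_ext_deriv x] sa sb
    by (subst (asm) proj_add[OF x _ _ that]) auto
  have S: "shift_op e a c x vs = proj Q (k + 2) (r + 1 + e) (ext_deriv a) c x vs"
    "shift_op e b c x vs = proj Q (k + 2) (r - 1 + e) (ext_deriv b) c x vs" if "e \<le> 1" for e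
    using shift_op_component[OF \<omega> x i that, of 1] shift_op_component[OF \<omega> x i that, of "- 1"] kr(1)
    by (simp_all add: a_def b_def)
  \<comment> \<open>The derivative of \<open>b\<close> only has the weights r and r - 2, so the
    weight r + 2 part of the relation involves \<open>a\<close> alone.\<close>
  have "proj Q (k + 1 + 1) (r + 2) (ext_deriv b) c x vs = 0"
    using kr by (intro proj_ext_deriv(2)[OF b x]) auto
  then show "shift_op 1 (component_op 1 \<omega> i) c x vs = 0"
    using s[of "r + 2"] kr unfolding a_def[symmetric] b_def[symmetric] by (simp add: S algebra_simps)
  have "proj Q (k + 1 + 1) (r - 2) (ext_deriv a) c x vs = 0"
    using kr by (intro proj_ext_deriv(2)[OF a x]) auto
  then show "shift_op (- 1) (component_op (- 1) \<omega> i) c x vs = 0"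
    using s[of "r - 2"] kr unfolding a_def[symmetric] b_def[symmetric] by (simp add: S algebra_simps)
  show "shift_op 1 (component_op (- 1) \<omega> i) c x vs + shift_op (- 1) (component_op 1 \<omega> i) c x vs = 0"
    using s[of r] kr unfolding a_def[symmetric] b_def[symmetric] by (simp add: S algebra_simps)
qed

lemma shift_op_square:
  assumes \<omega>: "smooth_family \<omega>" and x: "x \<in> U"
  shows "shift_op 1 (shift_op 1 \<omega>) c x vs = 0"
    and "shift_op 1 (shift_op (- 1) \<omega>) c x vs + shift_op (- 1) (shift_op 1 \<omega>) c x vs = 0"
    and "shift_op (- 1) (shift_op (- 1) \<omega>) c x vs = 0"
proof -
  have "shift_op e (shift_op e' \<omega>) c x vs = (\<Sum>i\<in>weights. shift_op e (component_op e' \<omega> i) c x vs)"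
    if "e \<le> 1" "e' \<le> 1" for e e'
    unfolding shift_op_def[of e' \<omega>, abs_def]
    using smooth_family_component[OF \<omega> that(2)] by (intro shift_op_sum x that) (auto simp: has_type_def)
  then show "shift_op 1 (shift_op 1 \<omega>) c x vs = 0"
    and "shift_op 1 (shift_op (- 1) \<omega>) c x vs + shift_op (- 1) (shift_op 1 \<omega>) c x vs = 0"
    and "shift_op (- 1) (shift_op (- 1) \<omega>) c x vs = 0"
    using component_op_square[OF \<omega> x] by (simp_all flip: sum.distrib)
qed

end

theorem proposition4p5:
  fixes X :: "'a topology"
    and A :: "('a, 'n::finite) chart set"
    and Q :: "('a, 'n) frame_bundle"
    and \<omega> :: "('a, 'n) form_field"
  assumes "quaternionic_manifold X A Q"
    and "smooth_form A \<omega>"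
  shows "\<forall>c\<in>A. \<forall>x\<in>chart_image c. \<forall>vs.
      ext_deriv \<omega> c x vs = D_op Q \<omega> c x vs + Dbar_op Q \<omega> c x vs \<and>
      D_op Q (D_op Q \<omega>) c x vs = 0 \<and>
      D_op Q (Dbar_op Q \<omega>) c x vs + Dbar_op Q (D_op Q \<omega>) c x vs = 0 \<and>
      Dbar_op Q (Dbar_op Q \<omega>) c x vs = 0"
proof (intro ballI allI)
  fix c x vs assume c: "c \<in> A" and x: "x \<in> chart_image c"
  interpret quaternionic_chart Q c
  proof
    show "open (chart_image c)"
      using assms(1) c by (simp add: quaternionic_manifold_def smooth_manifold_def)
    show "linear f \<and> bij f \<and> Q c x = {f \<circ> h |h. h \<in> Sp1GL}" if "x \<in> chart_image c" "f \<in> Q c x" for x f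
      using assms(1) c that by (simp add: quaternionic_manifold_def Sp1GL_structure_def)
    show "\<exists>W s G \<theta>. connection_at W s x G \<theta> \<and> W \<subseteq> chart_image c \<and> (\<forall>y\<in>W. s y \<in> Q c y)"
      if "x \<in> chart_image c" for x
      by (rule quaternionic_manifold_connection[OF assms(1) c that])
  qed
  have "smooth_family \<omega>"
    using assms(2) c by (simp add: smooth_form_def smooth_family_def)
  then show "ext_deriv \<omega> c x vs = D_op Q \<omega> c x vs + Dbar_op Q \<omega> c x vs \<and>
      D_op Q (D_op Q \<omega>) c x vs = 0 \<and>
      D_op Q (Dbar_op Q \<omega>) c x vs + Dbar_op Q (D_op Q \<omega>) c x vs = 0 \<and>
      Dbar_op Q (Dbar_op Q \<omega>) c x vs = 0"
    unfolding shift_op_eq using ext_deriv_decomposition[OF _ x] shift_op_square[OF _ x] by blast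
qed

end
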